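(* Let $m,n$ be positive integers. For $k=1,\dots,2m$, let $X_k$ be an $n\times n$ Hermitian matrix with eigenvalues $x_{k,1},\dots,x_{k,n}$, and denote $s_\lambda(x_{k,1},\dots,x_{k,n})$ by $s_\lambda(X_k)$. Then $$\int_{U(n)}\cdots\int_{U(n)} \exp\left(\operatorname{tr}\prod_{k=1}^{2m} U_kX_kU_k^{-1}\right)\prod_{k=1}^{2m}\mathrm{d}U_k = \beta_n\sum_\lambda \frac{1}{\prod_{j=1}^n(\lambda_j+n-j)!}\cdot\frac{1}{(s_\lambda(I_n))^{2m-2}}\prod_{k=1}^{2m}s_\lambda(X_k),$$ where the sum is over all partitions $\lambda=(\lambda_1,\dots,\lambda_n)$, $\lambda_1\ge\cdots\ge\lambda_n\ge 0$, of all nonnegative integers, of length at most $n$.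
   Context: $U(n)$ is the group of $n\times n$ unitary matrices and $\mathrm{d}U$ is its Haar measure normalized to have total volume $1$. The matrix product is taken in the order $k=1,2,\dots,2m$. The constant is $\beta_n=\prod_{j=1}^n (j-1)!$. For a partition $\lambda=(\lambda_1,\dots,\lambda_n)$, $s_\lambda(x_1,\dots,x_n)$ is the Schur function (polynomial) $\det\bigl(x_r^{\lambda_s+n-s}\bigr)_{1\le r,s\le n}\big/\prod_{1\le r<s\le n}(x_r-x_s)$, extended as a polynomial to coinciding arguments. $I_n$ is the $n\times n$ identity matrix, so $s_\lambda(I_n)=s_\lambda(1,\dots,1)=\prod_{1\le i<j\le n}(\lambda_i-\lambda_j-i+j)\big/\prod_{j=1}^n (j-1)!$. *)

theory Defs
  imports
    "Jordan_Normal_Form.Determinant"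
    "HOL-Analysis.Analysis"
begin

(* Matrices over which we integrate are of type complex^'n^'n, so that the size is CARD('n) and
   the Borel structure is the library's.  Everything indexed by the ordered set {1..n}
   (eigenvalues, parts of partitions) is a function on nat, with 1-based indices.
   Both imports have a constant det and a constant mat; they are always qualified here. *)

definition conj_transpose :: "complex^'n^'m \<Rightarrow> complex^'m^'n" where
  "conj_transpose A = map_matrix cnj (transpose A)"

definition hermitian_matrix :: "complex^'n^'n \<Rightarrow> bool" where
  "hermitian_matrix A \<longleftrightarrow> conj_transpose A = A"

definition unitary_group :: "(complex^'n^'n) set" where
  "unitary_group =
     {U. U ** conj_transpose U = Finite_Cartesian_Product.mat 1 \<and>
         conj_transpose U ** U = Finite_Cartesian_Product.mat 1}"

(* Left-invariant Borel probability measures on the unitary group.  By the theorem on existence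
   and uniqueness of Haar measure there is exactly one such measure. *)
definition normalized_haar_measure :: "(complex^'n^'n) measure \<Rightarrow> bool" where
  "normalized_haar_measure H \<longleftrightarrow>
     sets H = sets (restrict_space borel unitary_group) \<and>
     emeasure H (space H) = 1 \<and>
     (\<forall>V\<in>unitary_group. \<forall>A\<in>sets H. emeasure H ((\<lambda>U. V ** U) ` A) = emeasure H A)"

(* x 1, ..., x n are the eigenvalues of A, listed with algebraic multiplicity: they are the roots
   of the characteristic polynomial of A. *)
definition has_eigenvalues :: "complex^'n^'n \<Rightarrow> (nat \<Rightarrow> complex) \<Rightarrow> bool" where
  "has_eigenvalues A x \<longleftrightarrow>
     (\<forall>t. Determinants.det (Finite_Cartesian_Product.mat t - A) = (\<Prod>i=1..CARD('n). t - x i))"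

(* The product A a ** A (a + 1) ** ... ** A b, in this order.  The multiplication of the type
   class monoid_mult is componentwise on this type, so prod_list cannot be used. *)
definition ordered_matrix_prod ::
  "nat \<Rightarrow> nat \<Rightarrow> (nat \<Rightarrow> complex^'n^'n) \<Rightarrow> complex^'n^'n" where
  "ordered_matrix_prod a b A =
     foldr (**) (map A [a..<Suc b]) (Finite_Cartesian_Product.mat 1)"

(* Partitions of length at most n; the parts are extended by 0 outside {1..n}, so that each
   partition is represented by exactly one function. *)
definition partitions_len :: "nat \<Rightarrow> (nat \<Rightarrow> nat) set" where
  "partitions_len n = {lam. antimono_on {1..n} lam \<and> (\<forall>i. i \<notin> {1..n} \<longrightarrow> lam i = 0)}"

definition poly_fun :: "nat \<Rightarrow> ((nat \<Rightarrow> 'a::field_char_0) \<Rightarrow> 'a) \<Rightarrow> bool" where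
  "poly_fun n f \<longleftrightarrow>
     (\<exists>(E :: (nat \<Rightarrow> nat) set) c. finite E \<and>
        (\<forall>x. f x = (\<Sum>e\<in>E. c e * (\<Prod>i=1..n. x i ^ e i))))"

definition vandermonde_prod :: "nat \<Rightarrow> (nat \<Rightarrow> 'a::field_char_0) \<Rightarrow> 'a" where
  "vandermonde_prod n x = (\<Prod>s=1..n. \<Prod>r\<in>{1..<s}. x r - x s)"

(* Matrix.mat is indexed from 0, hence the Suc. *)
definition alternant :: "nat \<Rightarrow> (nat \<Rightarrow> nat) \<Rightarrow> (nat \<Rightarrow> 'a::field_char_0) \<Rightarrow> 'a" where
  "alternant n lam x =
     Determinant.det (Matrix.mat n n (\<lambda>(r, s). x (Suc r) ^ (lam (Suc s) + n - Suc s)))"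

(* The ratio of alternants defines the Schur polynomial at points with distinct coordinates; it is
   extended to all points as the (unique) polynomial function in n variables agreeing with it. *)
definition schur :: "nat \<Rightarrow> (nat \<Rightarrow> nat) \<Rightarrow> (nat \<Rightarrow> 'a::field_char_0) \<Rightarrow> 'a" where
  "schur n lam =
     (THE f. poly_fun n f \<and>
        (\<forall>x. inj_on x {1..n} \<longrightarrow> f x = alternant n lam x / vandermonde_prod n x))"

definition beta :: "nat \<Rightarrow> real" where
  "beta n = (\<Prod>j=1..n. fact (j - 1))"

end

theory Submission
  imports Defs "HOL-Computational_Algebra.Fundamental_Theorem_Algebra"
begin

text \<open>Expand the exponential: exp (tr M) is the sum of (tr M)^d / d! over d. In the eigenvalues of M the
trace is the first power sum, and its d-th power is a combination of the Schur functions of the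
partitions of d, with coefficients d! beta_n s_lam(I) / prod_j (lam_j + n - j)!
(power_sum_expansion, expcoef_eq, and trace_power_expansion on the level of matrices). It
therefore suffices to integrate s_lam of the product. The identity

  int s_lam(A U B U^-1) dU = s_lam(A) s_lam(B) / s_lam(I)

(haar_average_matschur) removes one factor U_k X_k U_k^-1 at a time, and leaves
prod_k s_lam(X_k) / s_lam(I)^(2m-1). One power of s_lam(I) cancels against the coefficient, which
gives the exponent 2m-2. Dominated convergence sums over d. The sum over all partitions converges
absolutely: if the 2m matrices are equal, all terms are nonnegative, because 2m is even, so that
the convergent partial sums bound every finite sum; in general the absolute value of a term is at
most the sum of the 2m terms with equal matrices.

The averaging identity is usually read off from Schur's lemma for the representation with
character s_lam. The proof below replaces representations by a differential operator. Let g(A) be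
the left side as a function of A. It is a polynomial in the entries of A, and invariant under
unitary conjugation because Haar measure is invariant under translation. Such a function is
determined by its values on real diagonal matrices with distinct entries (uclass_eqI): Hermitian
matrices are unitarily diagonalizable, and every matrix is P + iQ with P, Q Hermitian, the value at
t = i of a polynomial family that is Hermitian for real t. It remains to show that
g is a multiple of s_lam there; the multiple is found at A = I. Two properties identify g.

The Casimir operator, sum over a, b of L_ab L_ba with L_ab the derivative along A -> E_ab A,
commutes with A -> A M for every M. So, if s_lam is an eigenfunction, g is one for the same
eigenvalue. On the diagonal, after multiplication by the Vandermonde product, the operator acts on
monomials by scalars (vdm_casimir): x^k is multiplied by a quadratic function of the exponent k.
The product of the Vandermonde product and s_lam is the alternant with exponents lam + delta, whose
monomials differ by permutations of the exponents and have the same eigenvalue.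

The exponents of the entries of a diagonal matrix D in s_lam(D M) lie in the permutohedron of lam
(matschur_exists), hence so do those in g(D M). Together with the exponents of the Vandermonde
product they lie in the permutohedron of lam + delta. In it the total is constant, so the
eigenvalue depends only on the sum of squares, and this is maximal exactly at the permutations of
lam + delta (dominated_extremal). Only these monomials can occur. By the antisymmetry of the product of g with the Vandermonde
product they combine into a multiple of one alternant (eigenfunction_unique).\<close>

section \<open>Alternating sums over permutations\<close>

text \<open>The Leibniz formula for the matrix with rows and columns numbered from 1 to n, over functions on nat.
The index set grows by one element at a time, so determinants of different sizes can occur in one
induction.\<close>

definition altdet :: "nat \<Rightarrow> (nat \<Rightarrow> nat \<Rightarrow> 'a) \<Rightarrow> 'a::comm_ring_1" where
  "altdet n F = (\<Sum>p | p permutes {1..n}. of_int (sign p) * (\<Prod>i=1..n. F i (p i)))"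

lemma altdet_transpose: "altdet n (\<lambda>i j. F j i) = altdet n F"
proof -
  have "altdet n (\<lambda>i j. F j i) = (\<Sum>p | p permutes {1..n}. of_int (sign (inv_into UNIV p)) * (\<Prod>i=1..n. F (inv_into UNIV p i) i))"
    unfolding altdet_def by (subst sum_permutations_inverse) simp
  also have "\<dots> = altdet n F"
    unfolding altdet_def
  proof (rule sum.cong[OF refl])
    fix p :: "nat \<Rightarrow> nat" assume "p \<in> {p. p permutes {1..n}}"
    then have p: "p permutes {1..n}" by simp
    have "(\<Prod>i=1..n. F (inv_into UNIV p i) i) = (\<Prod>i=1..n. F i (p i))"
      by (subst prod.permute[OF p]) (simp add: comp_def permutes_inverses[OF p])
    then show "of_int (sign (inv_into UNIV p)) * (\<Prod>i = 1..n. F (inv_into UNIV p i) i) = of_int (sign p) * (\<Prod>i = 1..n. F i (p i))"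
      using sign_inverse[of p] permutes_imp_permutation[OF _ p] by simp
  qed
  finally show ?thesis .
qed

lemma altdet_permute_cols:
  assumes q: "q permutes {1..n}"
  shows "altdet n (\<lambda>i j. F i (q j)) = of_int (sign q) * altdet n F"
proof -
  have "altdet n F = (\<Sum>p | p permutes {1..n}. of_int (sign (q \<circ> p)) * (\<Prod>i=1..n. F i ((q \<circ> p) i)))"
    unfolding altdet_def by (rule setum_permutations_compose_left[OF q]) 
  also have "\<dots> = (\<Sum>p | p permutes {1..n}. of_int (sign q) * (of_int (sign p) * (\<Prod>i=1..n. F i (q (p i)))))"
  proof (rule sum.cong[OF refl])
    fix p :: "nat \<Rightarrow> nat" assume "p \<in> {p. p permutes {1..n}}"
    then have p: "p permutes {1..n}" by simp
    show "of_int (sign (q \<circ> p)) * (\<Prod>i=1..n. F i ((q \<circ> p) i)) = of_int (sign q) * (of_int (sign p) * (\<Prod>i=1..n. F i (q (p i))))"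
      using sign_compose[OF permutes_imp_permutation[OF _ q] permutes_imp_permutation[OF _ p]] by simp
  qed
  finally have "altdet n F = of_int (sign q) * altdet n (\<lambda>i j. F i (q j))"
    unfolding altdet_def sum_distrib_left .
  moreover have "of_int (sign q) * of_int (sign q) = (1 :: 'a)"
    by (metis of_int_1 of_int_mult sign_idempotent)
  ultimately show ?thesis by (metis mult.assoc mult_1)
qed

text \<open>The indices of a matrix start from 0, so permutations are transported along Suc.\<close>

lemma altdet_eq_det:
  "altdet n F = Determinant.det (Matrix.mat n n (\<lambda>(r, s). F (Suc r) (Suc s)))"
proof -
  let ?c = "\<lambda>p i. if i \<in> {1..n} then Suc (p (i - 1)) else (i::nat)"
  let ?d = "\<lambda>p i. if i < n then p (Suc i) - 1 else (i::nat)"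
  have "Determinant.det (Matrix.mat n n (\<lambda>(r, s). F (Suc r) (Suc s))) = 
     (\<Sum>p | p permutes {0..<n}. of_int (sign p) * (\<Prod>i = 0..<n. F (Suc i) (Suc (p i))))"
    unfolding Determinant.det_def
    by (auto intro!: sum.cong prod.cong simp: permutes_in_image[of _ "{0..<n}", simplified])
  also have "\<dots> = (\<Sum>p | p permutes {0..<n}. of_int (sign p) * (\<Prod>i = 1..n. F i (map_permutation {0..<n} Suc p i)))"
  proof (intro sum.cong refl arg_cong2[of _ _ _ _ "(*)"])
    fix p :: "nat \<Rightarrow> nat" assume "p \<in> {p. p permutes {0..<n}}"
    have "(\<Prod>i = 0..<n. F (Suc i) (Suc (p i))) = (\<Prod>i = 0..<n. F (Suc i) (map_permutation {0..<n} Suc p (Suc i)))"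
      by (intro prod.cong refl) (simp add: map_permutation_apply)
    also have "\<dots> = (\<Prod>i = 1..n. F i (map_permutation {0..<n} Suc p i))"
      by (simp add: prod.atLeast_Suc_atMost_Suc_shift atLeast0LessThan prod.atLeast1_atMost_eq)
    finally show "(\<Prod>i = 0..<n. F (Suc i) (Suc (p i))) = (\<Prod>i = 1..n. F i (map_permutation {0..<n} Suc p i))" .
  qed
  also have "\<dots> = (\<Sum>p | p permutes {0..<n}. of_int (sign (map_permutation {0..<n} Suc p)) * (\<Prod>i = 1..n. F i (map_permutation {0..<n} Suc p i)))"
    by (intro sum.cong refl) (simp add: sign_map_permutation)
  also have "\<dots> = altdet n F"
    unfolding altdet_def
    using sum.reindex_bij_betw[OF bij_betw_permutations[of Suc "{0..<n}" "{1..n}"],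
      of "\<lambda>p. of_int (sign p) * (\<Prod>i = 1..n. F i (p i))"]
    by (simp add: map_permutation_def restrict_id_def bij_betw_def image_Suc_atLeastLessThan atLeastLessThanSuc_atLeastAtMost)
  finally show ?thesis by simp
qed

lemma altdet_cong:
  "(\<And>i j. i \<in> {1..n} \<Longrightarrow> j \<in> {1..n} \<Longrightarrow> F i j = G i j) \<Longrightarrow> altdet n F = altdet n G"
  unfolding altdet_def
  by (intro sum.cong prod.cong arg_cong2[of _ _ _ _ "(*)"] refl) (metis mem_Collect_eq permutes_in_image)

lemma altdet_identical_cols:
  fixes F :: "nat \<Rightarrow> nat \<Rightarrow> 'a::field_char_0"
  assumes ab: "a \<in> {1..n}" "b \<in> {1..n}" "a \<noteq> b"
    and eq: "\<And>i. F i a = F i b"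
  shows "altdet n F = 0"
proof -
  have "altdet n (\<lambda>i j. F i (Transposition.transpose a b j)) = of_int (sign (Transposition.transpose a b)) * altdet n F"
    by (rule altdet_permute_cols) (use ab in \<open>auto intro: permutes_swap_id\<close>)
  moreover have "altdet n (\<lambda>i j. F i (Transposition.transpose a b j)) = altdet n F"
    by (rule altdet_cong) (auto simp: Transposition.transpose_def eq)
  ultimately show ?thesis using ab by (simp add: sign_swap_id)
qed

text \<open>Column operations turn the power n - j into any monic polynomial of that degree: the matrix of
coefficients is triangular with ones on its diagonal.\<close>

lemma altdet_monic:
  fixes x :: "nat \<Rightarrow> 'a::field_char_0"
  assumes q: "\<And>j. j \<in> {1..n} \<Longrightarrow> degree (q j) = n - j \<and> lead_coeff (q j) = 1"
  shows "altdet n (\<lambda>i j. poly (q j) (x i)) = altdet n (\<lambda>i j. x i ^ (n - j))"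
proof -
  let ?P = "Matrix.mat n n (\<lambda>(r, s). x (Suc r) ^ (n - Suc s))"
  let ?C = "Matrix.mat n n (\<lambda>(r, s). coeff (q (Suc s)) (n - Suc r))"
  have "Matrix.mat n n (\<lambda>(r, s). poly (q (Suc s)) (x (Suc r))) = ?P * ?C"
  proof (rule eq_matI)
    fix r s assume rs: "r < dim_row (?P * ?C)" "s < dim_col (?P * ?C)"
    then have rs: "r < n" "s < n" by auto
    have "(?P * ?C) $$ (r, s) = (\<Sum>k<n. x (Suc r) ^ (n - Suc k) * coeff (q (Suc s)) (n - Suc k))"
      using rs by (simp add: scalar_prod_def atLeast0LessThan)
    also have "\<dots> = (\<Sum>k<n. x (Suc r) ^ k * coeff (q (Suc s)) k)"
      by (rule sum.nat_diff_reindex)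
    also have "\<dots> = (\<Sum>k\<le>degree (q (Suc s)). x (Suc r) ^ k * coeff (q (Suc s)) k)"
      by (rule sum.mono_neutral_right) (use rs q[of "Suc s"] in \<open>auto intro: coeff_eq_0\<close>)
    also have "\<dots> = poly (q (Suc s)) (x (Suc r))"
      by (simp add: poly_altdef mult.commute)
    finally show "Matrix.mat n n (\<lambda>(r, s). poly (q (Suc s)) (x (Suc r))) $$ (r, s) = (?P * ?C) $$ (r, s)"
      using rs by simp
  qed auto
  moreover have "Determinant.det ?C = 1"
  proof -
    have "Determinant.det ?C = prod_list (diag_mat ?C)"
    proof (rule det_lower_triangular)
      show "?C \<in> carrier_mat n n" by simp
      fix i j :: nat assume "i < j" "j < n"
      then show "?C $$ (i, j) = 0" using q[of "Suc j"] by (auto intro!: coeff_eq_0)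
    qed
    also have "diag_mat ?C = map (\<lambda>i. 1) [0..<n]"
      unfolding diag_mat_def
    proof (rule map_cong)
      fix i assume "i \<in> set [0..<n]"
      then show "?C $$ (i, i) = 1" using q[of "Suc i"] by (simp, metis)
    qed simp
    also have "prod_list \<dots> = (1::'a)" by (simp add: map_replicate_const)
    finally show ?thesis .
  qed
  ultimately show ?thesis
    unfolding altdet_eq_det by (simp add: Determinant.det_mult[of _ n])
qed

lemma altdet_Suc_last_row:
  fixes F :: "nat \<Rightarrow> nat \<Rightarrow> 'a::comm_ring_1"
  assumes "\<And>j. j \<in> {1..n} \<Longrightarrow> F (Suc n) j = 0"
  shows "altdet (Suc n) F = altdet n F * F (Suc n) (Suc n)"
proof -
  have "altdet (Suc n) F = (\<Sum>p | p permutes {1..n}. of_int (sign p) * (\<Prod>i=1..Suc n. F i (p i)))"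
    unfolding altdet_def
  proof (rule sum.mono_neutral_right)
    show "finite {p. p permutes {1..Suc n}}" by (simp add: finite_permutations)
    show "{p. p permutes {1..n}} \<subseteq> {p. p permutes {1..Suc n}}"
    proof clarify
      fix p :: "nat \<Rightarrow> nat" assume "p permutes {1..n}"
      then show "p permutes {1..Suc n}" by (rule permutes_subset) auto
    qed
    show "\<forall>p\<in>{p. p permutes {1..Suc n}} - {p. p permutes {1..n}}. of_int (sign p) * (\<Prod>i = 1..Suc n. F i (p i)) = 0"
    proof
      fix p :: "nat \<Rightarrow> nat" assume "p \<in> {p. p permutes {1..Suc n}} - {p. p permutes {1..n}}"
      then have p: "p permutes {1..Suc n}" "\<not> p permutes {1..n}" by auto
      have "p (Suc n) \<noteq> Suc n"
      proof
        assume "p (Suc n) = Suc n"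
        then have "p permutes {1..n}" 
          by (intro permutes_superset[OF p(1)]) (auto simp: le_Suc_eq)
        then show False using p by simp
      qed
      moreover have "p (Suc n) \<in> {1..Suc n}" using permutes_in_image[OF p(1)] by auto
      ultimately have "F (Suc n) (p (Suc n)) = 0" by (intro assms) auto
      then have "(\<Prod>i = 1..Suc n. F i (p i)) = 0" by simp
      then show "of_int (sign p) * (\<Prod>i = 1..Suc n. F i (p i)) = 0" by simp
    qed
  qed
  also have "\<dots> = altdet n F * F (Suc n) (Suc n)"
    unfolding altdet_def sum_distrib_right
  proof (rule sum.cong[OF refl])
    fix p :: "nat \<Rightarrow> nat" assume "p \<in> {p. p permutes {1..n}}"
    then have "p (Suc n) = Suc n" by (auto simp: permutes_def)
    then show "of_int (sign p) * (\<Prod>i = 1..Suc n. F i (p i)) = of_int (sign p) * (\<Prod>i = 1..n. F i (p i)) * F (Suc n) (Suc n)"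
      by (simp add: mult.assoc)
  qed
  finally show ?thesis .
qed

lemma altdet_row_scale:
  fixes F :: "nat \<Rightarrow> nat \<Rightarrow> 'a::comm_ring_1"
  shows "altdet n (\<lambda>i j. c i * F i j) = (\<Prod>i=1..n. c i) * altdet n F"
  unfolding altdet_def by (simp add: prod.distrib sum_distrib_left mult_ac)

text \<open>The Vandermonde determinant. By the freedom to choose monic polynomials, take those that vanish at
the last point; the last row then has one nonzero entry.\<close>

lemma altdet_powers:
  fixes x :: "nat \<Rightarrow> 'a::field_char_0"
  shows "altdet n (\<lambda>i j. x i ^ (n - j)) = vandermonde_prod n x"
proof (induction n)
  case 0
  then show ?case by (simp add: altdet_def vandermonde_prod_def)
next
  case (Suc n)
  \<comment> \<open>Monic polynomials, all but the last of which vanish at x (Suc n).\<close>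
  define q where "q j = (if j = Suc n then 1 else [:- x (Suc n), 1:] * monom 1 (n - j))" for j
  have "altdet (Suc n) (\<lambda>i j. x i ^ (Suc n - j)) = altdet (Suc n) (\<lambda>i j. poly (q j) (x i))"
  proof (rule altdet_monic[symmetric])
    fix j assume j: "j \<in> {1..Suc n}"
    show "degree (q j) = Suc n - j \<and> lead_coeff (q j) = 1"
    proof (cases "j = Suc n")
      case False
      have "degree ([:- x (Suc n), 1:] * monom 1 (n - j)) = Suc (n - j)"
        by (subst degree_mult_eq) (auto simp: Polynomial.degree_monom_eq)
      moreover have "lead_coeff ([:- x (Suc n), 1:] * monom 1 (n - j)) = 1"
        by (subst lead_coeff_mult) (auto simp: Polynomial.degree_monom_eq)
      ultimately show ?thesis using False j by (auto simp: q_def Suc_diff_le)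
    qed (auto simp: q_def)
  qed
  also have "\<dots> = altdet n (\<lambda>i j. poly (q j) (x i)) * poly (q (Suc n)) (x (Suc n))"
    by (rule altdet_Suc_last_row) (auto simp: q_def)
  also have "\<dots> = altdet n (\<lambda>i j. (x i - x (Suc n)) * x i ^ (n - j))"
    by (simp add: q_def, rule altdet_cong) (auto simp: q_def poly_monom algebra_simps)
  also have "\<dots> = (\<Prod>i=1..n. x i - x (Suc n)) * vandermonde_prod n x"
    by (simp add: altdet_row_scale Suc.IH)
  also have "\<dots> = vandermonde_prod (Suc n) x"
    by (simp add: vandermonde_prod_def mult.commute atLeastLessThanSuc_atLeastAtMost)
  finally show ?case .
qed

section \<open>Alternants and the Pieri rule\<close>

definition alt :: "nat \<Rightarrow> (nat \<Rightarrow> nat) \<Rightarrow> (nat \<Rightarrow> 'a) \<Rightarrow> 'a::field_char_0" where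
  "alt n l x = altdet n (\<lambda>i j. x i ^ l j)"

text \<open>The partition lam + delta with delta = (n-1, ..., 1, 0): the exponents of the alternant of lam.\<close>

definition shifted :: "nat \<Rightarrow> (nat \<Rightarrow> nat) \<Rightarrow> nat \<Rightarrow> nat" where
  "shifted n lam j = lam j + n - j"

lemma alternant_eq_alt: "alternant n lam x = alt n (shifted n lam) x"
  unfolding alternant_def alt_def altdet_eq_det shifted_def by simp

definition esym :: "nat \<Rightarrow> nat \<Rightarrow> (nat \<Rightarrow> 'a) \<Rightarrow> 'a::comm_ring_1" where
  "esym n k x = (\<Sum>I | I \<subseteq> {1..n} \<and> card I = k. \<Prod>i\<in>I. x i)"

text \<open>The Pieri rule before cancellation. In the term of the permutation p, the elementary symmetric
function is written as a sum over the preimages of I under p, so that the factor x_i appears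
exactly when the column p i belongs to I.\<close>

lemma esym_times_alt:
  fixes x :: "nat \<Rightarrow> 'a::field_char_0"
  shows "esym n k x * alt n l x = (\<Sum>I | I \<subseteq> {1..n} \<and> card I = k. alt n (\<lambda>j. l j + (if j \<in> I then 1 else 0)) x)"
proof -
  have e: "esym n k x = (\<Sum>I | I \<subseteq> {1..n} \<and> card I = k. \<Prod>i=1..n. if p i \<in> I then x i else 1)"
    if p: "p permutes {1..n}" for p
  proof -
    have "esym n k x = (\<Sum>I | I \<subseteq> {1..n} \<and> card I = k. \<Prod>i\<in>p -` I. x i)"
      unfolding esym_def
    proof (rule sum.reindex_bij_witness[of _ "\<lambda>I. p -` I" "\<lambda>I. p ` I"])
      fix I assume I: "I \<in> {I. I \<subseteq> {1..n} \<and> card I = k}"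
      show "p -` p ` I = I" by (simp add: inj_vimage_image_eq permutes_inj[OF p])
      then show "(\<Prod>i\<in>p -` p ` I. x i) = prod x I" by simp
      show "p ` I \<in> {I. I \<subseteq> {1..n} \<and> card I = k}"
        using I permutes_in_image[OF p] using card_image[OF inj_on_subset[OF permutes_inj[OF p] subset_UNIV], of I] by auto
      show "p ` (p -` I) = I" by (simp add: surj_image_vimage_eq permutes_surj[OF p])
      then have "card I = card (p -` I)"
        using card_image[OF inj_on_subset[OF permutes_inj[OF p] subset_UNIV], of "p -` I"] by simp
      then show "p -` I \<in> {I. I \<subseteq> {1..n} \<and> card I = k}"
        using I permutes_in_image[OF p] by (auto)
    qed
    also have "\<dots> = (\<Sum>I | I \<subseteq> {1..n} \<and> card I = k. \<Prod>i=1..n. if p i \<in> I then x i else 1)"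
    proof (rule sum.cong[OF refl])
      fix I assume I: "I \<in> {I. I \<subseteq> {1..n} \<and> card I = k}"
      have "(\<Prod>i=1..n. if p i \<in> I then x i else 1) = (\<Prod>i\<in>{1..n} \<inter> {i. p i \<in> I}. x i)"
        by (subst prod.inter_restrict) auto
      also have "{1..n} \<inter> {i. p i \<in> I} = p -` I"
        using I permutes_in_image[OF p] by auto
      finally show "(\<Prod>i\<in>p -` I. x i) = (\<Prod>i=1..n. if p i \<in> I then x i else 1)" by simp
    qed
    finally show ?thesis .
  qed
  have "esym n k x * alt n l x = (\<Sum>p | p permutes {1..n}. \<Sum>I | I \<subseteq> {1..n} \<and> card I = k. 
      of_int (sign p) * (\<Prod>i=1..n. x i ^ (l (p i) + (if p i \<in> I then 1 else 0))))"
    unfolding alt_def altdet_def sum_distrib_left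
  proof (rule sum.cong[OF refl])
    fix p :: "nat \<Rightarrow> nat" assume "p \<in> {p. p permutes {1..n}}"
    then have p: "p permutes {1..n}" by simp
    show "esym n k x * (of_int (sign p) * (\<Prod>i = 1..n. x i ^ l (p i))) = 
      (\<Sum>I | I \<subseteq> {1..n} \<and> card I = k. of_int (sign p) * (\<Prod>i=1..n. x i ^ (l (p i) + (if p i \<in> I then 1 else 0))))"
      unfolding e[OF p] sum_distrib_right
      by (intro sum.cong refl) (auto simp: prod.distrib[symmetric] mult_ac power_add intro!: prod.cong)
  qed
  also have "\<dots> = (\<Sum>I | I \<subseteq> {1..n} \<and> card I = k. alt n (\<lambda>j. l j + (if j \<in> I then 1 else 0)) x)"
    unfolding alt_def altdet_def by (rule sum.swap)
  finally show ?thesis .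
qed

section \<open>Polynomial functions in several variables\<close>

lemma poly_funI:
  assumes J: "finite J" and f: "\<And>x. f x = (\<Sum>j\<in>J. c j * (\<Prod>i=1..n. x i ^ e j i))"
  shows "poly_fun n f"
proof -
  have "f x = (\<Sum>\<nu>\<in>e ` J. (\<Sum>j | j \<in> J \<and> e j = \<nu>. c j) * (\<Prod>i=1..n. x i ^ \<nu> i))" for x
  proof -
  have "f x = (\<Sum>\<nu>\<in>e ` J. \<Sum>j | j \<in> J \<and> e j = \<nu>. c j * (\<Prod>i=1..n. x i ^ e j i))"
    unfolding f by (rule sum.image_gen[OF J])
  also have "\<dots> = (\<Sum>\<nu>\<in>e ` J. (\<Sum>j | j \<in> J \<and> e j = \<nu>. c j) * (\<Prod>i=1..n. x i ^ \<nu> i))"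
    unfolding sum_distrib_right by (intro sum.cong refl) simp
  finally show ?thesis .
  qed
  then show ?thesis unfolding poly_fun_def using J
    by (intro exI[of _ "e ` J"] exI[of _ "\<lambda>\<nu>. \<Sum>j | j \<in> J \<and> e j = \<nu>. c j"]) simp
qed

lemma poly_fun_const: "poly_fun n (\<lambda>x. c)"
  by (rule poly_funI[of "{()}" _ "\<lambda>_. c" "\<lambda>_ _. 0"]) auto

lemma poly_fun_var:
  assumes "k \<in> {1..n}" shows "poly_fun n (\<lambda>x. x k)"
proof (rule poly_funI[of "{()}" _ "\<lambda>_. 1" "\<lambda>_ i. if i = k then 1 else 0"])
  fix x :: "nat \<Rightarrow> 'a"
  have "(\<Prod>i = 1..n. x i ^ (if i = k then 1 else 0)) = (\<Prod>i = 1..n. if i = k then x i else 1)"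
    by (intro prod.cong) auto
  then show "x k = (\<Sum>j\<in>{()}. 1 * (\<Prod>i = 1..n. x i ^ (if i = k then 1 else 0)))"
    using assms by simp
qed simp

lemma poly_fun_add:
  assumes "poly_fun n f" "poly_fun n g" shows "poly_fun n (\<lambda>x. f x + g x)"
proof -
  obtain E c E' c' where 1: "finite E" "\<And>x. f x = (\<Sum>e\<in>E. c e * (\<Prod>i=1..n. x i ^ e i))"
    and 2: "finite E'" "\<And>x. g x = (\<Sum>e\<in>E'. c' e * (\<Prod>i=1..n. x i ^ e i))"
    using assms unfolding poly_fun_def by blast
  show ?thesis
    by (rule poly_funI[of "E <+> E'" _ "case_sum c c'" "case_sum id id"])
       (use 1 2 in \<open>auto simp: sum.Plus\<close>)
qed

lemma poly_fun_mult:
  assumes "poly_fun n f" "poly_fun n g" shows "poly_fun n (\<lambda>x. f x * g x)"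
proof -
  obtain E c E' c' where 1: "finite E" "\<And>x. f x = (\<Sum>e\<in>E. c e * (\<Prod>i=1..n. x i ^ e i))"
    and 2: "finite E'" "\<And>x. g x = (\<Sum>e\<in>E'. c' e * (\<Prod>i=1..n. x i ^ e i))"
    using assms unfolding poly_fun_def by blast
  show ?thesis
  proof (rule poly_funI[of "E \<times> E'" _ "\<lambda>(a, b). c a * c' b" "\<lambda>(a, b) i. a i + b i"])
    fix x
    show "f x * g x = (\<Sum>j\<in>E \<times> E'. (case j of (a, b) \<Rightarrow> c a * c' b) * (\<Prod>i=1..n. x i ^ (case j of (a, b) \<Rightarrow> \<lambda>i. a i + b i) i))"
      unfolding 1(2) 2(2) sum_product sum.cartesian_product
      by (intro sum.cong refl) (auto simp: power_add prod.distrib mult_ac)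
  qed (use 1 2 in auto)
qed

lemma poly_fun_minus:
  assumes "poly_fun n f" "poly_fun n g" shows "poly_fun n (\<lambda>x. f x - g x)"
  using poly_fun_add[OF assms(1) poly_fun_mult[OF poly_fun_const[of n "-1"] assms(2)]] by simp

lemma poly_fun_sum:
  "(\<And>j. j \<in> J \<Longrightarrow> poly_fun n (f j)) \<Longrightarrow> poly_fun n (\<lambda>x. \<Sum>j\<in>J. f j x)"
  by (induction J rule: infinite_finite_induct) (auto intro: poly_fun_const poly_fun_add)

lemma poly_fun_prod:
  "(\<And>j. j \<in> J \<Longrightarrow> poly_fun n (f j)) \<Longrightarrow> poly_fun n (\<lambda>x. \<Prod>j\<in>J. f j x)"
  by (induction J rule: infinite_finite_induct) (auto intro: poly_fun_const poly_fun_mult)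

lemma poly_fun_esym: "poly_fun n (esym n k)"
  unfolding esym_def by (intro poly_fun_sum poly_fun_prod poly_fun_var) auto

lemma vandermonde_prod_eq_0_iff: "vandermonde_prod n x = 0 \<longleftrightarrow> \<not> inj_on x {1..n}"
proof
  assume "vandermonde_prod n x = 0"
  then obtain r s where "r \<in> {1..<s}" "s \<in> {1..n}" "x r = x s"
    unfolding vandermonde_prod_def by auto
  then have "r \<in> {1..n}" "r \<noteq> s" by auto
  then show "\<not> inj_on x {1..n}" using inj_onD[of x "{1..n}" r s] \<open>s \<in> {1..n}\<close> \<open>x r = x s\<close> by blast
next
  assume "\<not> inj_on x {1..n}"
  then obtain a b where ab: "a \<in> {1..n}" "b \<in> {1..n}" "x a = x b" "a \<noteq> b" by (auto simp: inj_on_def)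
  define r s where "r = min a b" "s = max a b"
  have rs: "r \<in> {1..<s}" "s \<in> {1..n}" "x r - x s = 0" using ab unfolding r_s_def by (auto simp: min_def max_def)
  have "(\<Prod>r\<in>{1..<s}. x r - x s) = 0" by (rule prod_zero[OF _ bexI[of _ r]]) (use rs in simp_all)
  then have "\<exists>s\<in>{1..n}. (\<Prod>r\<in>{1..<s}. x r - x s) = 0" using rs(2) by (rule bexI)
  then show "vandermonde_prod n x = 0"
    unfolding vandermonde_prod_def by (rule prod_zero[OF finite_atLeastAtMost])
qed

lemma poly_fun_tendsto:
  fixes f :: "(nat \<Rightarrow> 'a::real_normed_field) \<Rightarrow> 'a"
  assumes "poly_fun n f" and y: "\<And>i. i \<in> {1..n} \<Longrightarrow> ((\<lambda>t. y t i) \<longlongrightarrow> x i) F"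
  shows "((\<lambda>t. f (y t)) \<longlongrightarrow> f x) F"
proof -
  obtain E c where 1: "finite E" "\<And>x. f x = (\<Sum>e\<in>E. c e * (\<Prod>i=1..n. x i ^ e i))"
    using assms unfolding poly_fun_def by blast
  show ?thesis unfolding 1(2)
    by (intro tendsto_sum tendsto_mult tendsto_prod tendsto_power y tendsto_const) auto
qed

text \<open>Points with distinct coordinates accumulate at every point: two coordinates of the perturbed point
agree for at most one t.\<close>

lemma eventually_perturb_inj:
  fixes x :: "nat \<Rightarrow> 'a::real_normed_field"
  shows "eventually (\<lambda>t::real. inj_on (\<lambda>i. x i + of_real t * of_nat i) {1..n}) (at 0)"
proof -
  define B where "B = (\<Union>i\<in>{1..n}. \<Union>j\<in>{1..n}-{i}. {t::real. x i + of_real t * of_nat i = x j + of_real t * of_nat j})"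
  have "finite B"
    unfolding B_def
  proof (intro finite_UN_I finite_Diff finite_atLeastAtMost)
    fix i j assume ij: "i \<in> {1..n}" "j \<in> {1..n}-{i}"
    have "{t::real. x i + of_real t * of_nat i = x j + of_real t * of_nat j} \<subseteq> 
        (of_real :: real \<Rightarrow> 'a) -` {(x j - x i) / (of_nat i - of_nat j)}"
      using ij by (auto simp: field_simps)
    moreover have "finite ((of_real :: real \<Rightarrow> 'a) -` {(x j - x i) / (of_nat i - of_nat j)})"
      by (intro finite_vimageI) (auto simp: inj_def)
    ultimately show "finite {t::real. x i + of_real t * of_nat i = x j + of_real t * of_nat j}"
      by (rule finite_subset)
  qed
  then have "open (- (B - {0}))" by (intro open_Compl finite_imp_closed) auto
  then have "eventually (\<lambda>t. t \<in> - (B - {0})) (at 0)"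
    by (intro eventually_at_in_open') auto
  then show ?thesis
    using eventually_neq_at_within[of 0 0 UNIV]
  proof eventually_elim
    case (elim t)
    then have "t \<notin> B" by auto
    then show ?case unfolding B_def inj_on_def by blast
  qed
qed

text \<open>Two polynomial functions that agree where the Vandermonde product can be cancelled agree
everywhere, by continuity.\<close>

lemma poly_fun_eqI:
  fixes f g :: "(nat \<Rightarrow> 'a::real_normed_field) \<Rightarrow> 'a"
  assumes f: "poly_fun n f" and g: "poly_fun n g"
    and eq: "\<And>x. inj_on x {1..n} \<Longrightarrow> f x = g x"
  shows "f x = g x"
proof (rule tendsto_unique)
  let ?y = "\<lambda>(t::real) i. x i + of_real t * of_nat i"
  have y: "((\<lambda>t. ?y t i) \<longlongrightarrow> x i) (at 0)" for i
    by (auto intro!: tendsto_eq_intros)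
  show "((\<lambda>t. f (?y t)) \<longlongrightarrow> f x) (at 0)" by (rule poly_fun_tendsto[OF f y])
  have "((\<lambda>t. g (?y t)) \<longlongrightarrow> g x) (at 0)" by (rule poly_fun_tendsto[OF g y])
  then show "((\<lambda>t. f (?y t)) \<longlongrightarrow> g x) (at 0)"
    by (rule Lim_transform_eventually)
      (rule eventually_mono[OF eventually_perturb_inj[of x n]], simp add: eq)
qed auto

section \<open>Partitions and dominance\<close>

definition part_sum :: "(nat \<Rightarrow> nat) \<Rightarrow> nat \<Rightarrow> nat" where "part_sum lam j = (\<Sum>i=1..j. lam i)"

lemma part_sum_Suc: "part_sum lam (Suc j) = part_sum lam j + lam (Suc j)"
  unfolding part_sum_def by simp

lemma partitions_lenI:
  assumes "\<And>i. 1 \<le> i \<Longrightarrow> i < n \<Longrightarrow> lam (Suc i) \<le> lam i" "\<And>i. i \<notin> {1..n} \<Longrightarrow> lam i = 0"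
  shows "lam \<in> partitions_len n"
proof -
  have "lam j \<le> lam i" if "1 \<le> i" "i \<le> j" "j \<le> n" for i j
    using that(2,3)
  proof (induction j rule: dec_induct)
    case (step k)
    then show ?case using assms(1)[of k] that(1) by auto
  qed simp
  then show ?thesis using assms(2) by (auto simp: partitions_len_def monotone_on_def)
qed

lemma partitions_lenD:
  "lam \<in> partitions_len n \<Longrightarrow> 1 \<le> i \<Longrightarrow> i \<le> j \<Longrightarrow> j \<le> n \<Longrightarrow> lam j \<le> lam i"
  "lam \<in> partitions_len n \<Longrightarrow> i \<notin> {1..n} \<Longrightarrow> lam i = 0"
  by (auto simp: partitions_len_def monotone_on_def)

lemma part_sum_eq_imp_eq:
  assumes "lam \<in> partitions_len n" "nu \<in> partitions_len n" "\<And>j. j \<le> n \<Longrightarrow> part_sum lam j = part_sum nu j"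
  shows "lam = nu"
proof
  fix i
  show "lam i = nu i"
  proof (cases "i \<in> {1..n}")
    case True
    then obtain k where k: "i = Suc k" "Suc k \<le> n" by (cases i) auto
    then show ?thesis using assms(3)[of k] assms(3)[of "Suc k"] by (simp add: part_sum_Suc)
  next
    case False then show ?thesis using partitions_lenD(2) assms by metis
  qed
qed

definition add_ind :: "nat set \<Rightarrow> (nat \<Rightarrow> nat) \<Rightarrow> nat \<Rightarrow> nat" where
  "add_ind I mu i = mu i + (if i \<in> I then 1 else 0)"

lemma part_sum_add_ind: "part_sum (add_ind I mu) j = part_sum mu j + card (I \<inter> {1..j})"
  unfolding part_sum_def add_ind_def
  by (simp add: sum.distrib sum.If_cases Int_commute)

text \<open>Induction along the Pieri rule for elementary symmetric functions. A nonzero partition lam arises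
from a smaller mu by adding the first column; the other partitions in the product of s_mu with the
elementary symmetric function of the column length are strictly below lam in dominance order. The
sum of all partial sums decreases in both cases.\<close>

lemma partition_induct [consumes 1, case_names zero step]:
  assumes lam: "lam \<in> partitions_len n"
    and zero: "P (\<lambda>_. 0)"
    and step: "\<And>mu k. mu \<in> partitions_len n \<Longrightarrow> k \<le> n \<Longrightarrow> add_ind {1..k} mu \<in> partitions_len n \<Longrightarrow> P mu \<Longrightarrow>
      (\<And>nu. nu \<in> partitions_len n \<Longrightarrow> nu \<noteq> add_ind {1..k} mu \<Longrightarrow> (\<And>j. j \<le> n \<Longrightarrow> part_sum nu j \<le> part_sum (add_ind {1..k} mu) j) \<Longrightarrow>
         part_sum nu n = part_sum (add_ind {1..k} mu) n \<Longrightarrow> P nu) \<Longrightarrow> P (add_ind {1..k} mu)"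
  shows "P lam"
  using lam
proof (induction "\<Sum>j\<le>n. part_sum lam j" arbitrary: lam rule: less_induct)
  case less
  have IH: "P nu" if "nu \<in> partitions_len n" "nu \<noteq> lam" "\<And>j. j \<le> n \<Longrightarrow> part_sum nu j \<le> part_sum lam j" for nu
  proof (rule less.hyps)
    have "\<exists>j\<le>n. part_sum nu j \<noteq> part_sum lam j"
    proof (rule ccontr)
      assume "\<not> ?thesis"
      then have "nu = lam" by (intro part_sum_eq_imp_eq[OF that(1) less.prems]) metis
      with that(2) show False ..
    qed
    then obtain j where "j \<le> n" "part_sum nu j \<noteq> part_sum lam j" by (elim exE conjE)
    then have j: "j \<le> n" "part_sum nu j < part_sum lam j" using that(3)[of j] by auto
    show "(\<Sum>j\<le>n. part_sum nu j) < (\<Sum>j\<le>n. part_sum lam j)"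
    proof (rule sum_strict_mono_ex1)
      show "\<forall>j\<in>{..n}. part_sum nu j \<le> part_sum lam j" using that(3) by simp
      show "\<exists>j\<in>{..n}. part_sum nu j < part_sum lam j" using j by blast
    qed simp
  qed (rule that(1))
  show ?case
  proof (cases "lam = (\<lambda>_. 0)")
    case True show ?thesis unfolding True by (rule zero)
  next
    case False
    have sub: "{i. lam i \<noteq> 0} \<subseteq> {1..n}" using partitions_lenD(2)[OF less.prems] by (metis (mono_tags) mem_Collect_eq subsetI)
    then have fin: "finite {i. lam i \<noteq> 0}" by (rule finite_subset) simp
    define m where "m = Max {i. lam i \<noteq> 0}"
    have ne: "{i. lam i \<noteq> 0} \<noteq> {}" using False by auto
    have m: "lam m \<noteq> 0" using Max_in[OF fin ne] unfolding m_def by simp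
    then have mn: "m \<in> {1..n}" using sub[unfolded subset_eq, rule_format, of m] by simp
    have m': "i \<le> m" if "lam i \<noteq> 0" for i using Max_ge[OF fin, of i] that unfolding m_def by simp
    have supp: "{i. lam i \<noteq> 0} = {1..m}"
    proof (rule equalityI; rule subsetI)
      fix i assume "i \<in> {1..m}"
      then show "i \<in> {i. lam i \<noteq> 0}" using partitions_lenD(1)[OF less.prems, of i m] m mn by simp
    next
      fix i assume "i \<in> {i. lam i \<noteq> 0}"
      then show "i \<in> {1..m}" using m'[of i] sub[unfolded subset_eq, rule_format, of i] by simp
    qed
    define mu where "mu i = lam i - (if i \<in> {1..m} then 1 else 0)" for i
    have supp': "lam i \<noteq> 0 \<longleftrightarrow> i \<in> {1..m}" for i using supp[unfolded set_eq_iff, rule_format, of i] by simp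
    have lam_eq: "lam = add_ind {1..m} mu"
    proof
      fix i show "lam i = add_ind {1..m} mu i"
        using supp'[of i] unfolding add_ind_def mu_def by (cases "i \<in> {1..m}") auto
    qed
    have mu: "mu \<in> partitions_len n"
    proof (rule partitions_lenI)
      fix i assume i: "1 \<le> i" "i < n"
      show "mu (Suc i) \<le> mu i"
        using partitions_lenD(1)[OF less.prems, of i "Suc i"] i supp'[of i] supp'[of "Suc i"] unfolding mu_def by auto
    next
      fix i assume "i \<notin> {1..n}"
      then show "mu i = 0" using partitions_lenD(2)[OF less.prems, of i] by (simp add: mu_def)
    qed
    have ps: "part_sum lam j = part_sum mu j + card ({1..m} \<inter> {1..j})" for j
      unfolding lam_eq part_sum_add_ind ..
    have "P (add_ind {1..m} mu)"
    proof (rule step[OF mu])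
      show "m \<le> n" using mn by simp
      show "add_ind {1..m} mu \<in> partitions_len n" using less.prems unfolding lam_eq[symmetric] .
      have "mu m \<noteq> lam m" using m mn unfolding mu_def by simp
      then have "mu \<noteq> lam" by metis
      then show "P mu" by (intro IH mu) (auto simp: ps)
      show "P nu" if a: "nu \<in> partitions_len n" and b: "nu \<noteq> add_ind {1..m} mu"
        and c: "\<And>j. j \<le> n \<Longrightarrow> part_sum nu j \<le> part_sum (add_ind {1..m} mu) j" for nu
        by (rule IH[OF a b[folded lam_eq] c[folded lam_eq]])
    qed
    then show ?thesis unfolding lam_eq[symmetric] .
  qed
qed

lemma alt_cong: "(\<And>j. j \<in> {1..n} \<Longrightarrow> l j = l' j) \<Longrightarrow> (\<And>i. i \<in> {1..n} \<Longrightarrow> x i = y i) \<Longrightarrow> alt n l x = alt n l' y"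
  unfolding alt_def by (intro altdet_cong) auto

text \<open>Adding a vertical strip to a partition breaks monotonicity only at rows i, i + 1 of equal length,
and only by 1. After the shift by delta the two exponents coincide.\<close>

lemma alt_shifted_add_ind:
  fixes x :: "nat \<Rightarrow> 'a::field_char_0"
  assumes mu: "mu \<in> partitions_len n" and I: "I \<subseteq> {1..n}" and "add_ind I mu \<notin> partitions_len n"
  shows "alt n (shifted n (add_ind I mu)) x = 0"
proof -
  have "\<exists>i. 1 \<le> i \<and> i < n \<and> add_ind I mu (Suc i) > add_ind I mu i"
  proof (rule ccontr)
    assume "\<not> ?thesis"
    then have 1: "add_ind I mu (Suc i) \<le> add_ind I mu i" if "1 \<le> i" "i < n" for i
      using that by (metis not_le)
    have "add_ind I mu i = 0" if "i \<notin> {1..n}" for i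
      using partitions_lenD(2)[OF mu that] I that by (auto simp: add_ind_def)
    with 1 have "add_ind I mu \<in> partitions_len n" by (intro partitions_lenI)
    with assms(3) show False ..
  qed
  then obtain i where i: "1 \<le> i" "i < n" "add_ind I mu (Suc i) > add_ind I mu i" by (elim exE conjE)
  then have "shifted n (add_ind I mu) i = shifted n (add_ind I mu) (Suc i)"
    using partitions_lenD(1)[OF mu, of i "Suc i"] unfolding add_ind_def shifted_def 
    by (auto split: if_splits)
  then show ?thesis unfolding alt_def by (intro altdet_identical_cols[of i _ "Suc i"]) (use i in auto)
qed

text \<open>The vertical strips of k boxes other than the topmost one.\<close>

definition pieri_rest :: "nat \<Rightarrow> (nat \<Rightarrow> nat) \<Rightarrow> nat \<Rightarrow> nat set set" where
  "pieri_rest n mu k = {I. I \<subseteq> {1..n} \<and> card I = k \<and> I \<noteq> {1..k} \<and> add_ind I mu \<in> partitions_len n}"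

text \<open>The Pieri rule, solved for its dominant term.\<close>

lemma pieri_alt:
  fixes x :: "nat \<Rightarrow> 'a::field_char_0"
  assumes mu: "mu \<in> partitions_len n" and k: "k \<le> n" 
  shows "alt n (shifted n (add_ind {1..k} mu)) x = 
     esym n k x * alt n (shifted n mu) x - (\<Sum>I\<in>pieri_rest n mu k. alt n (shifted n (add_ind I mu)) x)"
proof -
  let ?S = "{I. I \<subseteq> {1..n} \<and> card I = k}"
  have "esym n k x * alt n (shifted n mu) x = (\<Sum>I\<in>?S. alt n (shifted n (add_ind I mu)) x)"
    unfolding esym_times_alt
    by (intro sum.cong refl alt_cong) (auto simp: shifted_def add_ind_def)
  also have "\<dots> = alt n (shifted n (add_ind {1..k} mu)) x + (\<Sum>I\<in>?S - {{1..k}}. alt n (shifted n (add_ind I mu)) x)"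
    by (rule sum.remove) (use k in auto)
  also have "(\<Sum>I\<in>?S - {{1..k}}. alt n (shifted n (add_ind I mu)) x) = (\<Sum>I\<in>pieri_rest n mu k. alt n (shifted n (add_ind I mu)) x)"
  proof (rule sum.mono_neutral_right)
    show "\<forall>I\<in>?S - {{1..k}} - pieri_rest n mu k. alt n (shifted n (add_ind I mu)) x = 0"
    proof
      fix I assume "I \<in> ?S - {{1..k}} - pieri_rest n mu k"
      then show "alt n (shifted n (add_ind I mu)) x = 0" 
        by (intro alt_shifted_add_ind[OF mu]) (auto simp: pieri_rest_def)
    qed
  qed (simp_all, auto simp: pieri_rest_def)
  finally show ?thesis by simp
qed

lemma pieri_rest_dominated:
  assumes I: "I \<in> pieri_rest n mu k" and k: "k \<le> n"
  shows "add_ind I mu \<in> partitions_len n" "add_ind I mu \<noteq> add_ind {1..k} mu"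
    "part_sum (add_ind I mu) j \<le> part_sum (add_ind {1..k} mu) j"
    "part_sum (add_ind I mu) n = part_sum (add_ind {1..k} mu) n"
proof -
  have I': "I \<subseteq> {1..n}" "card I = k" "I \<noteq> {1..k}" "finite I" 
    using I finite_subset[of I "{1..n}"] by (auto simp: pieri_rest_def)
  show "add_ind I mu \<in> partitions_len n" using I by (auto simp: pieri_rest_def)
  show "add_ind I mu \<noteq> add_ind {1..k} mu"
  proof
    assume "add_ind I mu = add_ind {1..k} mu"
    then have "i \<in> I \<longleftrightarrow> i \<in> {1..k}" for i unfolding add_ind_def fun_eq_iff by (metis add_left_cancel zero_neq_one)
    then show False using I' by auto
  qed
  have "card (I \<inter> {1..j}) \<le> k" "card (I \<inter> {1..j}) \<le> j"
    using card_mono[of I "I \<inter> {1..j}"] card_mono[of "{1..j}" "I \<inter> {1..j}"] I' by auto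
  moreover have "card ({1..k} \<inter> {1..j}) = min k j" by simp
  ultimately show "part_sum (add_ind I mu) j \<le> part_sum (add_ind {1..k} mu) j"
    unfolding part_sum_add_ind by simp
  have "I \<inter> {1..n} = I" "card ({1..k} \<inter> {1..n}) = k" using I' k by auto
  then show "part_sum (add_ind I mu) n = part_sum (add_ind {1..k} mu) n"
    unfolding part_sum_add_ind using I' by simp
qed

section \<open>Schur polynomials\<close>

lemma vandermonde_eq_alt: "vandermonde_prod n x = alt n (\<lambda>j. n - j) x"
  unfolding alt_def altdet_powers ..

text \<open>The quotient of alternants is a polynomial: the Pieri rule expresses it by elementary symmetric
functions and by quotients for partitions that come earlier in the induction.\<close>

lemma schur_poly_exists:
  assumes "lam \<in> partitions_len n"
  shows "\<exists>f. poly_fun n f \<and> (\<forall>x::nat \<Rightarrow> 'a::field_char_0. vandermonde_prod n x * f x = alt n (shifted n lam) x)"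
  using assms
proof (induction rule: partition_induct)
  case zero
  show ?case
    by (rule exI[of _ "\<lambda>_. 1"]) (auto intro: poly_fun_const simp: vandermonde_eq_alt shifted_def intro!: alt_cong)
next
  case (step mu k)
  obtain f where f: "poly_fun n f" "\<And>x::nat \<Rightarrow> 'a. vandermonde_prod n x * f x = alt n (shifted n mu) x"
    using step by blast
  have "\<exists>g. poly_fun n g \<and> (\<forall>x::nat \<Rightarrow> 'a. vandermonde_prod n x * g x = alt n (shifted n (add_ind I mu)) x)"
    if "I \<in> pieri_rest n mu k" for I
    using step(5) pieri_rest_dominated[OF that step(2)] by blast
  then obtain g where g: "\<And>I. I \<in> pieri_rest n mu k \<Longrightarrow> poly_fun n (g I)" 
    "\<And>I x. I \<in> pieri_rest n mu k \<Longrightarrow> vandermonde_prod n (x::nat \<Rightarrow> 'a) * g I x = alt n (shifted n (add_ind I mu)) x"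
    by metis
  show ?case
  proof (intro exI[of _ "\<lambda>x. esym n k x * f x - (\<Sum>I\<in>pieri_rest n mu k. g I x)"] conjI allI)
    show "poly_fun n (\<lambda>x. esym n k x * f x - (\<Sum>I\<in>pieri_rest n mu k. g I x))"
      by (intro poly_fun_minus poly_fun_mult poly_fun_sum poly_fun_esym f g)
    show "vandermonde_prod n x * (esym n k x * f x - (\<Sum>I\<in>pieri_rest n mu k. g I x)) = alt n (shifted n (add_ind {1..k} mu)) x" for x :: "nat \<Rightarrow> 'a"
      unfolding pieri_alt[OF step(1,2)] f(2)[symmetric] right_diff_distrib sum_distrib_left
      by (simp add: g mult_ac)
  qed
qed

lemma schur_props:
  fixes x :: "nat \<Rightarrow> 'a::real_normed_field"
  assumes "lam \<in> partitions_len n"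
  shows "poly_fun n (schur n lam :: (nat \<Rightarrow> 'a) \<Rightarrow> 'a)"
    and "vandermonde_prod n x * schur n lam x = alt n (shifted n lam) x"
proof -
  obtain f :: "(nat \<Rightarrow> 'a) \<Rightarrow> 'a" where f: "poly_fun n f" "\<And>x. vandermonde_prod n x * f x = alt n (shifted n lam) x"
    using schur_poly_exists[OF assms] by blast
  have f': "f x = alternant n lam x / vandermonde_prod n x" if "inj_on x {1..n}" for x
    using f(2)[of x] that vandermonde_prod_eq_0_iff[of n x] by (simp add: alternant_eq_alt field_simps)
  have "schur n lam = f"
    unfolding schur_def
  proof (rule the_equality, goal_cases)
    case 1
    show ?case using f(1) f' by blast
  next
    case (2 g)
    have "g x = f x" for x
    proof (rule poly_fun_eqI[of n g f])
      show "poly_fun n g" using 2 ..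
      show "poly_fun n f" by (rule f(1))
      fix x :: "nat \<Rightarrow> 'a" assume "inj_on x {1..n}"
      then show "g x = f x" using 2 f'[of x] by metis
    qed
    then show ?case by (rule ext)
  qed
  with f show "poly_fun n (schur n lam :: (nat \<Rightarrow> 'a) \<Rightarrow> 'a)" "vandermonde_prod n x * schur n lam x = alt n (shifted n lam) x"
    by metis+
qed

lemma alt_complex_of_real: "alt n l (\<lambda>i. complex_of_real (x i)) = complex_of_real (alt n l x)"
  unfolding alt_def altdet_def by simp

lemma vandermonde_complex_of_real: 
  "vandermonde_prod n (\<lambda>i. complex_of_real (x i)) = complex_of_real (vandermonde_prod n x)"
  unfolding vandermonde_prod_def by simp

lemma schur_complex_of_real:
  assumes lam: "lam \<in> partitions_len n"
  shows "schur n lam (\<lambda>i. complex_of_real (x i)) = complex_of_real (schur n lam x)"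
proof (rule tendsto_unique)
  let ?y = "\<lambda>(t::real) i. x i + of_real t * of_nat i"
  have y: "((\<lambda>t. ?y t i) \<longlongrightarrow> x i) (at 0)" for i
    by (auto intro!: tendsto_eq_intros)
  show "((\<lambda>t. complex_of_real (schur n lam (?y t))) \<longlongrightarrow> complex_of_real (schur n lam x)) (at 0)"
    by (intro tendsto_of_real poly_fun_tendsto[OF schur_props(1)[OF lam]] y)
  have "((\<lambda>t. schur n lam (\<lambda>i. complex_of_real (?y t i))) \<longlongrightarrow> schur n lam (\<lambda>i. complex_of_real (x i))) (at 0)"
    by (intro poly_fun_tendsto[OF schur_props(1)[OF lam]] tendsto_of_real y)
  then show "((\<lambda>t. complex_of_real (schur n lam (?y t))) \<longlongrightarrow> schur n lam (\<lambda>i. complex_of_real (x i))) (at 0)"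
  proof (rule Lim_transform_eventually)
    show "eventually (\<lambda>t. schur n lam (\<lambda>i. complex_of_real (?y t i)) = complex_of_real (schur n lam (?y t))) (at 0)"
      using eventually_perturb_inj[of x n]
    proof eventually_elim
      case (elim t)
      then have "vandermonde_prod n (?y t) \<noteq> 0" by (simp add: vandermonde_prod_eq_0_iff)
      moreover have "complex_of_real (vandermonde_prod n (?y t)) * schur n lam (\<lambda>i. complex_of_real (?y t i)) = 
         complex_of_real (vandermonde_prod n (?y t) * schur n lam (?y t))"
        using schur_props(2)[OF lam, of "\<lambda>i. complex_of_real (?y t i)"] schur_props(2)[OF lam, of "?y t"]
        by (simp only: alt_complex_of_real vandermonde_complex_of_real)
      ultimately show ?case by (simp del: of_real_add)
    qed
  qed
qed auto

section \<open>The value of a Schur polynomial at the identity\<close>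

lemma vandermonde_delta: "vandermonde_prod n (\<lambda>i. real n - real i) = beta n"
proof -
  have "(\<Prod>r\<in>{1..<s}. (real n - real r) - (real n - real s)) = fact (s - 1)" if "s \<ge> 1" for s
  proof -
    have "(\<Prod>r\<in>{1..<s}. (real n - real r) - (real n - real s)) = (\<Prod>r\<in>{1..<s}. real (s - r))"
      by (intro prod.cong refl) (auto simp: of_nat_diff)
    also have "\<dots> = (\<Prod>r\<in>{1..<s}. real r)"
      by (rule prod.reindex_bij_witness[of _ "\<lambda>r. s - r" "\<lambda>r. s - r"]) auto
    also have "\<dots> = (\<Prod>r\<in>{1..s-1}. real r)" using that by (intro prod.cong) auto
    also have "(\<Prod>r\<in>{1..s-1}. real r) = fact (s - 1)" by (simp add: fact_prod)
    finally show ?thesis .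
  qed
  then show ?thesis unfolding vandermonde_prod_def beta_def by simp
qed

lemma prod_fact_delta: "(\<Prod>j=1..n. fact (n - j)) = beta n"
  unfolding beta_def
  by (rule prod.reindex_bij_witness[of _ "\<lambda>j. Suc n - j" "\<lambda>j. Suc n - j"]) (auto simp: Suc_diff_le)

lemma beta_pos: "beta n > 0"
  unfolding beta_def by (intro prod_pos) auto

text \<open>The numerator and the denominator of the quotient vanish at (1, ..., 1). At x_i = exp (t (n - i))
the alternant is, after transposition, itself a Vandermonde determinant, in the points
exp (t (lam_j + n - j)). Dividing each difference by t and letting t tend to 0 gives the formula.\<close>

lemma schur_one:
  assumes lam: "lam \<in> partitions_len n"
  shows "beta n * schur n lam (\<lambda>_. 1 :: real) = vandermonde_prod n (\<lambda>i. real (shifted n lam i))"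
proof -
  define W where "W a t = (\<Prod>s=1..n. \<Prod>r\<in>{1..<s}. (exp (t * a r) - exp (t * a s)) / t)" for a :: "nat \<Rightarrow> real" and t :: real
  define N where "N t = (\<Prod>s=1..n. \<Prod>r\<in>{1..<s}. t)" for t :: real
  have W: "vandermonde_prod n (\<lambda>i. exp (t * a i)) = N t * W a t" if "t \<noteq> 0" for a t
    unfolding vandermonde_prod_def W_def N_def prod.distrib[symmetric] using that by simp
  have limW: "(W a \<longlongrightarrow> vandermonde_prod n a) (at 0)" for a
    unfolding vandermonde_prod_def W_def
  proof (intro tendsto_prod)
    fix r s :: nat
    have "((\<lambda>t. exp (t * a r) - exp (t * a s)) has_field_derivative (a r - a s)) (at 0)"
      by (auto intro!: derivative_eq_intros)
    then show "((\<lambda>t. (exp (t * a r) - exp (t * a s)) / t) \<longlongrightarrow> a r - a s) (at 0)"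
      unfolding DERIV_def by simp
  qed
  let ?l = "\<lambda>i. real (shifted n lam i)"
  let ?d = "\<lambda>i. real n - real i"
  let ?y = "\<lambda>t i. exp (t * ?d i)"
  have alt: "alt n (shifted n lam) (?y t) = vandermonde_prod n (\<lambda>i. exp (t * ?l i))" for t
  proof -
    have "alt n (shifted n lam) (?y t) = altdet n (\<lambda>i j. exp (t * ?l j) ^ (n - i))"
      unfolding alt_def by (rule altdet_cong) (auto simp: exp_of_nat_mult[symmetric] mult_ac of_nat_diff)
    also have "\<dots> = altdet n (\<lambda>i j. exp (t * ?l i) ^ (n - j))"
      by (rule altdet_transpose[of n "\<lambda>i j. exp (t * ?l i) ^ (n - j)"])
    also have "\<dots> = vandermonde_prod n (\<lambda>i. exp (t * ?l i))" by (rule altdet_powers)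
    finally show ?thesis .
  qed
  have eq: "W ?d t * schur n lam (?y t) = W ?l t" if "t \<noteq> 0" for t
  proof -
    have "N t * (W ?d t * schur n lam (?y t)) = N t * W ?l t"
      using schur_props(2)[OF lam, of "?y t"] unfolding alt W[OF that] by (simp add: mult.assoc)
    moreover have "N t \<noteq> 0" using that unfolding N_def by simp
    ultimately show ?thesis by simp
  qed
  have "((\<lambda>t. W ?d t * schur n lam (?y t)) \<longlongrightarrow> vandermonde_prod n ?d * schur n lam (\<lambda>_. 1)) (at 0)"
    by (intro tendsto_mult limW poly_fun_tendsto[OF schur_props(1)[OF lam]]) (auto intro!: tendsto_eq_intros)
  moreover have "eventually (\<lambda>t. W ?d t * schur n lam (?y t) = W ?l t) (at 0)"
    using eventually_neq_at_within[of 0 0 UNIV] by (rule eventually_mono) (rule eq)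
  ultimately have "(W ?l \<longlongrightarrow> vandermonde_prod n ?d * schur n lam (\<lambda>_. 1)) (at 0)"
    by (rule Lim_transform_eventually)
  then have "vandermonde_prod n ?d * schur n lam (\<lambda>_. 1) = vandermonde_prod n ?l"
    using limW tendsto_unique[OF _ _ limW] by (metis at_neq_bot)
  then show ?thesis by (simp add: vandermonde_delta)
qed

lemma shifted_inj:
  assumes "lam \<in> partitions_len n" shows "inj_on (shifted n lam) {1..n}"
proof (rule linorder_inj_onI)
  fix i j assume "i < j" "i \<in> {1..n}" "j \<in> {1..n}"
  then show "shifted n lam i \<noteq> shifted n lam j"
    using partitions_lenD(1)[OF assms, of i j] unfolding shifted_def by auto
qed auto

lemma schur_one_nonzero: "lam \<in> partitions_len n \<Longrightarrow> schur n lam (\<lambda>_. 1 :: real) \<noteq> 0"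
proof
  assume lam: "lam \<in> partitions_len n" and 0: "schur n lam (\<lambda>_. 1 :: real) = 0"
  have "inj_on (\<lambda>i. real (shifted n lam i)) {1..n}"
  proof (rule inj_onI)
    fix a b assume "a \<in> {1..n}" "b \<in> {1..n}" "real (shifted n lam a) = real (shifted n lam b)"
    then show "a = b" using inj_onD[OF shifted_inj[OF lam], of a b] by simp
  qed
  then have "vandermonde_prod n (\<lambda>i. real (shifted n lam i)) \<noteq> 0"
    by (simp add: vandermonde_prod_eq_0_iff)
  then show False using schur_one[OF lam] 0 by simp
qed

section \<open>Powers of the first power sum\<close>

definition falling :: "nat \<Rightarrow> real \<Rightarrow> real" where "falling k a = (\<Prod>m<k. a - real m)"

text \<open>The reason to use falling factorials below: lowering the argument by 1 acts on them, up to the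
factor a, as multiplication by a scalar.\<close>

lemma falling_shift: "a * falling k (a - 1) = (a - real k) * falling k a"
proof -
  have "a * falling k (a - 1) = falling (Suc k) a"
    unfolding falling_def prod.lessThan_Suc_shift by (simp add: algebra_simps)
  also have "\<dots> = (a - real k) * falling k a" unfolding falling_def by (simp add: mult.commute)
  finally show ?thesis .
qed

lemma vandermonde_falling: "vandermonde_prod n a = altdet n (\<lambda>i j. falling (n - j) (a i))"
proof -
  let ?q = "\<lambda>j. \<Prod>m<n-j. [:- real m, 1:]"
  have "altdet n (\<lambda>i j. poly (?q j) (a i)) = altdet n (\<lambda>i j. a i ^ (n - j))"
  proof (rule altdet_monic)
    fix j assume "j \<in> {1..n}"
    have "degree (?q j) = (\<Sum>m<n-j. degree [:- real m, 1:])" by (rule degree_prod_eq_sum_degree) auto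
    moreover have "lead_coeff (?q j) = (\<Prod>m<n-j. lead_coeff [:- real m, 1:])" by (rule lead_coeff_prod)
    ultimately show "degree (?q j) = n - j \<and> lead_coeff (?q j) = 1" by simp
  qed
  moreover have "poly (?q j) b = falling (n - j) b" for j b unfolding falling_def by (simp add: poly_prod)
  ultimately show ?thesis by (simp add: altdet_powers)
qed

text \<open>The sum over all ways to lower one argument. In the basis of falling factorials each term of the
determinant is multiplied by a_i - (n - p i), and the sum over i does not depend on p.\<close>

lemma vandermonde_lowering:
  fixes a :: "nat \<Rightarrow> real"
  shows "(\<Sum>i=1..n. a i * vandermonde_prod n (a(i := a i - 1))) = ((\<Sum>i=1..n. a i) - (\<Sum>i=1..n. real (n - i))) * vandermonde_prod n a"
proof -
  have 1: "a i * vandermonde_prod n (a(i := a i - 1)) = 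
     (\<Sum>p | p permutes {1..n}. (a i - real (n - p i)) * (of_int (sign p) * (\<Prod>j=1..n. falling (n - p j) (a j))))"
    if i: "i \<in> {1..n}" for i
    unfolding vandermonde_falling altdet_def sum_distrib_left
  proof (rule sum.cong[OF refl])
    fix p :: "nat \<Rightarrow> nat" assume "p \<in> {p. p permutes {1..n}}"
    have "a i * (\<Prod>j=1..n. falling (n - p j) ((a(i := a i - 1)) j)) = 
       a i * falling (n - p i) (a i - 1) * (\<Prod>j\<in>{1..n}-{i}. falling (n - p j) (a j))"
      using i by (simp add: prod.remove[of _ i])
    also have "\<dots> = (a i - real (n - p i)) * (falling (n - p i) (a i) * (\<Prod>j\<in>{1..n}-{i}. falling (n - p j) (a j)))"
      unfolding falling_shift by simp
    also have "falling (n - p i) (a i) * (\<Prod>j\<in>{1..n}-{i}. falling (n - p j) (a j)) = (\<Prod>j=1..n. falling (n - p j) (a j))"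
      using i by (simp add: prod.remove[of _ i])
    finally show "a i * (of_int (sign p) * (\<Prod>j=1..n. falling (n - p j) ((a(i := a i - 1)) j))) =
       (a i - real (n - p i)) * (of_int (sign p) * (\<Prod>j=1..n. falling (n - p j) (a j)))"
      by (simp add: mult_ac)
  qed
  have 2: "(\<Sum>i=1..n. a i - real (n - p i)) = (\<Sum>i=1..n. a i) - (\<Sum>i=1..n. real (n - i))" if "p permutes {1..n}" for p
    using sum.permute[OF that, of "\<lambda>i. real (n - i)"] by (simp add: sum_subtractf comp_def del: of_nat_diff)
  have "(\<Sum>i=1..n. a i * vandermonde_prod n (a(i := a i - 1))) = 
    (\<Sum>i=1..n. \<Sum>p | p permutes {1..n}. (a i - real (n - p i)) * (of_int (sign p) * (\<Prod>j=1..n. falling (n - p j) (a j))))"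
    by (rule sum.cong[OF refl 1])
  also have "\<dots> = (\<Sum>p | p permutes {1..n}. \<Sum>i=1..n. (a i - real (n - p i)) * (of_int (sign p) * (\<Prod>j=1..n. falling (n - p j) (a j))))"
    by (rule sum.swap)
  also have "\<dots> = (\<Sum>p | p permutes {1..n}. ((\<Sum>i=1..n. a i) - (\<Sum>i=1..n. real (n - i))) * (of_int (sign p) * (\<Prod>j=1..n. falling (n - p j) (a j))))"
    unfolding sum_distrib_right[symmetric] by (rule sum.cong[OF refl]) (simp only: 2 mem_Collect_eq)
  also have "\<dots> = ((\<Sum>i=1..n. a i) - (\<Sum>i=1..n. real (n - i))) * vandermonde_prod n a"
    unfolding vandermonde_falling altdet_def sum_distrib_left ..
  finally show ?thesis .
qed

definition partitions_of_size :: "nat \<Rightarrow> nat \<Rightarrow> (nat \<Rightarrow> nat) set" where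
  "partitions_of_size n d = {lam \<in> partitions_len n. part_sum lam n = d}"

lemma finite_partitions_of_size: "finite (partitions_of_size n d)"
proof (rule finite_subset)
  show "finite {f. \<forall>x. (x \<in> {1..n} \<longrightarrow> f x \<in> {0..d}) \<and> (x \<notin> {1..n} \<longrightarrow> f x = (0::nat))}"
    by (rule finite_set_of_finite_funs) auto
  show "partitions_of_size n d \<subseteq> {f. \<forall>x. (x \<in> {1..n} \<longrightarrow> f x \<in> {0..d}) \<and> (x \<notin> {1..n} \<longrightarrow> f x = 0)}"
  proof
    fix lam assume lam: "lam \<in> partitions_of_size n d"
    have "lam i \<le> d" if "i \<in> {1..n}" for i
    proof -
      have "lam i \<le> part_sum lam n" unfolding part_sum_def by (rule member_le_sum) (use that in auto)
      then show ?thesis using lam by (simp add: partitions_of_size_def)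
    qed
    moreover have "lam i = 0" if "i \<notin> {1..n}" for i
      using lam partitions_lenD(2)[OF _ that] by (simp add: partitions_of_size_def)
    ultimately show "lam \<in> {f. \<forall>x. (x \<in> {1..n} \<longrightarrow> f x \<in> {0..d}) \<and> (x \<notin> {1..n} \<longrightarrow> f x = 0)}"
      by simp
  qed
qed

text \<open>The number of standard Young tableaux of shape lam, divided by the factorial of its size, written
as a Vandermonde product.\<close>

definition expcoef :: "nat \<Rightarrow> (nat \<Rightarrow> nat) \<Rightarrow> real" where
  "expcoef n lam = vandermonde_prod n (\<lambda>i. real (shifted n lam i)) / (\<Prod>j=1..n. fact (shifted n lam j))"

lemma part_sum_single: "i \<in> {1..n} \<Longrightarrow> part_sum (add_ind {i} lam) n = Suc (part_sum lam n)"
  unfolding part_sum_add_ind by (simp add: Int_absorb2)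

lemma esym_1: "esym n 1 x = (\<Sum>i=1..n. x i)"
proof -
  have "{I. I \<subseteq> {1..n} \<and> card I = 1} = (\<lambda>i. {i}) ` {1..n}"
    by (auto simp: card_Suc_eq)
  then show ?thesis unfolding esym_def by (simp add: sum.reindex)
qed

lemma power_sum_times_alt:
  fixes x :: "nat \<Rightarrow> 'a::field_char_0"
  shows "(\<Sum>i=1..n. x i) * alt n (shifted n lam) x = (\<Sum>i=1..n. alt n (shifted n (add_ind {i} lam)) x)"
proof -
  have 1: "{I. I \<subseteq> {1..n} \<and> card I = 1} = (\<lambda>i. {i}) ` {1..n}"
    by (auto simp: card_Suc_eq)
  have "(\<Sum>i=1..n. x i) * alt n (shifted n lam) x = (\<Sum>i=1..n. alt n (\<lambda>j. shifted n lam j + (if j \<in> {i} then 1 else 0)) x)"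
    unfolding esym_1[of n x, symmetric] esym_times_alt 1 by (simp add: sum.reindex)
  also have "\<dots> = (\<Sum>i=1..n. alt n (shifted n (add_ind {i} lam)) x)"
    by (intro sum.cong refl alt_cong) (auto simp: shifted_def add_ind_def)
  finally show ?thesis .
qed

text \<open>The branching rule for the number of standard tableaux. Rows from which no box can be removed
contribute 0 to the full sum over the rows, because lowering there either makes two arguments of
the Vandermonde product equal or has the factor 0; the sum over all rows is then given by the
lowering identity.\<close>

lemma expcoef_recursion:
  assumes lam: "lam \<in> partitions_len n"
  shows "(\<Sum>i\<in>{i \<in> {1..n}. \<exists>mu\<in>partitions_len n. add_ind {i} mu = lam}. expcoef n (\<lambda>j. lam j - (if j = i then 1 else 0)))
     = real (part_sum lam n) * expcoef n lam"
proof -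
  let ?l = "\<lambda>i. real (shifted n lam i)"
  let ?G = "{i \<in> {1..n}. \<exists>mu\<in>partitions_len n. add_ind {i} mu = lam}"
  let ?P = "\<Prod>j=1..n. fact (shifted n lam j) :: real"
  have P: "?P \<noteq> 0" by simp
  have good: "expcoef n (\<lambda>j. lam j - (if j = i then 1 else 0)) = ?l i * vandermonde_prod n (?l(i := ?l i - 1)) / ?P"
    if i: "i \<in> ?G" for i
  proof -
    from i obtain mu where mu: "mu \<in> partitions_len n" "add_ind {i} mu = lam" and i': "i \<in> {1..n}" by blast
    have lami: "lam j = mu j + (if j = i then 1 else 0)" for j using mu(2) unfolding add_ind_def by auto
    then have mu_eq: "(\<lambda>j. lam j - (if j = i then 1 else 0)) = mu" by auto
    have sh: "shifted n lam j = (if j = i then Suc (shifted n mu j) else shifted n mu j)" if "j \<in> {1..n}" for j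
      using that unfolding shifted_def lami by auto
    have "?P = fact (shifted n lam i) * (\<Prod>j\<in>{1..n}-{i}. fact (shifted n lam j))"
      using i' by (simp add: prod.remove[of _ i])
    also have "(\<Prod>j\<in>{1..n}-{i}. fact (shifted n lam j)) = (\<Prod>j\<in>{1..n}-{i}. fact (shifted n mu j) :: real)"
      by (intro prod.cong refl) (simp add: sh)
    also have "fact (shifted n lam i) = ?l i * (fact (shifted n mu i) :: real)"
      using sh[OF i'] by simp
    also have "?l i * fact (shifted n mu i) * (\<Prod>j\<in>{1..n}-{i}. fact (shifted n mu j) :: real) = ?l i * (\<Prod>j=1..n. fact (shifted n mu j))"
      using i' by (simp add: prod.remove[of _ i])
    finally have P_eq: "?P = ?l i * (\<Prod>j=1..n. fact (shifted n mu j))" .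
    have "vandermonde_prod n (?l(i := ?l i - 1)) = vandermonde_prod n (\<lambda>j. real (shifted n mu j))"
      unfolding vandermonde_prod_def
      by (intro prod.cong refl) (auto simp: sh i')
    moreover have "?l i \<noteq> 0" using sh[OF i'] by simp
    ultimately show ?thesis unfolding mu_eq expcoef_def P_eq by simp
  qed
  \<comment> \<open>If no box can be removed from row i, then either l_i = 0 or l_i - 1 = l_(i+1).\<close>
  have bad: "?l i * vandermonde_prod n (?l(i := ?l i - 1)) = 0" if i: "i \<in> {1..n} - ?G" for i
  proof (rule ccontr)
    assume "\<not> ?thesis"
    then have l0: "shifted n lam i \<noteq> 0" and "vandermonde_prod n (?l(i := ?l i - 1)) \<noteq> 0" by auto
    then have inj: "inj_on (?l(i := ?l i - 1)) {1..n}" by (simp add: vandermonde_prod_eq_0_iff)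
    have i': "i \<in> {1..n}" using i by simp
    have ne: "shifted n lam i - 1 \<noteq> shifted n lam (Suc i)" if "Suc i \<le> n"
    proof
      assume "shifted n lam i - 1 = shifted n lam (Suc i)"
      then have "(?l(i := ?l i - 1)) i = (?l(i := ?l i - 1)) (Suc i)" using l0 by simp
      then show False using inj_onD[OF inj, of i "Suc i"] that i' by simp
    qed
    let ?mu = "\<lambda>j. lam j - (if j = i then 1 else 0)"
    have lt: "lam (Suc i) < lam i"
    proof (cases "Suc i \<le> n")
      case True
      then show ?thesis using ne[OF True] partitions_lenD(1)[OF lam, of i "Suc i"] i' unfolding shifted_def by auto
    next
      case False
      then have "i = n" using i' by simp
      then show ?thesis using l0 partitions_lenD(2)[OF lam, of "Suc i"] i' unfolding shifted_def by auto
    qed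
    have "?mu \<in> partitions_len n"
    proof (rule partitions_lenI)
      fix j assume "1 \<le> j" "j < n"
      then show "?mu (Suc j) \<le> ?mu j" using partitions_lenD(1)[OF lam, of j "Suc j"] lt by auto
    next
      fix j assume "j \<notin> {1..n}"
      then show "?mu j = 0" using partitions_lenD(2)[OF lam, of j] by simp
    qed
    moreover have "add_ind {i} ?mu = lam" using lt by (auto simp: add_ind_def fun_eq_iff)
    ultimately show False using i by blast
  qed
  have "(\<Sum>i\<in>?G. expcoef n (\<lambda>j. lam j - (if j = i then 1 else 0))) = (\<Sum>i\<in>?G. ?l i * vandermonde_prod n (?l(i := ?l i - 1)) / ?P)"
    by (rule sum.cong[OF refl good])
  also have "\<dots> = (\<Sum>i=1..n. ?l i * vandermonde_prod n (?l(i := ?l i - 1)) / ?P)"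
    by (rule sum.mono_neutral_left) (use bad in auto)
  also have "\<dots> = (\<Sum>i=1..n. ?l i * vandermonde_prod n (?l(i := ?l i - 1))) / ?P"
    by (simp add: sum_divide_distrib)
  also have "\<dots> = ((\<Sum>i=1..n. ?l i) - (\<Sum>i=1..n. real (n - i))) * vandermonde_prod n ?l / ?P"
    by (subst vandermonde_lowering) simp
  also have "(\<Sum>i=1..n. ?l i) - (\<Sum>i=1..n. real (n - i)) = real (part_sum lam n)"
    unfolding part_sum_def of_nat_sum sum_subtractf[symmetric] by (rule sum.cong) (auto simp: shifted_def)
  finally show ?thesis by (simp add: expcoef_def)
qed

text \<open>Multiplication by the first power sum adds one box. Exchanging the sums over partitions and boxes
turns the coefficient of lam into the sum over the boxes that can be removed from lam.\<close>

lemma power_sum_expansion_alt: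
  fixes x :: "nat \<Rightarrow> 'a::real_field"
  shows "(\<Sum>i=1..n. x i) ^ d * vandermonde_prod n x = fact d * (\<Sum>lam\<in>partitions_of_size n d. of_real (expcoef n lam) * alt n (shifted n lam) x)"
proof (induction d)
  case 0
  have "partitions_of_size n 0 = {\<lambda>_. 0}"
  proof (rule equalityI; rule subsetI)
    fix lam assume "lam \<in> partitions_of_size n 0"
    then have lam: "lam \<in> partitions_len n" "part_sum lam n = 0" by (auto simp: partitions_of_size_def)
    have "lam i = 0" for i
      using lam partitions_lenD(2)[OF lam(1), of i] by (cases "i \<in> {1..n}") (auto simp: part_sum_def)
    then show "lam \<in> {\<lambda>_. 0}" by auto
  qed (auto simp: partitions_of_size_def part_sum_def intro!: partitions_lenI)
  moreover have "expcoef n (\<lambda>_. 0) = 1"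
  proof -
    have "vandermonde_prod n (\<lambda>i. real (shifted n (\<lambda>_. 0) i)) = vandermonde_prod n (\<lambda>i. real n - real i)"
      unfolding vandermonde_prod_def shifted_def by (intro prod.cong refl) (auto simp: of_nat_diff)
    then show ?thesis using beta_pos[of n] prod_fact_delta[of n]
      unfolding expcoef_def by (simp add: vandermonde_delta shifted_def)
  qed
  moreover have "alt n (shifted n (\<lambda>_. 0)) x = vandermonde_prod n x"
    unfolding vandermonde_eq_alt by (rule alt_cong) (auto simp: shifted_def)
  ultimately show ?case by simp
next
  case (Suc d)
  let ?a = "\<lambda>lam. alt n (shifted n lam) x"
  let ?c = "\<lambda>lam. of_real (expcoef n lam) :: 'a"
  let ?S1 = "Sigma (partitions_of_size n d) (\<lambda>lam. {i\<in>{1..n}. add_ind {i} lam \<in> partitions_len n})"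
  \<comment> \<open>Pairs of a partition of size d with an addable box correspond to pairs of a partition of size d + 1 with a removable box.\<close>
  let ?S2 = "Sigma (partitions_of_size n (Suc d)) (\<lambda>lam. {i\<in>{1..n}. \<exists>mu\<in>partitions_len n. add_ind {i} mu = lam})"
  let ?down = "\<lambda>i lam j. lam j - (if j = i then 1 else (0::nat))"
  have down: "?down i (add_ind {i} mu) = mu" for i mu by (auto simp: add_ind_def)
  have "(\<Sum>i=1..n. x i) * (\<Sum>lam\<in>partitions_of_size n d. ?c lam * ?a lam) = 
     (\<Sum>lam\<in>partitions_of_size n d. \<Sum>i\<in>{1..n}. ?c lam * ?a (add_ind {i} lam))"
  proof -
    have "(\<Sum>i=1..n. x i) * (?c lam * ?a lam) = (\<Sum>i\<in>{1..n}. ?c lam * ?a (add_ind {i} lam))" for lam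
      unfolding sum_distrib_left[symmetric] power_sum_times_alt[symmetric] by (simp only: mult.left_commute)
    then show ?thesis unfolding sum_distrib_left[of _ _ "partitions_of_size n d"] by (simp only:)
  qed
  also have "\<dots> = (\<Sum>lam\<in>partitions_of_size n d. \<Sum>i\<in>{i\<in>{1..n}. add_ind {i} lam \<in> partitions_len n}. ?c lam * ?a (add_ind {i} lam))"
  proof (rule sum.cong[OF refl], rule sum.mono_neutral_right)
    fix lam assume "lam \<in> partitions_of_size n d"
    then have lam: "lam \<in> partitions_len n" by (simp add: partitions_of_size_def)
    show "\<forall>i\<in>{1..n} - {i\<in>{1..n}. add_ind {i} lam \<in> partitions_len n}. ?c lam * ?a (add_ind {i} lam) = 0"
      using alt_shifted_add_ind[OF lam, of "{_}" x] by auto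
  qed auto
  also have "\<dots> = (\<Sum>(lam, i)\<in>?S1. ?c lam * ?a (add_ind {i} lam))"
    by (rule sum.Sigma) (auto simp: finite_partitions_of_size)
  also have "\<dots> = (\<Sum>(lam, i)\<in>?S2. ?c (?down i lam) * ?a lam)"
  proof (rule sum.reindex_bij_witness[of _ "\<lambda>(lam, i). (?down i lam, i)" "\<lambda>(lam, i). (add_ind {i} lam, i)"], goal_cases)
    case (1 p) then show ?case by (auto simp: down)
  next
    case (2 p) then show ?case by (auto simp: down partitions_of_size_def part_sum_single)
  next
    case (3 p) then show ?case by (auto simp: down)
  next
    case (4 p) then show ?case by (auto simp: down partitions_of_size_def part_sum_single)
  next
    case (5 p) then show ?case by (auto simp: down)
  qed
  also have "\<dots> = (\<Sum>lam\<in>partitions_of_size n (Suc d). \<Sum>i\<in>{i\<in>{1..n}. \<exists>mu\<in>partitions_len n. add_ind {i} mu = lam}. ?c (?down i lam) * ?a lam)"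
    by (rule sum.Sigma[symmetric]) (auto simp: finite_partitions_of_size)
  also have "\<dots> = (\<Sum>lam\<in>partitions_of_size n (Suc d). of_nat (Suc d) * (?c lam * ?a lam))"
  proof (rule sum.cong[OF refl])
    fix lam assume "lam \<in> partitions_of_size n (Suc d)"
    then have lam: "lam \<in> partitions_len n" "part_sum lam n = Suc d" by (auto simp: partitions_of_size_def)
    have "(\<Sum>i\<in>{i\<in>{1..n}. \<exists>mu\<in>partitions_len n. add_ind {i} mu = lam}. ?c (?down i lam)) = of_real (real (Suc d) * expcoef n lam)"
      unfolding of_real_sum[symmetric] expcoef_recursion[OF lam(1)] lam(2) ..
    then show "(\<Sum>i\<in>{i\<in>{1..n}. \<exists>mu\<in>partitions_len n. add_ind {i} mu = lam}. ?c (?down i lam) * ?a lam) = of_nat (Suc d) * (?c lam * ?a lam)"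
      unfolding sum_distrib_right[symmetric] by (simp add: mult.assoc)
  qed
  finally have *: "(\<Sum>i=1..n. x i) * (\<Sum>lam\<in>partitions_of_size n d. ?c lam * ?a lam) = of_nat (Suc d) * (\<Sum>lam\<in>partitions_of_size n (Suc d). ?c lam * ?a lam)"
    by (simp only: sum_distrib_left)
  have "(\<Sum>i=1..n. x i) ^ Suc d * vandermonde_prod n x = (\<Sum>i=1..n. x i) * (fact d * (\<Sum>lam\<in>partitions_of_size n d. ?c lam * ?a lam))"
    using Suc.IH by (simp only: power_Suc mult.assoc)
  also have "\<dots> = fact d * (of_nat (Suc d) * (\<Sum>lam\<in>partitions_of_size n (Suc d). ?c lam * ?a lam))"
    by (simp only: *[symmetric] mult.left_commute)
  also have "\<dots> = fact (Suc d) * (\<Sum>lam\<in>partitions_of_size n (Suc d). ?c lam * ?a lam)"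
    by (simp only: fact_Suc mult.assoc mult.left_commute of_nat_mult)
  finally show ?case .
qed

lemma power_sum_expansion:
  fixes x :: "nat \<Rightarrow> 'a::real_normed_field"
  shows "(\<Sum>i=1..n. x i) ^ d = fact d * (\<Sum>lam\<in>partitions_of_size n d. of_real (expcoef n lam) * schur n lam x)"
proof (rule poly_fun_eqI[of n "\<lambda>x. (\<Sum>i=1..n. x i) ^ d" "\<lambda>x. fact d * (\<Sum>lam\<in>partitions_of_size n d. of_real (expcoef n lam) * schur n lam x)"])
  have "poly_fun n (\<lambda>x::nat \<Rightarrow> 'a. \<Prod>_<d. \<Sum>i=1..n. x i)"
    by (intro poly_fun_prod poly_fun_sum poly_fun_var) auto
  then show "poly_fun n (\<lambda>x::nat \<Rightarrow> 'a. (\<Sum>i=1..n. x i) ^ d)" by simp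
  show "poly_fun n (\<lambda>x::nat \<Rightarrow> 'a. fact d * (\<Sum>lam\<in>partitions_of_size n d. of_real (expcoef n lam) * schur n lam x))"
    by (intro poly_fun_mult poly_fun_const poly_fun_sum schur_props(1)) (simp add: partitions_of_size_def)
  fix x :: "nat \<Rightarrow> 'a" assume "inj_on x {1..n}"
  then have V: "vandermonde_prod n x \<noteq> 0" by (simp add: vandermonde_prod_eq_0_iff)
  have "(\<Sum>i=1..n. x i) ^ d * vandermonde_prod n x = fact d * (\<Sum>lam\<in>partitions_of_size n d. of_real (expcoef n lam) * (vandermonde_prod n x * schur n lam x))"
    unfolding power_sum_expansion_alt
    by (intro arg_cong2[of _ _ _ _ "(*)"] refl sum.cong) (simp add: schur_props(2) partitions_of_size_def)
  also have "\<dots> = fact d * (\<Sum>lam\<in>partitions_of_size n d. of_real (expcoef n lam) * schur n lam x) * vandermonde_prod n x"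
    by (simp only: sum_distrib_left sum_distrib_right mult_ac)
  finally show "(\<Sum>i=1..n. x i) ^ d = fact d * (\<Sum>lam\<in>partitions_of_size n d. of_real (expcoef n lam) * schur n lam x)"
    using V by simp
qed

lemma expcoef_eq: 
  assumes "lam \<in> partitions_len n"
  shows "expcoef n lam = beta n * schur n lam (\<lambda>_. 1) / (\<Prod>j=1..n. fact (lam j + n - j))"
  unfolding expcoef_def schur_one[OF assms] shifted_def ..

section \<open>Polynomial functions on matrices\<close>

(* From here on $ is only indexing of the type-indexed vectors; otherwise every entry A $ i $ j
   would be parsed in several ways. *)
no_notation Matrix.vec_index (infixl "$" 100)

text \<open>Polynomials in the entries of a matrix, generated as functions; identities for operators that
satisfy the Leibniz rule are proved by induction over this generation.\<close>

inductive mpoly :: "(complex^'n^'n \<Rightarrow> complex) \<Rightarrow> bool" where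
  mpoly_const: "mpoly (\<lambda>_. c)"
| mpoly_coord: "mpoly (\<lambda>A. A $ i $ j)"
| mpoly_add: "mpoly f \<Longrightarrow> mpoly g \<Longrightarrow> mpoly (\<lambda>A. f A + g A)"
| mpoly_mult: "mpoly f \<Longrightarrow> mpoly g \<Longrightarrow> mpoly (\<lambda>A. f A * g A)"

lemma mpoly_minus: "mpoly f \<Longrightarrow> mpoly g \<Longrightarrow> mpoly (\<lambda>A. f A - g A)"
  using mpoly_add[OF _ mpoly_mult[OF mpoly_const[of "-1"]], of f g] by simp

lemma mpoly_sum: "(\<And>j. j \<in> J \<Longrightarrow> mpoly (f j)) \<Longrightarrow> mpoly (\<lambda>A. \<Sum>j\<in>J. f j A)"
  by (induction J rule: infinite_finite_induct) (auto intro: mpoly_const mpoly_add)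

lemma mpoly_prod: "(\<And>j. j \<in> J \<Longrightarrow> mpoly (f j)) \<Longrightarrow> mpoly (\<lambda>A. \<Prod>j\<in>J. f j A)"
  by (induction J rule: infinite_finite_induct) (auto intro: mpoly_const mpoly_mult)

lemma mpoly_comp:
  assumes "mpoly f" and W: "\<And>i j. mpoly (\<lambda>A. W A $ i $ j)"
  shows "mpoly (\<lambda>A. f (W A))"
  using assms(1) by induction (auto intro: mpoly.intros W)

lemma mm_nth: "(A ** B) $ i $ j = (\<Sum>k\<in>UNIV. A $ i $ k * B $ k $ j)"
  by (simp add: matrix_matrix_mult_def)

lemma ct_nth: "conj_transpose A $ i $ j = cnj (A $ j $ i)"
  by (simp add: conj_transpose_def transpose_def map_matrix_def)

lemma mpoly_mm_left: "mpoly (\<lambda>A. (M ** A) $ i $ j)"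
  unfolding mm_nth by (intro mpoly_sum mpoly.intros)

lemma mpoly_mm_right: "mpoly (\<lambda>A. (A ** M) $ i $ j)"
  unfolding mm_nth by (intro mpoly_sum mpoly.intros)

lemma mpoly_left: "mpoly f \<Longrightarrow> mpoly (\<lambda>A. f (M ** A))"
  by (rule mpoly_comp[OF _ mpoly_mm_left])

lemma continuous_mpoly: "mpoly f \<Longrightarrow> continuous_on S f"
  by (induction rule: mpoly.induct) (auto intro!: continuous_intros)

text \<open>The parameter is complex, so that differentiation along lines is complex linear in the direction.\<close>

definition line :: "complex^'n^'n \<Rightarrow> complex^'n^'n \<Rightarrow> complex \<Rightarrow> complex^'n^'n" where
  "line A Y t = (\<chi> i j. A $ i $ j + t * Y $ i $ j)"

lemma line_nth [simp]: "line A Y t $ i $ j = A $ i $ j + t * Y $ i $ j"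
  by (simp add: line_def)

lemma line_0 [simp]: "line A Y 0 = A"
  by (simp add: vec_eq_iff)

lemma mpoly_line:
  assumes "mpoly f" shows "\<exists>p. \<forall>t. f (line A Y t) = poly p t"
  using assms
proof induction
  case (mpoly_const c)
  show ?case by (rule exI[of _ "[:c:]"]) simp
next
  case (mpoly_coord i j)
  show ?case by (rule exI[of _ "[:A $ i $ j, Y $ i $ j:]"]) simp
next
  case (mpoly_add f g)
  then obtain p q where "\<forall>t. f (line A Y t) = poly p t" "\<forall>t. g (line A Y t) = poly q t" by (elim exE)
  then show ?case by (intro exI[of _ "p + q"]) simp
next
  case (mpoly_mult f g)
  then obtain p q where "\<forall>t. f (line A Y t) = poly p t" "\<forall>t. g (line A Y t) = poly q t" by (elim exE)
  then show ?case by (intro exI[of _ "p * q"]) simp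
qed

definition ddir :: "complex^'n^'n \<Rightarrow> (complex^'n^'n \<Rightarrow> complex) \<Rightarrow> complex^'n^'n \<Rightarrow> complex" where
  "ddir Y f A = deriv (\<lambda>t. f (line A Y t)) 0"

lemma has_derivative_line:
  assumes "mpoly f"
  shows "((\<lambda>t. f (line A Y t)) has_field_derivative ddir Y f A) (at 0)"
proof -
  obtain p where p: "\<forall>t. f (line A Y t) = poly p t" using mpoly_line[OF assms] by metis
  have "((\<lambda>t. f (line A Y t)) has_field_derivative poly (pderiv p) 0) (at 0)"
    using p poly_DERIV[of p 0] by presburger
  then show ?thesis unfolding ddir_def by (metis DERIV_imp_deriv)
qed

lemma ddir_const [simp]: "ddir Y (\<lambda>_. c) A = 0"
  by (simp add: ddir_def)

lemma ddir_coord [simp]: "ddir Y (\<lambda>A. A $ i $ j) A = Y $ i $ j"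
  unfolding ddir_def by (rule DERIV_imp_deriv) (auto intro!: derivative_eq_intros)

lemma ddir_add: "mpoly f \<Longrightarrow> mpoly g \<Longrightarrow> ddir Y (\<lambda>A. f A + g A) A = ddir Y f A + ddir Y g A"
  unfolding ddir_def[of Y "\<lambda>A. f A + g A"] by (rule DERIV_imp_deriv[OF DERIV_add[OF has_derivative_line has_derivative_line]])

lemma ddir_mult: "mpoly f \<Longrightarrow> mpoly g \<Longrightarrow> ddir Y (\<lambda>A. f A * g A) A = ddir Y f A * g A + f A * ddir Y g A"
  unfolding ddir_def[of Y "\<lambda>A. f A * g A"]
  using DERIV_imp_deriv[OF DERIV_mult[OF has_derivative_line[of f A Y] has_derivative_line[of g A Y]]] by simp

lemma ddir_sum: "(\<And>j. j \<in> J \<Longrightarrow> mpoly (f j)) \<Longrightarrow> ddir Y (\<lambda>A. \<Sum>j\<in>J. f j A) A = (\<Sum>j\<in>J. ddir Y (f j) A)"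
  by (induction J rule: infinite_finite_induct) (auto simp: ddir_add mpoly_sum)

definition munit :: "'n \<Rightarrow> 'n \<Rightarrow> complex^'n^'n" where
  "munit a b = (\<chi> i j. if i = a \<and> j = b then 1 else 0)"

lemma munit_nth: "munit a b $ i $ j = (if i = a \<and> j = b then 1 else 0)"
  by (simp add: munit_def)

lemma ddir_expand:
  assumes "mpoly f"
  shows "ddir Y f A = (\<Sum>i\<in>UNIV. \<Sum>j\<in>UNIV. Y $ i $ j * ddir (munit i j) f A)"
  using assms
proof induction
  case (mpoly_coord a b)
  have "(\<Sum>i\<in>UNIV. \<Sum>j\<in>UNIV. Y $ i $ j * munit i j $ a $ b) = (\<Sum>i\<in>UNIV. if a = i then \<Sum>j\<in>UNIV. if b = j then Y $ i $ j else 0 else 0)"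
    by (intro sum.cong refl) (simp add: munit_nth if_distrib cong: if_cong)
  then show ?case by simp
next
  case (mpoly_add f g)
  then show ?case by (simp add: ddir_add distrib_left sum.distrib)
next
  case (mpoly_mult f g)
  then show ?case by (simp add: ddir_mult distrib_left sum.distrib sum_distrib_left sum_distrib_right mult_ac)
qed simp

lemma mpoly_ddir:
  assumes "mpoly f" and W: "\<And>i j. mpoly (\<lambda>A. W A $ i $ j)"
  shows "mpoly (\<lambda>A. ddir (W A) f A)"
  using assms(1) by induction (auto simp: ddir_add ddir_mult intro!: mpoly.intros W)

section \<open>Derivations of left and right multiplication\<close>

definition derivation :: "((complex^'n^'n \<Rightarrow> complex) \<Rightarrow> complex^'n^'n \<Rightarrow> complex) \<Rightarrow> bool" where
  "derivation T \<longleftrightarrow> (\<forall>f. mpoly f \<longrightarrow> mpoly (T f)) \<and> (\<forall>c. T (\<lambda>_. c) = (\<lambda>_. 0)) \<and>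
     (\<forall>f g. mpoly f \<longrightarrow> mpoly g \<longrightarrow> T (\<lambda>A. f A + g A) = (\<lambda>A. T f A + T g A)) \<and>
     (\<forall>f g. mpoly f \<longrightarrow> mpoly g \<longrightarrow> T (\<lambda>A. f A * g A) = (\<lambda>A. T f A * g A + f A * T g A))"

lemma derivationD:
  assumes "derivation T"
  shows "mpoly f \<Longrightarrow> mpoly (T f)" "T (\<lambda>_. c) = (\<lambda>_. 0)"
    "mpoly f \<Longrightarrow> mpoly g \<Longrightarrow> T (\<lambda>A. f A + g A) = (\<lambda>A. T f A + T g A)"
    "mpoly f \<Longrightarrow> mpoly g \<Longrightarrow> T (\<lambda>A. f A * g A) = (\<lambda>A. T f A * g A + f A * T g A)"
  using assms unfolding derivation_def by metis+

lemma derivation_ddir: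
  "(\<And>i j. mpoly (\<lambda>A. W A $ i $ j)) \<Longrightarrow> derivation (\<lambda>f A. ddir (W A) f A)"
  unfolding derivation_def by (auto simp: mpoly_ddir ddir_add ddir_mult)

lemma derivation_commutator:
  assumes T: "derivation T" and S: "derivation S"
  shows "derivation (\<lambda>f A. T (S f) A - S (T f) A)"
  unfolding derivation_def
  by (auto simp: derivationD[OF T] derivationD[OF S] mpoly.intros algebra_simps intro!: mpoly_minus ext)

lemma derivation_diff:
  assumes T: "derivation T" and S: "derivation S"
  shows "derivation (\<lambda>f A. T f A - S f A)"
  unfolding derivation_def
  by (auto simp: derivationD[OF T] derivationD[OF S] mpoly.intros algebra_simps intro!: mpoly_minus ext)

lemma derivation_zero: "derivation (\<lambda>f A. 0)"
  unfolding derivation_def by (auto intro: mpoly.intros)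

text \<open>A derivation on polynomials is determined by its values on the coordinates. This reduces the
commutation relations below to identities between matrix entries.\<close>

lemma derivation_eqI:
  assumes T: "derivation T" and S: "derivation S"
    and eq: "\<And>i j. T (\<lambda>A. A $ i $ j) = S (\<lambda>A. A $ i $ j)"
    and f: "mpoly f"
  shows "T f = S f"
  using f by induction (auto simp: derivationD[OF T] derivationD[OF S] eq)

lemma derivation_sum:
  assumes T: "derivation T" and "\<And>j. j \<in> J \<Longrightarrow> mpoly (f j)"
  shows "T (\<lambda>A. \<Sum>j\<in>J. f j A) = (\<lambda>A. \<Sum>j\<in>J. T (f j) A)"
  using assms(2) by (induction J rule: infinite_finite_induct) (auto simp: derivationD[OF T] mpoly_sum)

lemma derivation_cmult:
  assumes T: "derivation T" and "mpoly f"
  shows "T (\<lambda>A. c * f A) = (\<lambda>A. c * T f A)"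
  using derivationD(4)[OF T mpoly_const assms(2), of c] by (simp add: derivationD(2)[OF T])

text \<open>The infinitesimal generators of left and right multiplication by exp (t Y).\<close>

definition lder :: "complex^'n^'n \<Rightarrow> (complex^'n^'n \<Rightarrow> complex) \<Rightarrow> complex^'n^'n \<Rightarrow> complex" where
  "lder Y f A = ddir (Y ** A) f A"

definition rder :: "complex^'n^'n \<Rightarrow> (complex^'n^'n \<Rightarrow> complex) \<Rightarrow> complex^'n^'n \<Rightarrow> complex" where
  "rder Y f A = ddir (A ** Y) f A"

lemma derivation_lder: "derivation (lder Y)"
  unfolding lder_def[abs_def] by (rule derivation_ddir) (rule mpoly_mm_left)

lemma derivation_rder: "derivation (rder Y)"
  unfolding rder_def[abs_def] by (rule derivation_ddir) (rule mpoly_mm_right)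

lemma lder_coord: "lder Y (\<lambda>A. A $ i $ j) = (\<lambda>A. (Y ** A) $ i $ j)"
  by (simp add: lder_def fun_eq_iff)

lemma rder_coord: "rder Y (\<lambda>A. A $ i $ j) = (\<lambda>A. (A ** Y) $ i $ j)"
  by (simp add: rder_def fun_eq_iff)

lemma lder_rder_commute:
  assumes "mpoly f" shows "lder X (rder Y f) = rder Y (lder X f)"
proof -
  have "(\<lambda>A. lder X (rder Y f) A - rder Y (lder X f) A) = (\<lambda>A. 0)"
  proof (rule derivation_eqI[OF derivation_commutator[OF derivation_lder derivation_rder] derivation_zero _ assms])
    fix i j :: 'a
    have 1: "lder X (\<lambda>A. (A ** Y) $ i $ j) = (\<lambda>A. \<Sum>k\<in>UNIV. (X ** A) $ i $ k * Y $ k $ j)"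
      unfolding mm_nth[of _ Y] 
      by (subst derivation_sum[OF derivation_lder])
         (auto intro!: mpoly.intros simp: derivationD(2,4)[OF derivation_lder] mpoly.intros lder_coord)
    have 2: "rder Y (\<lambda>A. (X ** A) $ i $ j) = (\<lambda>A. \<Sum>k\<in>UNIV. X $ i $ k * (A ** Y) $ k $ j)"
      unfolding mm_nth[of X]
      by (subst derivation_sum[OF derivation_rder])
         (auto intro!: mpoly.intros simp: derivationD(2,4)[OF derivation_rder] mpoly.intros rder_coord)
    show "(\<lambda>A. lder X (rder Y (\<lambda>A. A $ i $ j)) A - rder Y (lder X (\<lambda>A. A $ i $ j)) A) = (\<lambda>A. 0)"
      unfolding lder_coord rder_coord 1 2 mm_nth[symmetric] by (simp add: matrix_mul_assoc)
  qed
  then show ?thesis by (metis (no_types, lifting) eq_iff_diff_eq_0 ext)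
qed

lemma lder_expand:
  assumes "mpoly f" shows "lder Y f A = (\<Sum>i\<in>UNIV. \<Sum>j\<in>UNIV. Y $ i $ j * lder (munit i j) f A)"
proof (rule fun_cong[OF derivation_eqI[of "lder Y" "\<lambda>f A. \<Sum>i\<in>UNIV. \<Sum>j\<in>UNIV. Y $ i $ j * lder (munit i j) f A"]])
  show "derivation (\<lambda>f A. \<Sum>i\<in>UNIV. \<Sum>j\<in>UNIV. Y $ i $ j * lder (munit i j) f A)"
    unfolding derivation_def
    by (auto simp: derivationD[OF derivation_lder] mpoly.intros algebra_simps sum.distrib sum_distrib_left intro!: mpoly_sum mpoly.intros ext)
  show "lder Y (\<lambda>A. A $ a $ b) = (\<lambda>A. \<Sum>i\<in>UNIV. \<Sum>j\<in>UNIV. Y $ i $ j * lder (munit i j) (\<lambda>A. A $ a $ b) A)" for a b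
  proof
    fix A
    have "(\<Sum>i\<in>UNIV. \<Sum>j\<in>UNIV. Y $ i $ j * lder (munit i j) (\<lambda>A. A $ a $ b) A) = 
      (\<Sum>i\<in>UNIV. \<Sum>j\<in>UNIV. if a = i then Y $ i $ j * A $ j $ b else 0)"
      unfolding lder_coord mm_nth munit_nth
      by (intro sum.cong refl) (auto simp: if_distrib if_distribR cong: if_cong)
    also have "\<dots> = (\<Sum>j\<in>UNIV. \<Sum>i\<in>UNIV. if a = i then Y $ i $ j * A $ j $ b else 0)"
      by (rule sum.swap)
    also have "\<dots> = (Y ** A) $ a $ b" by (simp add: mm_nth)
    finally show "lder Y (\<lambda>A. A $ a $ b) A = (\<Sum>i\<in>UNIV. \<Sum>j\<in>UNIV. Y $ i $ j * lder (munit i j) (\<lambda>A. A $ a $ b) A)"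
      by (simp add: lder_coord)
  qed
qed (rule derivation_lder assms)+

text \<open>The bracket of E_ab and E_ba; the sign is reversed, because these generators form an
antihomomorphism.\<close>

lemma lder_commutator:
  assumes "mpoly f"
  shows "lder (munit a b) (lder (munit b a) f) A - lder (munit b a) (lder (munit a b) f) A = lder (munit b b) f A - lder (munit a a) f A"
proof -
  have mu: "(munit c d ** A) $ i $ j = (if i = c then A $ d $ j else 0)" for c d i j :: 'a and A
    unfolding mm_nth munit_nth by (simp add: if_distrib if_distribR cong: if_cong)
  have z: "lder (munit c d) (\<lambda>A. if i = p then A $ q $ j else 0) = (\<lambda>A. if i = p \<and> q = c then A $ d $ j else 0)" for c d i j p q :: 'a
    by (cases "i = p") (auto simp: lder_coord mu derivationD(2)[OF derivation_lder])
  have "(\<lambda>A. lder (munit a b) (lder (munit b a) f) A - lder (munit b a) (lder (munit a b) f) A) = (\<lambda>A. lder (munit b b) f A - lder (munit a a) f A)"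
  proof (rule derivation_eqI[OF derivation_commutator derivation_diff _ assms])
    fix i j :: 'a
    show "(\<lambda>A. lder (munit a b) (lder (munit b a) (\<lambda>A. A $ i $ j)) A - lder (munit b a) (lder (munit a b) (\<lambda>A. A $ i $ j)) A) = 
      (\<lambda>A. lder (munit b b) (\<lambda>A. A $ i $ j) A - lder (munit a a) (\<lambda>A. A $ i $ j) A)"
      unfolding lder_coord mu z by (auto simp: fun_eq_iff)
  qed (rule derivation_lder)+
  then show ?thesis by (rule fun_cong)
qed

lemma mpoly_curve:
  assumes "mpoly f" and \<gamma>: "\<And>i j. ((\<lambda>t. \<gamma> t $ i $ j) has_vector_derivative Y $ i $ j) (at (0::real))"
  shows "((\<lambda>t. f (\<gamma> t)) has_vector_derivative ddir Y f (\<gamma> 0)) (at 0)"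
  using assms(1)
proof induction
  case (mpoly_const c) show ?case by simp
next
  case (mpoly_coord i j) show ?case using \<gamma> by simp
next
  case (mpoly_add f g)
  then show ?case by (simp add: ddir_add has_vector_derivative_add)
next
  case (mpoly_mult f g)
  then show ?case using has_vector_derivative_mult[OF mpoly_mult.IH] by (simp add: ddir_mult add.commute)
qed

section \<open>The unitary group and its class functions\<close>

lemma ct_mm: "conj_transpose (A ** B) = conj_transpose B ** conj_transpose A"
  by (simp add: vec_eq_iff ct_nth mm_nth mult.commute)

lemma ct_ct [simp]: "conj_transpose (conj_transpose A) = A"
  by (simp add: vec_eq_iff ct_nth)

lemma mat_nth: "(Finite_Cartesian_Product.mat c :: complex^'n^'n) $ i $ j = (if i = j then c else 0)"
  by (simp add: Finite_Cartesian_Product.mat_def)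

lemma unitaryD:
  assumes "U \<in> unitary_group"
  shows "U ** conj_transpose U = Finite_Cartesian_Product.mat 1" "conj_transpose U ** U = Finite_Cartesian_Product.mat 1"
  using assms by (auto simp: unitary_group_def)

lemma ct_one [simp]: "conj_transpose (Finite_Cartesian_Product.mat 1) = Finite_Cartesian_Product.mat 1"
  by (simp add: vec_eq_iff ct_nth mat_nth)

lemma unitary_one: "Finite_Cartesian_Product.mat 1 \<in> unitary_group"
  by (simp add: unitary_group_def)

lemma unitary_mm:
  assumes U: "U \<in> unitary_group" and V: "V \<in> unitary_group" shows "U ** V \<in> unitary_group"
proof -
  have "U ** V ** conj_transpose (U ** V) = U ** (V ** conj_transpose V) ** conj_transpose U"
    by (simp add: ct_mm matrix_mul_assoc)
  moreover have "conj_transpose (U ** V) ** (U ** V) = conj_transpose V ** (conj_transpose U ** U) ** V"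
    by (simp add: ct_mm matrix_mul_assoc)
  ultimately show ?thesis
    using unitaryD[OF U] unitaryD[OF V] by (simp add: unitary_group_def)
qed

lemma unitary_ct: "U \<in> unitary_group \<Longrightarrow> conj_transpose U \<in> unitary_group"
  by (auto simp: unitary_group_def)

lemma unitaryI:
  fixes U :: "complex^'n^'n"
  assumes "U ** conj_transpose U = Finite_Cartesian_Product.mat 1" shows "U \<in> unitary_group"
  using assms matrix_left_right_inverse[of U "conj_transpose U"] by (simp add: unitary_group_def)

lemma matrix_inv_unitary:
  assumes "U \<in> unitary_group" shows "matrix_inv U = conj_transpose U"
proof -
  let ?C = "conj_transpose U"
  have "U ** matrix_inv U = Finite_Cartesian_Product.mat 1 \<and> matrix_inv U ** U = Finite_Cartesian_Product.mat 1"
    unfolding matrix_inv_def by (rule someI[of _ ?C]) (simp add: unitaryD[OF assms])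
  then have "?C ** (U ** matrix_inv U) = ?C" by simp
  then show ?thesis by (simp add: matrix_mul_assoc unitaryD[OF assms])
qed

lemma unitary_entry_bound:
  assumes "U \<in> unitary_group" shows "norm (U $ i $ j) \<le> 1"
proof -
  have "(U ** conj_transpose U) $ i $ i = 1" using unitaryD(1)[OF assms] by (simp add: mat_nth)
  then have "(\<Sum>k\<in>UNIV. U $ i $ k * cnj (U $ i $ k)) = 1" by (simp add: mm_nth ct_nth)
  then have "complex_of_real (\<Sum>k\<in>UNIV. (norm (U $ i $ k))\<^sup>2) = 1" by (simp add: complex_norm_square del: of_real_power)
  then have 1: "(\<Sum>k\<in>UNIV. (norm (U $ i $ k))\<^sup>2) = 1" by (metis of_real_eq_1_iff)
  have "(norm (U $ i $ j))\<^sup>2 \<le> (\<Sum>k\<in>UNIV. (norm (U $ i $ k))\<^sup>2)"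
    by (rule member_le_sum) auto
  then have "(norm (U $ i $ j))\<^sup>2 \<le> 1\<^sup>2" using 1 by simp
  then show ?thesis by (rule power2_le_imp_le) simp
qed

lemma norm_le_sum_entries: "norm (A :: complex^'n^'n) \<le> (\<Sum>i\<in>UNIV. \<Sum>j\<in>UNIV. norm (A $ i $ j))"
proof -
  have "norm A \<le> (\<Sum>i\<in>UNIV. norm (A $ i))"
    unfolding norm_vec_def by (rule L2_set_le_sum) simp
  also have "\<dots> \<le> (\<Sum>i\<in>UNIV. \<Sum>j\<in>UNIV. norm (A $ i $ j))"
    by (rule sum_mono) (simp add: norm_vec_def L2_set_le_sum)
  finally show ?thesis .
qed

lemma continuous_on_entries:
  fixes W :: "'a::topological_space \<Rightarrow> complex^'n^'n"
  assumes "\<And>i j. continuous_on S (\<lambda>x. W x $ i $ j)"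
  shows "continuous_on S W"
proof -
  have "continuous_on S (\<lambda>x. \<chi> i. \<chi> j. W x $ i $ j)"
    by (intro continuous_on_vec_lambda assms)
  then show ?thesis by (simp add: vec_lambda_eta)
qed

text \<open>Compactness makes continuous functions integrable and provides the maximum by which Hermitian
matrices are diagonalized.\<close>

lemma compact_unitary: "compact (unitary_group :: (complex^'n^'n) set)"
proof (rule compact_eq_bounded_closed[THEN iffD2], rule conjI)
  show "bounded (unitary_group :: (complex^'n^'n) set)"
    unfolding bounded_iff
  proof (intro exI ballI)
    fix U :: "complex^'n^'n" assume U: "U \<in> unitary_group"
    have "norm U \<le> (\<Sum>i::'n\<in>UNIV. \<Sum>j::'n\<in>UNIV. norm (U $ i $ j))" by (rule norm_le_sum_entries)
    also have "\<dots> \<le> (\<Sum>i::'n\<in>UNIV. \<Sum>j::'n\<in>UNIV. 1)" by (intro sum_mono unitary_entry_bound U)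
    finally show "norm U \<le> (\<Sum>i::'n\<in>UNIV. \<Sum>j::'n\<in>UNIV. 1)" .
  qed
  have c: "continuous_on UNIV (\<lambda>U :: complex^'n^'n. U ** conj_transpose U)"
    by (rule continuous_on_entries) (unfold mm_nth ct_nth, intro continuous_intros)
  have c': "continuous_on UNIV (\<lambda>U :: complex^'n^'n. conj_transpose U ** U)"
    by (rule continuous_on_entries) (unfold mm_nth ct_nth, intro continuous_intros)
  show "closed (unitary_group :: (complex^'n^'n) set)"
    unfolding unitary_group_def
    by (intro closed_Collect_conj closed_Collect_eq c c' continuous_on_const)
qed

text \<open>Invariance under unitary conjugation.\<close>

definition uclass :: "(complex^'n^'n \<Rightarrow> complex) \<Rightarrow> bool" where
  "uclass g \<longleftrightarrow> (\<forall>U\<in>unitary_group. \<forall>A. g (U ** A ** conj_transpose U) = g A)"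

text \<open>For distinct a and b and w of modulus 1, a rotation by the angle t in the plane of the coordinates a
and b, twisted by the phase w.\<close>

definition rot :: "'n \<Rightarrow> 'n \<Rightarrow> complex \<Rightarrow> real \<Rightarrow> complex^'n^'n" where
  "rot a b w t = (\<chi> i j. (if i = j then if i = a \<or> i = b then of_real (cos t) else 1 else 0)
     + (if i = a \<and> j = b then w * of_real (sin t) else 0) - (if i = b \<and> j = a then cnj w * of_real (sin t) else 0))"

text \<open>For distinct a and b, the derivative of the rotation at angle 0; it is skew-Hermitian.\<close>

definition rotgen :: "'n \<Rightarrow> 'n \<Rightarrow> complex \<Rightarrow> complex^'n^'n" where
  "rotgen a b w = (\<chi> i j. (if i = a \<and> j = b then w else 0) - (if i = b \<and> j = a then cnj w else 0))"

lemma rotgen_ct: "conj_transpose (rotgen a b w) = (\<chi> i j. - rotgen a b w $ i $ j)"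
proof -
  have g: "cnj ((if P then w else 0) - (if Q then cnj w else 0)) = - ((if Q then w else 0) - (if P then cnj w else 0))" for P Q
    by (cases P; cases Q) simp_all
  have "cnj (rotgen a b w $ j $ i) = - rotgen a b w $ i $ j" for i j
    unfolding rotgen_def vec_lambda_beta g conj_commute[of "j = b"] conj_commute[of "j = a"] ..
  then show ?thesis by (simp add: vec_eq_iff ct_nth)
qed

lemma rot_0: "rot a b w 0 = Finite_Cartesian_Product.mat 1"
  by (simp add: vec_eq_iff rot_def mat_nth)

lemma rot_unitary:
  assumes ab: "a \<noteq> b" and w: "w * cnj w = 1"
  shows "rot a b w t \<in> unitary_group"
proof (rule unitaryI)
  let ?c = "complex_of_real (cos t)" and ?s = "complex_of_real (sin t)"
  have cs: "?c * ?c + ?s * ?s = 1"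
    by (metis of_real_1 of_real_add of_real_mult sin_cos_squared_add3)
  have w': "cnj w * w = 1" using w by (simp add: mult.commute)
  let ?d = "\<lambda>k. if k = a \<or> k = b then ?c else (1::complex)"
  have row: "(\<Sum>k\<in>UNIV. rot a b w t $ i $ k * z k) = ?d i * z i + (if i = a then w * ?s * z b else 0) - (if i = b then cnj w * ?s * z a else 0)" for i z
  proof -
    have "(\<Sum>k\<in>UNIV. rot a b w t $ i $ k * z k) = (\<Sum>k\<in>UNIV. (if i = k then ?d i * z k else 0) + (if b = k then if i = a then w * ?s * z k else 0 else 0) - (if a = k then if i = b then cnj w * ?s * z k else 0 else 0))"
      by (intro sum.cong refl) (auto simp: rot_def algebra_simps)
    then show ?thesis by (simp add: sum.distrib sum_subtractf)
  qed
  have "(rot a b w t ** conj_transpose (rot a b w t)) $ i $ j = Finite_Cartesian_Product.mat 1 $ i $ j" for i j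
  proof -
    have "(rot a b w t ** conj_transpose (rot a b w t)) $ i $ j =
      ?d i * cnj (rot a b w t $ j $ i) + (if i = a then w * ?s * cnj (rot a b w t $ j $ b) else 0)
        - (if i = b then cnj w * ?s * cnj (rot a b w t $ j $ a) else 0)"
      unfolding mm_nth ct_nth by (rule row)
    also have "\<dots> = (if i = j then 1 else 0)"
    proof -
      have 1: "w * (cnj w * (?s * ?s)) = ?s * ?s" using w by (simp add: mult.assoc[symmetric])
      show ?thesis using ab ab[symmetric] cs 1 unfolding rot_def 
        by (cases "i = a"; cases "i = b"; cases "j = a"; cases "j = b") (auto simp: algebra_simps 1)
    qed
    finally show ?thesis by (simp add: mat_nth)
  qed
  then show "rot a b w t ** conj_transpose (rot a b w t) = Finite_Cartesian_Product.mat 1"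
    by (simp add: vec_eq_iff)
qed

lemma rot_derivative:
  assumes ab: "a \<noteq> b" 
  shows "((\<lambda>t. rot a b w t $ i $ j) has_vector_derivative rotgen a b w $ i $ j) (at 0)"
proof -
  have c: "((\<lambda>t. complex_of_real (cos t)) has_vector_derivative 0) (at 0)"
    by (rule has_vector_derivative_eq_rhs[OF has_vector_derivative_of_real]) (auto intro!: derivative_eq_intros simp: has_real_derivative_iff_has_vector_derivative[symmetric])
  have s: "((\<lambda>t. complex_of_real (sin t)) has_vector_derivative 1) (at 0)"
    by (rule has_vector_derivative_eq_rhs[OF has_vector_derivative_of_real]) (auto intro!: derivative_eq_intros simp: has_real_derivative_iff_has_vector_derivative[symmetric])
  have s': "((\<lambda>t. v * complex_of_real (sin t)) has_vector_derivative v) (at 0)" for v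
    using has_vector_derivative_mult_right[OF s, of v] by simp
  have 1: "((\<lambda>t. if i = j then if i = a \<or> i = b then complex_of_real (cos t) else 1 else 0) has_vector_derivative 0) (at 0)"
    by (cases "i = j"; cases "i = a \<or> i = b") (use c in auto)
  have 2: "((\<lambda>t. if P then v * complex_of_real (sin t) else 0) has_vector_derivative (if P then v else 0)) (at 0)" for P v
    using s' by auto
  show ?thesis unfolding rot_def rotgen_def
    using has_vector_derivative_diff[OF has_vector_derivative_add[OF 1 2[of "i = a \<and> j = b" w]] 2[of "i = b \<and> j = a" "cnj w"]]
    by simp
qed

lemma rot_conj_derivative:
  assumes f: "mpoly f" and ab: "a \<noteq> b"
  shows "((\<lambda>t. f (rot a b w t ** A ** conj_transpose (rot a b w t))) has_vector_derivative
     lder (rotgen a b w) f A - rder (rotgen a b w) f A) (at 0)"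
proof -
  let ?K = "rotgen a b w"
  have "((\<lambda>t. f (rot a b w t ** A ** conj_transpose (rot a b w t))) has_vector_derivative
     ddir ((?K ** A - A ** ?K)) f (rot a b w 0 ** A ** conj_transpose (rot a b w 0))) (at 0)"
  proof (rule mpoly_curve[OF f])
    fix i j
    have r: "((\<lambda>t. rot a b w t $ i $ k * A $ k $ l * cnj (rot a b w t $ j $ l)) has_vector_derivative
       (rot a b w 0 $ i $ k * A $ k $ l * cnj (?K $ j $ l) + ?K $ i $ k * A $ k $ l * cnj (rot a b w 0 $ j $ l))) (at 0)" for k l
      by (intro has_vector_derivative_mult has_vector_derivative_mult_left rot_derivative[OF ab] has_vector_derivative_cnj)
    have s: "((\<lambda>t. \<Sum>l\<in>UNIV. \<Sum>k\<in>UNIV. rot a b w t $ i $ k * A $ k $ l * cnj (rot a b w t $ j $ l)) has_vector_derivative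
       (\<Sum>l\<in>UNIV. \<Sum>k\<in>UNIV. rot a b w 0 $ i $ k * A $ k $ l * cnj (?K $ j $ l) + ?K $ i $ k * A $ k $ l * cnj (rot a b w 0 $ j $ l))) (at 0)"
      by (intro has_vector_derivative_sum r)
    have "(\<Sum>l\<in>UNIV. \<Sum>k\<in>UNIV. rot a b w 0 $ i $ k * A $ k $ l * cnj (?K $ j $ l) + ?K $ i $ k * A $ k $ l * cnj (rot a b w 0 $ j $ l))
       = (?K ** A - A ** ?K) $ i $ j"
    proof -
      have "cnj (?K $ j $ l) = - ?K $ l $ j" for l
        using arg_cong[OF rotgen_ct[of a b w], of "\<lambda>M. M $ l $ j"] by (simp add: ct_nth)
      then have "(\<Sum>l\<in>UNIV. \<Sum>k\<in>UNIV. rot a b w 0 $ i $ k * A $ k $ l * cnj (?K $ j $ l)) = (\<Sum>l\<in>UNIV. \<Sum>k\<in>UNIV. if i = k then A $ k $ l * - ?K $ l $ j else 0)"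
        by (intro sum.cong refl) (simp add: rot_0 mat_nth)
      then have 1: "(\<Sum>l\<in>UNIV. \<Sum>k\<in>UNIV. rot a b w 0 $ i $ k * A $ k $ l * cnj (?K $ j $ l)) = - (A ** ?K) $ i $ j"
        by (simp add: mm_nth sum_negf)
      have "(\<Sum>l\<in>UNIV. \<Sum>k\<in>UNIV. ?K $ i $ k * A $ k $ l * cnj (rot a b w 0 $ j $ l)) = (\<Sum>l\<in>UNIV. if j = l then \<Sum>k\<in>UNIV. ?K $ i $ k * A $ k $ l else 0)"
        by (intro sum.cong refl) (simp add: rot_0 mat_nth)
      then have 2: "(\<Sum>l\<in>UNIV. \<Sum>k\<in>UNIV. ?K $ i $ k * A $ k $ l * cnj (rot a b w 0 $ j $ l)) = (?K ** A) $ i $ j"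
        by (simp add: mm_nth)
      show ?thesis unfolding sum.distrib 1 2 by (simp add: vector_minus_component)
    qed
    with s show "((\<lambda>t. (rot a b w t ** A ** conj_transpose (rot a b w t)) $ i $ j) has_vector_derivative (?K ** A - A ** ?K) $ i $ j) (at 0)"
      by (simp add: mm_nth ct_nth sum_distrib_right)
  qed
  moreover have "rot a b w 0 ** A ** conj_transpose (rot a b w 0) = A"
    by (simp add: rot_0)
  moreover have "ddir ((?K ** A - A ** ?K)) f A = lder ?K f A - rder ?K f A"
    unfolding lder_def rder_def ddir_expand[OF f, of "(?K ** A - A ** ?K)"] ddir_expand[OF f, of "?K ** A"] ddir_expand[OF f, of "A ** ?K"]
    by (simp add: vector_minus_component left_diff_distrib sum_subtractf)
  ultimately show ?thesis by simp
qed

lemma rotgen_sum: "(\<Sum>i\<in>UNIV. \<Sum>j\<in>UNIV. rotgen a b w $ i $ j * F i j) = w * F a b - cnj w * F b a"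
proof -
  have d: "(\<Sum>i\<in>UNIV. \<Sum>j\<in>UNIV. (if i = p \<and> j = q then v else 0) * F i j) = v * F p q" for p q v
  proof -
    have "(\<Sum>i\<in>UNIV. \<Sum>j\<in>UNIV. (if i = p \<and> j = q then v else 0) * F i j) = (\<Sum>i\<in>UNIV. \<Sum>j\<in>UNIV. if q = j then if p = i then v * F i j else 0 else 0)"
      by (intro sum.cong refl) simp
    then show ?thesis by simp
  qed
  have "(\<Sum>i\<in>UNIV. \<Sum>j\<in>UNIV. rotgen a b w $ i $ j * F i j) = 
    (\<Sum>i\<in>UNIV. \<Sum>j\<in>UNIV. (if i = a \<and> j = b then w else 0) * F i j - (if i = b \<and> j = a then cnj w else 0) * F i j)"
    by (simp only: rotgen_def vec_lambda_beta left_diff_distrib)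
  then show ?thesis by (simp only: sum_subtractf d)
qed

lemma lder_rotgen:
  assumes f: "mpoly f"
  shows "lder (rotgen a b w) f A = w * lder (munit a b) f A - cnj w * lder (munit b a) f A"
  unfolding lder_expand[OF f, of "rotgen a b w"] rotgen_sum ..

lemma rder_expand:
  assumes "mpoly f" shows "rder Y f A = (\<Sum>i\<in>UNIV. \<Sum>j\<in>UNIV. Y $ i $ j * rder (munit i j) f A)"
proof (rule fun_cong[OF derivation_eqI[of "rder Y" "\<lambda>f A. \<Sum>i\<in>UNIV. \<Sum>j\<in>UNIV. Y $ i $ j * rder (munit i j) f A"]])
  show "derivation (\<lambda>f A. \<Sum>i\<in>UNIV. \<Sum>j\<in>UNIV. Y $ i $ j * rder (munit i j) f A)"
    unfolding derivation_def
    by (auto simp: derivationD[OF derivation_rder] mpoly.intros algebra_simps sum.distrib sum_distrib_left intro!: mpoly_sum mpoly.intros ext)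
  show "rder Y (\<lambda>A. A $ a $ b) = (\<lambda>A. \<Sum>i\<in>UNIV. \<Sum>j\<in>UNIV. Y $ i $ j * rder (munit i j) (\<lambda>A. A $ a $ b) A)" for a b
  proof
    fix A
    have "(\<Sum>i\<in>UNIV. \<Sum>j\<in>UNIV. Y $ i $ j * rder (munit i j) (\<lambda>A. A $ a $ b) A) = 
      (\<Sum>i\<in>UNIV. \<Sum>j\<in>UNIV. if b = j then Y $ i $ j * A $ a $ i else 0)"
      unfolding rder_coord mm_nth munit_nth
      by (intro sum.cong refl) (auto simp: if_distrib if_distribR cong: if_cong)
    also have "\<dots> = (A ** Y) $ a $ b" by (simp add: mm_nth mult.commute)
    finally show "rder Y (\<lambda>A. A $ a $ b) A = (\<Sum>i\<in>UNIV. \<Sum>j\<in>UNIV. Y $ i $ j * rder (munit i j) (\<lambda>A. A $ a $ b) A)"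
      by (simp add: rder_coord)
  qed
qed (rule derivation_rder assms)+

lemma rder_rotgen:
  assumes f: "mpoly f"
  shows "rder (rotgen a b w) f A = w * rder (munit a b) f A - cnj w * rder (munit b a) f A"
  unfolding rder_expand[OF f, of "rotgen a b w"] rotgen_sum ..

text \<open>Invariance makes the derivative along each one-parameter group of conjugations vanish. The
generators w E_ab - cnj w E_ba for w = 1 and w = i span E_ab over the complex numbers, so that the
conclusion extends from skew-Hermitian generators to the matrix unit.\<close>

lemma uclass_lder_eq_rder:
  assumes f: "mpoly g" and g: "uclass g" and ab: "a \<noteq> b"
  shows "lder (munit a b) g = rder (munit a b) g"
proof
  fix A
  \<comment> \<open>Conjugation by the rotations is constant on g, so its derivative at angle 0 is 0.\<close>
  have z: "lder (rotgen a b w) g A - rder (rotgen a b w) g A = 0" if w: "w * cnj w = 1" for w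
  proof -
    have "((\<lambda>t::real. g A) has_vector_derivative lder (rotgen a b w) g A - rder (rotgen a b w) g A) (at 0)"
      using rot_conj_derivative[OF f ab, of w A] rot_unitary[OF ab w] g by (simp add: uclass_def)
    then show ?thesis using vector_derivative_unique_at[OF has_vector_derivative_const] by metis
  qed
  let ?X = "lder (munit a b) g A" and ?Y = "lder (munit b a) g A" and ?R = "rder (munit a b) g A" and ?S = "rder (munit b a) g A"
  have 1: "?X - ?Y - (?R - ?S) = 0"
    using z[of 1] by (simp add: lder_rotgen[OF f] rder_rotgen[OF f])
  have "\<i> * (?X + ?Y - (?R + ?S)) = 0"
    using z[of \<i>] by (simp add: lder_rotgen[OF f] rder_rotgen[OF f] algebra_simps)
  then have 2: "?X + ?Y - (?R + ?S) = 0" by simp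
  have "2 * ?X = (?X - ?Y - (?R - ?S)) + (?X + ?Y - (?R + ?S)) + 2 * ?R" by (simp add: algebra_simps)
  then show "?X = ?R" by (simp only: 1 2) simp
qed

section \<open>Diagonal matrices\<close>

text \<open>An arbitrary numbering of the index type, which links matrix entries to eigenvalues and parts of
partitions, numbered from 1.\<close>

definition idx :: "'n::finite \<Rightarrow> nat" where
  "idx = (SOME f. bij_betw f UNIV {1..CARD('n)})"

lemma bij_idx: "bij_betw (idx :: 'n::finite \<Rightarrow> nat) UNIV {1..CARD('n)}"
proof -
  have "\<exists>f :: 'n \<Rightarrow> nat. bij_betw f UNIV {1..CARD('n)}" by (rule finite_same_card_bij) simp_all
  then show ?thesis unfolding idx_def by (rule someI_ex)
qed

lemma idx_in: "idx (i::'n::finite) \<in> {1..CARD('n)}"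
  using bij_betwE[OF bij_idx] by blast

lemma idx_eq [simp]: "idx (i::'n::finite) = idx j \<longleftrightarrow> i = j"
  using bij_betw_imp_inj_on[OF bij_idx] by (auto dest: injD)

lemma sum_idx: "(\<Sum>i::'n::finite\<in>UNIV. F (idx i)) = (\<Sum>i=1..CARD('n). F i)"
  by (rule sum.reindex_bij_betw[OF bij_idx])

lemma prod_idx: "(\<Prod>i::'n::finite\<in>UNIV. F (idx i)) = (\<Prod>i=1..CARD('n). F i)"
  by (rule prod.reindex_bij_betw[OF bij_idx])

definition diagm :: "(nat \<Rightarrow> complex) \<Rightarrow> complex^'n^'n" where
  "diagm x = (\<chi> i j. if i = j then x (idx i) else 0)"

lemma diagm_nth: "diagm x $ i $ j = (if i = j then x (idx i) else 0)"
  by (simp add: diagm_def)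

text \<open>Maximize tr (U A U^* D) over the unitary group, where D has the distinct entries 1, ..., n. At a
maximum the derivative along every rotation vanishes, and the derivative along the plane of a and b
is a nonzero multiple of the real part of w B_ba for B = U A U^*.\<close>

lemma hermitian_diagonalize:
  fixes A :: "complex^'n^'n"
  assumes A: "hermitian_matrix A"
  shows "\<exists>U\<in>unitary_group. \<exists>x. U ** A ** conj_transpose U = diagm (\<lambda>i. complex_of_real (x i))"
proof -
  \<comment> \<open>The trace of B D, where D is diagonal with the distinct entries 1, ..., n.\<close>
  define \<psi> where "\<psi> B = (\<Sum>i\<in>UNIV. of_nat (idx i) * B $ i $ i)" for B :: "complex^'n^'n"
  have \<psi>: "mpoly \<psi>" unfolding \<psi>_def by (intro mpoly_sum mpoly.intros)
  have c: "continuous_on unitary_group (\<lambda>U :: complex^'n^'n. Re (\<psi> (U ** A ** conj_transpose U)))"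
    unfolding \<psi>_def mm_nth ct_nth by (intro continuous_intros)
  obtain U where U: "U \<in> unitary_group" and max: "\<And>V. V \<in> unitary_group \<Longrightarrow> Re (\<psi> (V ** A ** conj_transpose V)) \<le> Re (\<psi> (U ** A ** conj_transpose U))"
    using continuous_attains_sup[OF compact_unitary _ c] unitary_one by blast
  let ?B = "U ** A ** conj_transpose U"
  have herm: "?B $ j $ i = cnj (?B $ i $ j)" for i j
  proof -
    have "conj_transpose ?B = ?B" using A by (simp add: hermitian_matrix_def ct_mm matrix_mul_assoc)
    then show ?thesis by (metis ct_nth)
  qed
  have off: "Re (w * ?B $ b $ a) = 0" if ab: "a \<noteq> b" and w: "w * cnj w = 1" for a b w
  proof -
    have "((\<lambda>t. Re (\<psi> (rot a b w t ** ?B ** conj_transpose (rot a b w t)))) has_real_derivative 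
        Re (lder (rotgen a b w) \<psi> ?B - rder (rotgen a b w) \<psi> ?B)) (at 0)"
      unfolding has_real_derivative_iff_has_vector_derivative
      by (rule bounded_linear.has_vector_derivative[OF bounded_linear_Re rot_conj_derivative[OF \<psi> ab]])
    moreover have "Re (\<psi> (rot a b w t ** ?B ** conj_transpose (rot a b w t))) \<le> Re (\<psi> (rot a b w 0 ** ?B ** conj_transpose (rot a b w 0)))" for t
      using max[OF unitary_mm[OF rot_unitary[OF ab w] U], of t]
      by (simp add: rot_0 ct_mm matrix_mul_assoc)
    ultimately have z: "Re (lder (rotgen a b w) \<psi> ?B - rder (rotgen a b w) \<psi> ?B) = 0"
      by (intro DERIV_local_max[where d = 1]) auto
    have DDpsi: "ddir Y \<psi> C = \<psi> Y" for Y C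
    proof -
      have "ddir Y \<psi> C = (\<Sum>i\<in>UNIV. ddir Y (\<lambda>B. of_nat (idx i) * B $ i $ i) C)"
        unfolding \<psi>_def[abs_def] by (rule ddir_sum) (intro mpoly.intros)
      also have "\<dots> = \<psi> Y" by (simp add: ddir_mult mpoly.intros \<psi>_def)
      finally show ?thesis .
    qed
    have l1: "(munit p q ** ?B) $ i $ i = (if p = i then ?B $ q $ i else 0)" for p q i
      unfolding mm_nth munit_nth by (simp add: if_distrib if_distribR cong: if_cong)
    have r1: "(?B ** munit p q) $ i $ i = (if q = i then ?B $ i $ p else 0)" for p q i
      unfolding mm_nth munit_nth by (simp add: if_distrib if_distribR cong: if_cong)
    have l2: "lder (munit p q) \<psi> ?B = of_nat (idx p) * ?B $ q $ p" for p q
      unfolding lder_def DDpsi unfolding \<psi>_def l1 by (simp add: if_distrib cong: if_cong)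
    have r2: "rder (munit p q) \<psi> ?B = of_nat (idx q) * ?B $ q $ p" for p q
      unfolding rder_def DDpsi unfolding \<psi>_def r1 by (simp add: if_distrib cong: if_cong)
    have "lder (rotgen a b w) \<psi> ?B - rder (rotgen a b w) \<psi> ?B = (of_nat (idx a) - of_nat (idx b)) * (w * ?B $ b $ a + cnj (w * ?B $ b $ a))"
      unfolding lder_rotgen[OF \<psi>] rder_rotgen[OF \<psi>] l2 r2 using herm[of b a] by (simp add: algebra_simps)
    also have "\<dots> = of_real ((real (idx a) - real (idx b)) * (2 * Re (w * ?B $ b $ a)))"
      by (simp only: complex_add_cnj of_real_mult of_real_diff of_real_of_nat_eq)
    finally have "(real (idx a) - real (idx b)) * (2 * Re (w * ?B $ b $ a)) = 0"
      using z by (metis Re_complex_of_real)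
    moreover have "real (idx a) - real (idx b) \<noteq> 0" using ab by simp
    ultimately show ?thesis by simp
  qed
  have "?B $ b $ a = 0" if "a \<noteq> b" for a b
    using off[OF that, of 1] off[OF that, of \<i>] by (auto simp: complex_eq_iff)
  moreover have "?B $ a $ a = complex_of_real (Re (?B $ a $ a))" for a
    using herm[of a a] by (metis complex_cnj_cancel_iff complex_is_Real_iff Reals_cnj_iff of_real_Re)
  moreover have "inv_into UNIV idx (idx a) = (a :: 'n)" for a by (rule inv_into_f_f) (auto intro: injI)
  moreover define d where "d i = Re (?B $ (inv_into UNIV idx i) $ (inv_into UNIV idx i))" for i
  ultimately have e: "?B $ i $ j = diagm (\<lambda>i. complex_of_real (d i)) $ i $ j" for i j
    by (cases "i = j") (simp_all add: diagm_nth d_def)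
  have "?B = diagm (\<lambda>i. complex_of_real (d i))"
    unfolding vec_eq_iff by (intro allI e)
  then show ?thesis using U by metis
qed

lemma diagm_tendsto_mpoly:
  assumes "mpoly h" and y: "\<And>i. i \<in> {1..CARD('n)} \<Longrightarrow> ((\<lambda>t. y t i) \<longlongrightarrow> x i) F"
  shows "((\<lambda>t. h (diagm (y t) :: complex^'n^'n)) \<longlongrightarrow> h (diagm x)) F"
  using assms(1)
proof induction
  case (mpoly_coord i j)
  show ?case unfolding diagm_nth using y[OF idx_in[of i]] by (cases "i = j") auto
qed (auto intro: tendsto_intros)

text \<open>Two invariant polynomials that agree on generic real diagonal matrices agree on all real diagonal
matrices by continuity and on Hermitian matrices by diagonalization. Every matrix is the value at
t = i of a line that is Hermitian for real t, and a polynomial in t is determined by its values at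
real t.\<close>

lemma uclass_eqI:
  fixes h h' :: "complex^'n^'n \<Rightarrow> complex"
  assumes h: "mpoly h" "uclass h" and h': "mpoly h'" "uclass h'"
    and eq: "\<And>x. inj_on x {1..CARD('n)} \<Longrightarrow> h (diagm (\<lambda>i. complex_of_real (x i))) = h' (diagm (\<lambda>i. complex_of_real (x i)))"
  shows "h = h'"
proof
  fix M :: "complex^'n^'n"
  have 1: "h (diagm (\<lambda>i. complex_of_real (x i))) = h' (diagm (\<lambda>i. complex_of_real (x i)))" for x
  proof (rule tendsto_unique)
    let ?y = "\<lambda>(t::real) i. x i + of_real t * of_nat i"
    have y: "((\<lambda>t. complex_of_real (?y t i)) \<longlongrightarrow> complex_of_real (x i)) (at 0)" for i
      by (auto intro!: tendsto_eq_intros)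
    show "((\<lambda>t. h (diagm (\<lambda>i. complex_of_real (?y t i)))) \<longlongrightarrow> h (diagm (\<lambda>i. complex_of_real (x i)))) (at 0)"
      by (rule diagm_tendsto_mpoly[OF h(1) y])
    have "((\<lambda>t. h' (diagm (\<lambda>i. complex_of_real (?y t i)))) \<longlongrightarrow> h' (diagm (\<lambda>i. complex_of_real (x i)))) (at 0)"
      by (rule diagm_tendsto_mpoly[OF h'(1) y])
    then show "((\<lambda>t. h (diagm (\<lambda>i. complex_of_real (?y t i)))) \<longlongrightarrow> h' (diagm (\<lambda>i. complex_of_real (x i)))) (at 0)"
      by (rule Lim_transform_eventually) 
         (rule eventually_mono[OF eventually_perturb_inj[of x "CARD('n)"]], rule eq[symmetric], assumption)
  qed auto
  have 2: "h A = h' A" if A: "hermitian_matrix A" for A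
  proof -
    obtain U x where U: "U \<in> unitary_group" and d: "U ** A ** conj_transpose U = diagm (\<lambda>i. complex_of_real (x i))"
      using hermitian_diagonalize[OF A] by blast
    have "h A = h (U ** A ** conj_transpose U)" using h(2) U by (simp add: uclass_def)
    also have "\<dots> = h' (U ** A ** conj_transpose U)" unfolding d by (rule 1)
    also have "\<dots> = h' A" using h'(2) U by (simp add: uclass_def)
    finally show ?thesis .
  qed
  \<comment> \<open>M = H + i K with H and K Hermitian.\<close>
  define H :: "complex^'n^'n" where "H = (\<chi> i j. (M $ i $ j + cnj (M $ j $ i)) / 2)"
  define K :: "complex^'n^'n" where "K = (\<chi> i j. (M $ i $ j - cnj (M $ j $ i)) / (2 * \<i>))"
  have M: "M = line H K \<i>" by (simp add: vec_eq_iff H_def K_def field_simps)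
  have herm: "hermitian_matrix (line H K (complex_of_real t))" for t
    by (simp add: hermitian_matrix_def vec_eq_iff ct_nth H_def K_def field_simps)
  obtain p q where p: "\<And>t. h (line H K t) = poly p t" and q: "\<And>t. h' (line H K t) = poly q t"
    using mpoly_line[OF h(1), of H K] mpoly_line[OF h'(1), of H K] by blast
  have "poly (p - q) (complex_of_real t) = 0" for t
    using 2[OF herm[of t]] by (simp add: p q)
  then have "range complex_of_real \<subseteq> {z. poly (p - q) z = 0}" by auto
  moreover have "infinite (range complex_of_real)"
    by (simp add: finite_image_iff infinite_UNIV_char_0 inj_of_real)
  ultimately have "p - q = 0" using poly_roots_finite finite_subset by blast
  then show "h M = h' M" unfolding M p q by simp
qed

section \<open>Principal minors and eigenvalues\<close>

text \<open>The principal minor with rows and columns in I, as a determinant of full size: the other rows are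
those of the identity.\<close>

definition minor :: "'n set \<Rightarrow> complex^'n^'n \<Rightarrow> complex" where
  "minor I M = Determinants.det (\<chi> i j. if i \<in> I then M $ i $ j else if i = j then 1 else 0)"

lemma minor_expand:
  "minor I M = (\<Sum>p | p permutes UNIV. of_int (sign p) * ((\<Prod>i\<in>I. M $ i $ p i) * (\<Prod>i\<in>- I. if i = p i then 1 else 0)))"
proof -
  have "(\<Prod>i\<in>UNIV. if i \<in> I then M $ i $ p i else if i = p i then 1 else 0) = 
     (\<Prod>i\<in>I. M $ i $ p i) * (\<Prod>i\<in>- I. if i = p i then 1 else 0)" for p :: "'a \<Rightarrow> 'a"
    by (simp add: prod.If_cases Compl_eq)
  then show ?thesis unfolding minor_def Determinants.det_def by simp
qed

lemma mpoly_minor: "mpoly (minor I)"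
proof -
  have "mpoly (\<lambda>M. minor I M)"
    unfolding minor_expand by (intro mpoly_sum mpoly_prod mpoly.intros)
  then show ?thesis by simp
qed

text \<open>Left multiplication by a diagonal matrix scales the rows, so minors scale by squarefree monomials.
Principal minors are the building blocks from which the exponents of Schur functions are found.\<close>

lemma minor_diagm: "minor I (diagm x ** M) = (\<Prod>i\<in>I. x (idx i)) * minor I M"
proof -
  have "(diagm x ** M) $ i $ j = x (idx i) * M $ i $ j" for i j
    unfolding mm_nth diagm_nth by (simp add: if_distrib[of "\<lambda>z. z * _"] cong: if_cong)
  then show ?thesis unfolding minor_expand sum_distrib_left
    by (intro sum.cong refl) (simp add: prod.distrib)
qed

lemma minor_empty: "minor {} M = 1"
proof -
  have "(\<chi> i j. if i \<in> {} then M $ i $ j else if i = j then 1 else 0) = Finite_Cartesian_Product.mat 1"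
    by (simp add: vec_eq_iff mat_nth)
  then show ?thesis unfolding minor_def by simp
qed

lemma char_poly_expand:
  fixes M :: "complex^'n^'n"
  shows "Determinants.det (Finite_Cartesian_Product.mat t - M) = (\<Sum>I\<in>UNIV. (-1) ^ card I * minor I M * t ^ (CARD('n) - card I))"
proof -
  have p: "(\<Prod>i\<in>UNIV. (Finite_Cartesian_Product.mat t - M) $ i $ p i) = 
    (\<Sum>I\<in>UNIV. (-1) ^ card I * t ^ (CARD('n) - card I) * ((\<Prod>i\<in>I. M $ i $ p i) * (\<Prod>i\<in>- I. if i = p i then 1 else 0)))" for p :: "'n \<Rightarrow> 'n"
  proof -
    have "(\<Prod>i\<in>UNIV. (Finite_Cartesian_Product.mat t - M) $ i $ p i) = (\<Prod>i\<in>UNIV. (-1) * M $ i $ p i + t * (if i = p i then 1 else 0))"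
      by (intro prod.cong refl) (simp add: mat_nth)
    also have "\<dots> = (\<Sum>I\<in>Pow UNIV. (\<Prod>i\<in>I. (-1) * M $ i $ p i) * (\<Prod>i\<in>UNIV - I. t * (if i = p i then 1 else 0)))"
      by (rule prod_add) simp
    also have "\<dots> = (\<Sum>I\<in>UNIV. (-1) ^ card I * t ^ (CARD('n) - card I) * ((\<Prod>i\<in>I. M $ i $ p i) * (\<Prod>i\<in>- I. if i = p i then 1 else 0)))"
    proof (rule sum.cong)
      fix I :: "'n set"
      have "card (- I) = CARD('n) - card I" unfolding Compl_eq_Diff_UNIV by (rule card_Diff_subset) simp_all
      then show "(\<Prod>i\<in>I. (-1) * M $ i $ p i) * (\<Prod>i\<in>UNIV - I. t * (if i = p i then 1 else 0)) = (-1) ^ card I * t ^ (CARD('n) - card I) * ((\<Prod>i\<in>I. M $ i $ p i) * (\<Prod>i\<in>- I. if i = p i then 1 else 0))"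
        unfolding prod.distrib Compl_eq_Diff_UNIV[symmetric] by simp
    qed simp
    finally show ?thesis .
  qed
  have "Determinants.det (Finite_Cartesian_Product.mat t - M) = (\<Sum>p | p permutes UNIV. \<Sum>I\<in>UNIV. of_int (sign p) * ((-1) ^ card I * t ^ (CARD('n) - card I) * ((\<Prod>i\<in>I. M $ i $ p i) * (\<Prod>i\<in>- I. if i = p i then 1 else 0))))"
    unfolding Determinants.det_def p sum_distrib_left ..
  also have "\<dots> = (\<Sum>I\<in>UNIV. \<Sum>p | p permutes UNIV. of_int (sign p) * ((-1) ^ card I * t ^ (CARD('n) - card I) * ((\<Prod>i\<in>I. M $ i $ p i) * (\<Prod>i\<in>- I. if i = p i then 1 else 0))))"
    by (rule sum.swap)
  also have "\<dots> = (\<Sum>I\<in>UNIV. (-1) ^ card I * minor I M * t ^ (CARD('n) - card I))"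
    unfolding minor_expand sum_distrib_left sum_distrib_right by (intro sum.cong refl) (simp only: mult_ac)
  finally show ?thesis .
qed

definition minor_sum :: "nat \<Rightarrow> complex^'n^'n \<Rightarrow> complex" where
  "minor_sum k M = (\<Sum>I | card I = k. minor I M)"

lemma mpoly_minor_sum: "mpoly (minor_sum k)"
proof -
  have "mpoly (\<lambda>M. minor_sum k M)" unfolding minor_sum_def by (intro mpoly_sum mpoly_minor)
  then show ?thesis by simp
qed

lemma group_by_card:
  fixes F :: "'b set \<Rightarrow> complex"
  assumes A: "finite A"
  shows "(\<Sum>I\<in>Pow A. (-1) ^ card I * F I * t ^ (card A - card I)) = (\<Sum>k\<le>card A. (-1) ^ (card A - k) * (\<Sum>I | I \<subseteq> A \<and> card I = card A - k. F I) * t ^ k)"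
proof -
  have "(\<Sum>I\<in>Pow A. (-1) ^ card I * F I * t ^ (card A - card I)) = 
    (\<Sum>k\<le>card A. \<Sum>I | I \<in> Pow A \<and> card A - card I = k. (-1) ^ card I * F I * t ^ (card A - card I))"
    by (rule sum.group[symmetric]) (use A in auto)
  also have "\<dots> = (\<Sum>k\<le>card A. (-1) ^ (card A - k) * (\<Sum>I | I \<subseteq> A \<and> card I = card A - k. F I) * t ^ k)"
  proof (rule sum.cong[OF refl])
    fix k assume k: "k \<in> {..card A}"
    have "{I. I \<in> Pow A \<and> card A - card I = k} = {I. I \<subseteq> A \<and> card I = card A - k}"
    proof (rule Collect_cong)
      fix I show "(I \<in> Pow A \<and> card A - card I = k) = (I \<subseteq> A \<and> card I = card A - k)"
        using card_mono[OF A, of I] k by auto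
    qed
    then have "(\<Sum>I | I \<in> Pow A \<and> card A - card I = k. (-1) ^ card I * F I * t ^ (card A - card I)) = 
      (\<Sum>I | I \<subseteq> A \<and> card I = card A - k. (-1) ^ card I * F I * t ^ (card A - card I))" by simp
    also have "\<dots> = (\<Sum>I | I \<subseteq> A \<and> card I = card A - k. (-1) ^ (card A - k) * F I * t ^ k)"
      using k by (intro sum.cong refl) simp
    finally show "(\<Sum>I | I \<in> Pow A \<and> card A - card I = k. (-1) ^ card I * F I * t ^ (card A - card I)) = (-1) ^ (card A - k) * (\<Sum>I | I \<subseteq> A \<and> card I = card A - k. F I) * t ^ k"
      by (simp add: sum_distrib_left sum_distrib_right)
  qed
  finally show ?thesis .
qed

text \<open>Comparing coefficients of the characteristic polynomial: sums of principal minors are the elementary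
symmetric functions of the eigenvalues.\<close>

lemma minor_sum_eigenvalues:
  fixes M :: "complex^'n^'n"
  assumes x: "has_eigenvalues M x" and k: "k \<le> CARD('n)"
  shows "minor_sum k M = esym (CARD('n)) k x"
proof -
  let ?n = "CARD('n)"
  have "(\<Sum>k\<le>?n. (-1) ^ (?n - k) * minor_sum (?n - k) M * t ^ k) = (\<Sum>k\<le>?n. (-1) ^ (?n - k) * esym ?n (?n - k) x * t ^ k)" for t
  proof -
    have "Determinants.det (Finite_Cartesian_Product.mat t - M) = (\<Sum>k\<le>?n. (-1) ^ (?n - k) * minor_sum (?n - k) M * t ^ k)"
      using group_by_card[of "UNIV :: 'n set" "\<lambda>I. minor I M" t] unfolding char_poly_expand minor_sum_def by simp
    moreover have "(\<Prod>i=1..?n. t - x i) = (\<Sum>k\<le>?n. (-1) ^ (?n - k) * esym ?n (?n - k) x * t ^ k)"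
    proof -
      have "(\<Prod>i=1..?n. t - x i) = (\<Prod>i=1..?n. (-1) * x i + t)" by (intro prod.cong refl) simp
      also have "\<dots> = (\<Sum>I\<in>Pow {1..?n}. (\<Prod>i\<in>I. (-1) * x i) * (\<Prod>i\<in>{1..?n} - I. t))"
        by (rule prod_add) simp
      also have "\<dots> = (\<Sum>I\<in>Pow {1..?n}. (-1) ^ card I * (\<Prod>i\<in>I. x i) * t ^ (card {1..?n} - card I))"
      proof (rule sum.cong[OF refl])
        fix I assume "I \<in> Pow {1..?n}"
        then have "card ({1..?n} - I) = card {1..?n} - card I" by (intro card_Diff_subset) (auto intro: finite_subset)
        then show "(\<Prod>i\<in>I. (-1) * x i) * (\<Prod>i\<in>{1..?n} - I. t) = (-1) ^ card I * (\<Prod>i\<in>I. x i) * t ^ (card {1..?n} - card I)"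
          unfolding prod.distrib by simp
      qed
      also have "\<dots> = (\<Sum>k\<le>?n. (-1) ^ (?n - k) * esym ?n (?n - k) x * t ^ k)"
        using group_by_card[of "{1..?n}" "\<lambda>I. \<Prod>i\<in>I. x i" t] unfolding esym_def by simp
      finally show ?thesis .
    qed
    ultimately show ?thesis using x unfolding has_eigenvalues_def by metis
  qed
  then have "\<forall>k\<le>?n. (-1) ^ (?n - k) * minor_sum (?n - k) M = (-1) ^ (?n - k) * esym ?n (?n - k) x"
    by (subst polyfun_eq_coeffs[symmetric]) blast
  then have "(-1) ^ k * minor_sum k M = (-1) ^ k * esym ?n k x"
    using k by (metis diff_diff_cancel diff_le_self)
  then show ?thesis by simp
qed

lemma has_eigenvalues_exists:
  fixes M :: "complex^'n^'n"
  shows "\<exists>x. has_eigenvalues M x"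
proof -
  let ?n = "CARD('n)"
  define c where "c k = (-1) ^ (?n - k) * minor_sum (?n - k) M" for k
  \<comment> \<open>The characteristic polynomial of M, which splits over the complex numbers.\<close>
  define p where "p = (\<Sum>k\<le>?n. monom (c k) k)"
  have p: "poly p t = Determinants.det (Finite_Cartesian_Product.mat t - M)" for t
    using group_by_card[of "UNIV :: 'n set" "\<lambda>I. minor I M" t] 
    unfolding char_poly_expand minor_sum_def p_def c_def poly_sum poly_monom by simp
  have "coeff p ?n = (\<Sum>k\<le>?n. if k = ?n then c k else 0)"
    unfolding p_def coeff_sum by (intro sum.cong refl) (simp add: Polynomial.coeff_monom)
  moreover have "{I :: 'n set. card I = 0} = {{}}" by auto
  ultimately have cn: "coeff p ?n = 1" by (simp add: c_def minor_sum_def minor_empty)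
  have "degree p \<le> ?n" unfolding p_def by (intro degree_sum_le) (auto intro: order.trans[OF degree_monom_le])
  then have deg: "degree p = ?n" using cn le_degree[of p ?n] by simp
  have "p \<noteq> 0" using cn by auto
  then obtain A where A: "size A = degree p" "p = Polynomial.smult (lead_coeff p) (\<Prod>x\<in>#A. [:- x, 1:])"
    using alg_closed_imp_factorization[of p] by blast
  obtain xs where xs: "mset xs = A" using ex_mset by blast
  have len: "length xs = ?n" using A(1) xs deg by auto
  have "poly p t = (\<Prod>i=1..?n. t - xs ! (i - 1))" for t
  proof -
    have "p = (\<Prod>x\<in>#A. [:- x, 1:])" using A(2) cn deg by simp
    also have "\<dots> = prod_list (map (\<lambda>x. [:- x, 1:]) xs)" 
      unfolding xs[symmetric] by (metis mset_map prod_mset_prod_list)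
    finally have "poly p t = poly (prod_list (map (\<lambda>x. [:- x, 1:]) xs)) t" by simp
    also have "\<dots> = prod_list (map (\<lambda>x. t - x) xs)" by (induction xs) (auto simp: algebra_simps)
    also have "\<dots> = (\<Prod>i<?n. t - xs ! i)"
      using len by (simp add: prod.list_conv_set_nth atLeast0LessThan)
    also have "\<dots> = (\<Prod>i=1..?n. t - xs ! (i - 1))"
      by (rule prod.reindex_bij_witness[of _ "\<lambda>i. i - 1" Suc]) auto
    finally show ?thesis .
  qed
  then have "has_eigenvalues M (\<lambda>i. xs ! (i - 1))" unfolding has_eigenvalues_def p[symmetric] by blast
  then show ?thesis by blast
qed

lemma has_eigenvalues_diagm: "has_eigenvalues (diagm x :: complex^'n^'n) x"
  unfolding has_eigenvalues_def
proof
  fix t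
  have "Determinants.det (Finite_Cartesian_Product.mat t - diagm x :: complex^'n^'n) = (\<Prod>i\<in>UNIV. (Finite_Cartesian_Product.mat t - diagm x :: complex^'n^'n) $ i $ i)"
    by (rule det_diagonal) (simp add: mat_nth diagm_nth)
  also have "\<dots> = (\<Prod>i::'n\<in>UNIV. t - x (idx i))" by (simp add: mat_nth diagm_nth)
  also have "\<dots> = (\<Prod>i=1..CARD('n). t - x i)" by (rule prod_idx)
  finally show "Determinants.det (Finite_Cartesian_Product.mat t - diagm x :: complex^'n^'n) = (\<Prod>i=1..CARD('n). t - x i)" .
qed

lemma has_eigenvalues_conj:
  fixes A :: "complex^'n^'n"
  assumes U: "U \<in> unitary_group" and x: "has_eigenvalues A x"
  shows "has_eigenvalues (U ** A ** conj_transpose U) x"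
  unfolding has_eigenvalues_def
proof
  fix t
  let ?m = "Finite_Cartesian_Product.mat t :: complex^'n^'n"
  have m: "U ** ?m ** conj_transpose U = ?m"
  proof -
    have "U ** ?m = ?m ** U" by (simp add: vec_eq_iff mm_nth mat_nth if_distrib if_distribR mult.commute cong: if_cong)
    then have "U ** ?m ** conj_transpose U = ?m ** (U ** conj_transpose U)" by (simp add: matrix_mul_assoc)
    then show ?thesis using unitaryD(1)[OF U] by simp
  qed
  have "(U ** (?m - A) ** conj_transpose U) $ i $ j = (U ** ?m ** conj_transpose U) $ i $ j - (U ** A ** conj_transpose U) $ i $ j" for i j
    by (simp add: mm_nth right_diff_distrib left_diff_distrib sum_subtractf)
  then have "?m - U ** A ** conj_transpose U = U ** (?m - A) ** conj_transpose U"
    unfolding m by (simp add: vec_eq_iff)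
  then have "Determinants.det (?m - U ** A ** conj_transpose U) = Determinants.det (U ** conj_transpose U) * Determinants.det (?m - A)"
    by (simp add: Determinants.det_mul)
  also have "\<dots> = (\<Prod>i=1..CARD('n). t - x i)" using unitaryD(1)[OF U] x by (simp add: has_eigenvalues_def)
  finally show "Determinants.det (?m - U ** A ** conj_transpose U) = (\<Prod>i=1..CARD('n). t - x i)" .
qed

section \<open>Exponents under left multiplication by diagonal matrices\<close>

text \<open>All exponents of the diagonal entries x in f (diagm x ** M) lie in Q: a bound for the weights of f
under the torus that acts by left multiplication. The coefficients are polynomials in M, so that M
can be integrated over.\<close>

definition weights_in :: "(nat \<Rightarrow> nat) set \<Rightarrow> (complex^'n^'n \<Rightarrow> complex) \<Rightarrow> bool" where
  "weights_in Q f \<longleftrightarrow> (\<exists>F q. finite F \<and> F \<subseteq> Q \<and> (\<forall>\<nu>. mpoly (q \<nu>)) \<and>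
     (\<forall>x M. f (diagm x ** M) = (\<Sum>\<nu>\<in>F. q \<nu> M * (\<Prod>i=1..CARD('n). x i ^ \<nu> i))))"

lemma weights_inI:
  fixes f :: "complex^'n^'n \<Rightarrow> complex"
  assumes J: "finite J" and e: "\<And>j. j \<in> J \<Longrightarrow> e j \<in> Q" and q: "\<And>j. j \<in> J \<Longrightarrow> mpoly (q j)"
    and f: "\<And>x M. f (diagm x ** M) = (\<Sum>j\<in>J. q j M * (\<Prod>i=1..CARD('n). x i ^ e j i))"
  shows "weights_in Q f"
proof -
  let ?q = "\<lambda>\<nu> M. \<Sum>j | j \<in> J \<and> e j = \<nu>. q j M"
  have "f (diagm x ** M) = (\<Sum>\<nu>\<in>e ` J. ?q \<nu> M * (\<Prod>i=1..CARD('n). x i ^ \<nu> i))" for x M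
  proof -
    have "f (diagm x ** M) = (\<Sum>\<nu>\<in>e ` J. \<Sum>j | j \<in> J \<and> e j = \<nu>. q j M * (\<Prod>i=1..CARD('n). x i ^ e j i))"
      unfolding f by (rule sum.image_gen[OF J])
    also have "\<dots> = (\<Sum>\<nu>\<in>e ` J. ?q \<nu> M * (\<Prod>i=1..CARD('n). x i ^ \<nu> i))"
      unfolding sum_distrib_right by (intro sum.cong refl) simp
    finally show ?thesis .
  qed
  moreover have "mpoly (?q \<nu>)" for \<nu> by (rule mpoly_sum) (simp add: q)
  moreover have "e ` J \<subseteq> Q" "finite (e ` J)" using e J by auto
  ultimately show ?thesis unfolding weights_in_def by (intro exI[of _ "e ` J"] exI[of _ ?q] conjI allI)
qed

lemma weights_inE:
  fixes f :: "complex^'n^'n \<Rightarrow> complex"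
  assumes "weights_in Q f"
  obtains F q where "finite F" "F \<subseteq> Q" "\<And>\<nu>. mpoly (q \<nu>)"
    "\<And>x M. f (diagm x ** M) = (\<Sum>\<nu>\<in>F. q \<nu> M * (\<Prod>i=1..CARD('n). x i ^ \<nu> i))"
proof -
  obtain F q where "finite F \<and> F \<subseteq> Q \<and> (\<forall>\<nu>. mpoly (q \<nu>)) \<and>
     (\<forall>x M. f (diagm x ** M) = (\<Sum>\<nu>\<in>F. q \<nu> M * (\<Prod>i=1..CARD('n). x i ^ \<nu> i)))"
    using assms unfolding weights_in_def by (elim exE)
  then show thesis by (intro that[of F q]) simp_all
qed

lemma weights_in_mono:
  fixes f :: "complex^'n^'n \<Rightarrow> complex"
  assumes f: "weights_in Q f" and sub: "Q \<subseteq> Q'" shows "weights_in Q' f"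
proof -
  obtain F q where 1: "finite F" "F \<subseteq> Q" "\<And>\<nu>. mpoly (q \<nu>)" "\<And>x M. f (diagm x ** M) = (\<Sum>\<nu>\<in>F. q \<nu> M * (\<Prod>i=1..CARD('n). x i ^ \<nu> i))"
    by (rule weights_inE[OF f], rule that, assumption+)
  show ?thesis
    by (rule weights_inI[of F "\<lambda>\<nu>. \<nu>" Q' q, OF 1(1) _ 1(3,4)]) (rule subsetD[OF subset_trans[OF 1(2) sub]])
qed

lemma weights_in_zero: "weights_in Q (\<lambda>_. 0)"
  by (rule weights_inI[of "{}"]) auto

lemma weights_in_add:
  fixes f g :: "complex^'n^'n \<Rightarrow> complex"
  assumes f: "weights_in Q f" and g: "weights_in Q g" shows "weights_in Q (\<lambda>M. f M + g M)"
proof -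
  obtain F q where 1: "finite F" "F \<subseteq> Q" "\<And>\<nu>. mpoly (q \<nu>)" "\<And>x M. f (diagm x ** M) = (\<Sum>\<nu>\<in>F. q \<nu> M * (\<Prod>i=1..CARD('n). x i ^ \<nu> i))"
    by (rule weights_inE[OF f], rule that, assumption+)
  obtain G r where 2: "finite G" "G \<subseteq> Q" "\<And>\<nu>. mpoly (r \<nu>)" "\<And>x M. g (diagm x ** M) = (\<Sum>\<nu>\<in>G. r \<nu> M * (\<Prod>i=1..CARD('n). x i ^ \<nu> i))"
    by (rule weights_inE[OF g], rule that, assumption+)
  show ?thesis
  proof (rule weights_inI[of "F <+> G" "case_sum id id" Q "case_sum q r"])
    show "finite (F <+> G)" using 1(1) 2(1) by simp
    fix j assume "j \<in> F <+> G"
    then show "case_sum id id j \<in> Q" using subsetD[OF 1(2)] subsetD[OF 2(2)] by (elim PlusE) simp_all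
    show "mpoly (case_sum q r j)" by (cases j) (simp_all add: 1(3) 2(3))
  next
    fix x :: "nat \<Rightarrow> complex" and M :: "complex^'n^'n"
    show "f (diagm x ** M) + g (diagm x ** M) = (\<Sum>j\<in>F <+> G. case_sum q r j M * (\<Prod>i=1..CARD('n). x i ^ case_sum id id j i))"
      unfolding 1(4) 2(4) by (simp add: sum.Plus 1(1) 2(1))
  qed
qed

lemma weights_in_sum: "(\<And>j. j \<in> J \<Longrightarrow> weights_in Q (f j)) \<Longrightarrow> weights_in Q (\<lambda>M. \<Sum>j\<in>J. f j M)"
  by (induction J rule: infinite_finite_induct) (auto intro: weights_in_zero weights_in_add)

lemma weights_in_mult:
  fixes f g :: "complex^'n^'n \<Rightarrow> complex"
  assumes f: "weights_in Q f" and g: "weights_in Q' g" and sub: "\<And>a b. a \<in> Q \<Longrightarrow> b \<in> Q' \<Longrightarrow> (\<lambda>i. a i + b i) \<in> Q''"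
  shows "weights_in Q'' (\<lambda>M. f M * g M)"
proof -
  obtain F q where 1: "finite F" "F \<subseteq> Q" "\<And>\<nu>. mpoly (q \<nu>)" "\<And>x M. f (diagm x ** M) = (\<Sum>\<nu>\<in>F. q \<nu> M * (\<Prod>i=1..CARD('n). x i ^ \<nu> i))"
    by (rule weights_inE[OF f], rule that, assumption+)
  obtain G r where 2: "finite G" "G \<subseteq> Q'" "\<And>\<nu>. mpoly (r \<nu>)" "\<And>x M. g (diagm x ** M) = (\<Sum>\<nu>\<in>G. r \<nu> M * (\<Prod>i=1..CARD('n). x i ^ \<nu> i))"
    by (rule weights_inE[OF g], rule that, assumption+)
  show ?thesis
  proof (rule weights_inI[of "F \<times> G" "\<lambda>(a, b) i. a i + b i" Q'' "\<lambda>(a, b) M. q a M * r b M"])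
    fix x :: "nat \<Rightarrow> complex" and M :: "complex^'n^'n"
    show "f (diagm x ** M) * g (diagm x ** M) = (\<Sum>j\<in>F \<times> G. (case j of (a, b) \<Rightarrow> \<lambda>M. q a M * r b M) M * (\<Prod>i=1..CARD('n). x i ^ (case j of (a, b) \<Rightarrow> \<lambda>i. a i + b i) i))"
      unfolding 1(4) 2(4) sum_product sum.cartesian_product
      by (intro sum.cong refl) (auto simp: power_add prod.distrib mult_ac)
  next
    fix j assume "j \<in> F \<times> G"
    then show "(case j of (a, b) \<Rightarrow> \<lambda>i. a i + b i) \<in> Q''" using 1(2) 2(2) sub by (cases j) (simp add: subset_iff)
    show "mpoly (case j of (a, b) \<Rightarrow> \<lambda>M. q a M * r b M)" by (cases j) (simp add: mpoly_mult 1(3) 2(3))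
  qed (use 1(1) 2(1) in simp)
qed

text \<open>The integer points of the permutohedron of a partition with partial sums h, in the form without
sorting: no set of coordinates has a larger sum than the same number of largest parts. Sets of
exponents described in this way add up under multiplication of polynomials.\<close>

definition dominated :: "nat \<Rightarrow> (nat \<Rightarrow> nat) \<Rightarrow> (nat \<Rightarrow> nat) set" where
  "dominated n h = {\<nu>. (\<forall>S\<subseteq>{1..n}. sum \<nu> S \<le> h (card S)) \<and> sum \<nu> {1..n} = h n \<and> (\<forall>i. i \<notin> {1..n} \<longrightarrow> \<nu> i = 0)}"

lemma dominated_mono: "(\<And>j. j \<le> n \<Longrightarrow> h j \<le> h' j) \<Longrightarrow> h n = h' n \<Longrightarrow> dominated n h \<subseteq> dominated n h'"
proof
  fix \<nu> assume h: "\<And>j. j \<le> n \<Longrightarrow> h j \<le> h' j" "h n = h' n" and nu: "\<nu> \<in> dominated n h"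
  have "sum \<nu> S \<le> h' (card S)" if S: "S \<subseteq> {1..n}" for S
  proof -
    have "card S \<le> n" using card_mono[OF _ S] by simp
    moreover have "sum \<nu> S \<le> h (card S)" using nu S by (simp add: dominated_def)
    ultimately show ?thesis using h(1)[of "card S"] by simp
  qed
  then show "\<nu> \<in> dominated n h'" using nu h(2) by (simp add: dominated_def)
qed

lemma dominated_add:
  assumes "a \<in> dominated n h" "b \<in> dominated n h'" "\<And>j. j \<le> n \<Longrightarrow> h j + h' j = h'' j"
  shows "(\<lambda>i. a i + b i) \<in> dominated n h''"
proof -
  have "sum (\<lambda>i. a i + b i) S \<le> h'' (card S)" if S: "S \<subseteq> {1..n}" for S
  proof -
    have "card S \<le> n" using card_mono[OF _ S] by simp
    moreover have "sum a S \<le> h (card S)" "sum b S \<le> h' (card S)" using assms(1,2) S by (auto simp: dominated_def)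
    ultimately show ?thesis using assms(3)[of "card S"] by (simp add: sum.distrib)
  qed
  moreover have "sum (\<lambda>i. a i + b i) {1..n} = h'' n" using assms assms(3)[of n] by (simp add: dominated_def sum.distrib)
  ultimately show ?thesis using assms(1,2) by (simp add: dominated_def)
qed

lemma weights_in_minor_sum: 
  assumes "k \<le> CARD('n)"
  shows "weights_in (dominated (CARD('n)) (\<lambda>j. min k j)) (minor_sum k :: complex^'n^'n \<Rightarrow> complex)"
proof (rule weights_inI[of "{I. card I = k}" "\<lambda>I i. if i \<in> idx ` I then 1 else 0" _ minor])
  fix I :: "'n set" assume I: "I \<in> {I. card I = k}"
  have "card (idx ` I) = k" using I by (simp add: card_image inj_on_def)
  moreover have "idx ` I \<subseteq> {1..CARD('n)}" using idx_in by blast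
  moreover have "sum (\<lambda>i. if i \<in> idx ` I then 1 else 0) S = card (S \<inter> idx ` I)" if "finite S" for S
    using that by (simp add: sum.If_cases)
  moreover have "card (S \<inter> idx ` I) \<le> card (idx ` I)" "finite S \<Longrightarrow> card (S \<inter> idx ` I) \<le> card S" for S
    by (auto intro: card_mono)
  ultimately show "(\<lambda>i. if i \<in> idx ` I then 1 else 0) \<in> dominated (CARD('n)) (\<lambda>j. min k j)"
    using assms finite_subset[of _ "{1..CARD('n)}"] by (auto simp: dominated_def Int_absorb1)
next
  fix x :: "nat \<Rightarrow> complex" and M :: "complex^'n^'n"
  have "(\<Prod>i\<in>I. x (idx i)) = (\<Prod>i=1..CARD('n). x i ^ (if i \<in> idx ` I then 1 else 0))" for I :: "'n set"
  proof -
    have "(\<Prod>i=1..CARD('n). x i ^ (if i \<in> idx ` I then 1 else 0)) = (\<Prod>i=1..CARD('n). if i \<in> idx ` I then x i else 1)"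
      by (intro prod.cong refl) simp
    also have "\<dots> = (\<Prod>i\<in>{1..CARD('n)} \<inter> idx ` I. x i)" by (simp add: prod.inter_restrict)
    also have "{1..CARD('n)} \<inter> idx ` I = idx ` I" using idx_in by blast
    also have "(\<Prod>i\<in>idx ` I. x i) = (\<Prod>i\<in>I. x (idx i))" by (simp add: prod.reindex inj_on_def)
    finally show ?thesis by simp
  qed
  then show "minor_sum k (diagm x ** M) = (\<Sum>I | card I = k. minor I M * (\<Prod>i=1..CARD('n). x i ^ (if i \<in> idx ` I then 1 else 0)))"
    unfolding minor_sum_def minor_diagm by (simp add: mult.commute)
qed (auto intro: mpoly_minor)

lemma schur_pieri:
  fixes x :: "nat \<Rightarrow> 'a::real_normed_field"
  assumes mu: "mu \<in> partitions_len n" and k: "k \<le> n" and lam: "add_ind {1..k} mu \<in> partitions_len n"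
  shows "schur n (add_ind {1..k} mu) x = esym n k x * schur n mu x - (\<Sum>I\<in>pieri_rest n mu k. schur n (add_ind I mu) x)"
proof (rule poly_fun_eqI[of n "schur n (add_ind {1..k} mu)" "\<lambda>x. esym n k x * schur n mu x - (\<Sum>I\<in>pieri_rest n mu k. schur n (add_ind I mu) x)"])
  show "poly_fun n (schur n (add_ind {1..k} mu) :: (nat \<Rightarrow> 'a) \<Rightarrow> 'a)" by (rule schur_props(1)[OF lam])
  show "poly_fun n (\<lambda>x :: nat \<Rightarrow> 'a. esym n k x * schur n mu x - (\<Sum>I\<in>pieri_rest n mu k. schur n (add_ind I mu) x))"
    by (intro poly_fun_minus poly_fun_mult poly_fun_esym poly_fun_sum schur_props(1) mu) (rule pieri_rest_dominated(1)[OF _ k])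
  fix x :: "nat \<Rightarrow> 'a" assume "inj_on x {1..n}"
  then have V: "vandermonde_prod n x \<noteq> 0" by (simp add: vandermonde_prod_eq_0_iff)
  have s: "(\<Sum>I\<in>pieri_rest n mu k. vandermonde_prod n x * schur n (add_ind I mu) x) = (\<Sum>I\<in>pieri_rest n mu k. alt n (shifted n (add_ind I mu)) x)"
    by (intro sum.cong refl schur_props(2)) (rule pieri_rest_dominated(1)[OF _ k])
  have "vandermonde_prod n x * schur n (add_ind {1..k} mu) x = vandermonde_prod n x * (esym n k x * schur n mu x - (\<Sum>I\<in>pieri_rest n mu k. schur n (add_ind I mu) x))"
    unfolding schur_props(2)[OF lam] pieri_alt[OF mu k] right_diff_distrib sum_distrib_left s mult.left_commute[of "vandermonde_prod n x"] schur_props(2)[OF mu] ..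
  then show "schur n (add_ind {1..k} mu) x = esym n k x * schur n mu x - (\<Sum>I\<in>pieri_rest n mu k. schur n (add_ind I mu) x)"
    using V by simp
qed

lemma schur_zero: 
  fixes x :: "nat \<Rightarrow> 'a::real_normed_field"
  shows "schur n (\<lambda>_. 0) x = 1"
proof (rule poly_fun_eqI[of n "schur n (\<lambda>_. 0)" "\<lambda>_. 1"])
  have z: "(\<lambda>_. 0) \<in> partitions_len n" by (rule partitions_lenI) auto
  show "poly_fun n (schur n (\<lambda>_. 0) :: (nat \<Rightarrow> 'a) \<Rightarrow> 'a)" by (rule schur_props(1)[OF z])
  show "poly_fun n (\<lambda>_ :: nat \<Rightarrow> 'a. 1)" by (rule poly_fun_const)
  fix x :: "nat \<Rightarrow> 'a" assume "inj_on x {1..n}"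
  then have V: "vandermonde_prod n x \<noteq> 0" by (simp add: vandermonde_prod_eq_0_iff)
  have "alt n (shifted n (\<lambda>_. 0)) x = vandermonde_prod n x"
    unfolding vandermonde_eq_alt by (rule alt_cong) (auto simp: shifted_def)
  then have "vandermonde_prod n x * schur n (\<lambda>_. 0) x = vandermonde_prod n x"
    using schur_props(2)[OF z, of x] by simp
  then show "schur n (\<lambda>_. 0) x = 1" using V by simp
qed

text \<open>The Pieri recursion, read with sums of principal minors in place of elementary symmetric functions,
gives Schur functions as polynomials in the entries. The same recursion bounds the exponents: a sum
of minors of size k has the exponents dominated by a column of length k, and all other terms belong
to smaller partitions.\<close>

lemma matschur_exists:
  assumes "lam \<in> partitions_len (CARD('n))"
  shows "\<exists>f :: complex^'n^'n \<Rightarrow> complex. mpoly f \<and> (\<forall>M x. has_eigenvalues M x \<longrightarrow> f M = schur (CARD('n)) lam x) \<and>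
     weights_in (dominated (CARD('n)) (part_sum lam)) f"
  using assms
proof (induction rule: partition_induct)
  case zero
  have "weights_in (dominated (CARD('n)) (part_sum (\<lambda>_. 0))) (\<lambda>_ :: complex^'n^'n. 1)"
    by (rule weights_inI[of "{()}" "\<lambda>_ _. 0" _ "\<lambda>_ _. 1"]) (auto simp: dominated_def part_sum_def intro: mpoly_const)
  then show ?case
    by (intro exI[of _ "\<lambda>_. 1"]) (auto simp: schur_zero intro: mpoly_const)
next
  case (step mu k)
  let ?n = "CARD('n)" and ?lam = "add_ind {1..k} mu"
  obtain f :: "complex^'n^'n \<Rightarrow> complex" where f: "mpoly f" "\<And>M x. has_eigenvalues M x \<Longrightarrow> f M = schur ?n mu x" "weights_in (dominated ?n (part_sum mu)) f"
    using step(4) by blast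
  have "\<exists>g :: complex^'n^'n \<Rightarrow> complex. mpoly g \<and> (\<forall>M x. has_eigenvalues M x \<longrightarrow> g M = schur ?n (add_ind I mu) x) \<and> weights_in (dominated ?n (part_sum (add_ind I mu))) g"
    if I: "I \<in> pieri_rest ?n mu k" for I
    by (rule step(5)) (rule pieri_rest_dominated[OF I step(2)])+
  then obtain g :: "nat set \<Rightarrow> complex^'n^'n \<Rightarrow> complex" where g: "\<And>I. I \<in> pieri_rest ?n mu k \<Longrightarrow> mpoly (g I) \<and> (\<forall>M x. has_eigenvalues M x \<longrightarrow> g I M = schur ?n (add_ind I mu) x) \<and> weights_in (dominated ?n (part_sum (add_ind I mu))) (g I)"
    by metis
  let ?f = "\<lambda>M. minor_sum k M * f M + (\<Sum>I\<in>pieri_rest ?n mu k. (\<lambda>_. -1) M * g I M)"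
  have "mpoly ?f" using g by (intro mpoly_add mpoly_mult mpoly_sum mpoly_minor_sum f mpoly_const) blast
  moreover have "?f M = schur ?n ?lam x" if x: "has_eigenvalues M x" for M x
    unfolding schur_pieri[OF step(1,2,3)] minor_sum_eigenvalues[OF x step(2)] f(2)[OF x]
    using g x by (simp add: sum_negf)
  moreover have "weights_in (dominated ?n (part_sum ?lam)) ?f"
  proof (intro weights_in_add weights_in_sum)
    show "weights_in (dominated ?n (part_sum ?lam)) (\<lambda>M. minor_sum k M * f M)"
      by (rule weights_in_mult[OF weights_in_minor_sum[OF step(2)] f(3)], rule dominated_add, assumption, assumption)
         (simp add: part_sum_add_ind)
    fix I assume I: "I \<in> pieri_rest ?n mu k"
    have 0: "weights_in (dominated ?n (\<lambda>_. 0)) (\<lambda>_ :: complex^'n^'n. - 1)"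
      by (rule weights_inI[of "{()}" "\<lambda>_ _. 0" _ "\<lambda>_ _. - 1"]) (auto simp: dominated_def intro: mpoly_const)
    have "weights_in (dominated ?n (part_sum (add_ind I mu))) (\<lambda>M. - 1 * g I M)"
      by (rule weights_in_mult[OF 0]) (use g[OF I] in \<open>auto intro: dominated_add\<close>)
    then show "weights_in (dominated ?n (part_sum ?lam)) (\<lambda>M. - 1 * g I M)"
      by (rule weights_in_mono) (rule dominated_mono, (rule pieri_rest_dominated[OF I step(2)])+)
  qed
  ultimately show ?case by (intro exI[of _ ?f]) blast
qed

section \<open>The Casimir operator\<close>

text \<open>The quadratic Casimir element of gl(n), acting by the generators of left multiplication.\<close>

definition casimir :: "(complex^'n^'n \<Rightarrow> complex) \<Rightarrow> complex^'n^'n \<Rightarrow> complex" where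
  "casimir f A = (\<Sum>a\<in>UNIV. \<Sum>b\<in>UNIV. lder (munit a b) (lder (munit b a) f) A)"

lemma mpoly_lder: "mpoly f \<Longrightarrow> mpoly (lder Y f)"
  by (rule derivationD(1)[OF derivation_lder])

lemma mpoly_casimir: 
  assumes "mpoly f" shows "mpoly (casimir f)"
proof -
  have "mpoly (\<lambda>A. casimir f A)" unfolding casimir_def by (intro mpoly_sum mpoly_lder assms)
  then show ?thesis by simp
qed

text \<open>Left and right multiplication commute on the level of the matrix argument.\<close>

lemma lder_right: "lder Y (\<lambda>A. f (A ** M)) A = lder Y f (A ** M)"
proof -
  have "line A (Y ** A) t ** M = line (A ** M) (Y ** (A ** M)) t" for t
    by (simp add: vec_eq_iff mm_nth[of _ M] matrix_mul_assoc distrib_right sum.distrib sum_distrib_left mult.assoc)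
  then show ?thesis unfolding lder_def ddir_def by simp
qed

lemma casimir_right:
  fixes f :: "complex^'n^'n \<Rightarrow> complex"
  shows "casimir (\<lambda>A. f (A ** M)) A = casimir f (A ** M)"
proof -
  have "lder Y (\<lambda>A. f (A ** M)) = (\<lambda>A. lder Y f (A ** M))" for Y and f :: "complex^'n^'n \<Rightarrow> complex" and M
    by (rule ext) (rule lder_right)
  then show ?thesis unfolding casimir_def by simp
qed

lemma lder_conj:
  assumes U: "U \<in> unitary_group"
  shows "lder Y (\<lambda>A. f (U ** A ** conj_transpose U)) A = lder (U ** Y ** conj_transpose U) f (U ** A ** conj_transpose U)"
proof -
  have e: "(U ** Y ** conj_transpose U) ** (U ** A ** conj_transpose U) = U ** (Y ** A) ** conj_transpose U"
  proof -
    have "(U ** Y ** conj_transpose U) ** (U ** A ** conj_transpose U) = U ** Y ** (conj_transpose U ** U) ** A ** conj_transpose U"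
      by (simp only: matrix_mul_assoc)
    then show ?thesis unfolding unitaryD(2)[OF U] by (simp add: matrix_mul_assoc)
  qed
  have "U ** line A B t ** conj_transpose U = line (U ** A ** conj_transpose U) (U ** B ** conj_transpose U) t" for t B
    by (simp add: vec_eq_iff mm_nth distrib_left distrib_right sum.distrib sum_distrib_left sum_distrib_right mult_ac)
  then show ?thesis unfolding lder_def ddir_def e by simp
qed

lemma lder_cmult: "mpoly f \<Longrightarrow> lder Y (\<lambda>A. c * f A) = (\<lambda>A. c * lder Y f A)"
  by (rule derivation_cmult[OF derivation_lder])

lemma lder_lder_expand:
  assumes f: "mpoly f"
  shows "lder X (lder Y f) A = (\<Sum>(c, d, e, h)\<in>UNIV. X $ c $ d * Y $ e $ h * lder (munit c d) (lder (munit e h) f) A)"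
proof -
  have Y: "lder Y f = (\<lambda>A. \<Sum>e\<in>UNIV. \<Sum>h\<in>UNIV. Y $ e $ h * lder (munit e h) f A)"
    by (rule ext) (rule lder_expand[OF f])
  have m: "mpoly (\<lambda>A. Y $ e $ h * lder (munit e h) f A)" for e h
    by (intro mpoly_mult mpoly_const mpoly_lder f)
  have "lder (munit c d) (lder Y f) A = (\<Sum>e\<in>UNIV. \<Sum>h\<in>UNIV. Y $ e $ h * lder (munit c d) (lder (munit e h) f) A)" for c d
    unfolding Y by (simp add: derivation_sum[OF derivation_lder] mpoly_sum m lder_cmult[OF mpoly_lder[OF f]])
  then have "lder X (lder Y f) A = (\<Sum>c\<in>UNIV. \<Sum>d\<in>UNIV. \<Sum>e\<in>UNIV. \<Sum>h\<in>UNIV. X $ c $ d * Y $ e $ h * lder (munit c d) (lder (munit e h) f) A)"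
    unfolding lder_expand[OF mpoly_lder[OF f], of X] by (simp add: sum_distrib_left mult.assoc)
  then show ?thesis by (simp add: sum.cartesian_product case_prod_unfold)
qed

lemma sum_UNIV_pair: "(\<Sum>a\<in>UNIV. \<Sum>b\<in>UNIV. F a b) = (\<Sum>(a :: 'a::finite, b :: 'b::finite)\<in>UNIV. F a b)"
  by (simp add: sum.cartesian_product)

lemma sum_UNIV_quad: "(\<Sum>(a :: 'a::finite, b :: 'b::finite, c :: 'c::finite, d :: 'd::finite)\<in>UNIV. F a b c d) = 
   (\<Sum>a\<in>UNIV. \<Sum>b\<in>UNIV. \<Sum>c\<in>UNIV. \<Sum>d\<in>UNIV. F a b c d)"
  by (simp only: sum_UNIV_pair case_prod_unfold)

text \<open>Conjugation by U maps E_ab (x) E_ba to sums of U_ca cnj U_db U_eb cnj U_ha E_cd (x) E_eh. Summed over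
a and b, the orthogonality of the rows of U leaves the terms with c = h and d = e.\<close>

lemma uclass_casimir:
  assumes f: "mpoly f" and u: "uclass f"
  shows "uclass (casimir f)"
  unfolding uclass_def
proof (intro ballI allI)
  fix U A :: "complex^'a^'a" assume U: "U \<in> unitary_group"
  let ?A = "U ** A ** conj_transpose U"
  let ?c = "\<lambda>Y. U ** Y ** conj_transpose U"
  let ?G = "\<lambda>c d e h. lder (munit c d) (lder (munit e h) f) ?A"
  have inv: "(\<lambda>A. f (U ** A ** conj_transpose U)) = f" using u U by (auto simp: uclass_def)
  have 1: "lder Y f = (\<lambda>A. lder (?c Y) f (U ** A ** conj_transpose U))" for Y
  proof
    fix A show "lder Y f A = lder (?c Y) f (U ** A ** conj_transpose U)"
      using lder_conj[OF U, of Y f A] by (simp only: inv)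
  qed
  have 2: "lder X (lder Y f) A = lder (?c X) (lder (?c Y) f) ?A" for X Y
    by (subst 1[of Y], rule lder_conj[OF U])
  have cE: "?c (munit a b) $ c $ d = U $ c $ a * cnj (U $ d $ b)" for a b c d
  proof -
    have "?c (munit a b) $ c $ d = (\<Sum>k\<in>UNIV. (\<Sum>j\<in>UNIV. if a = j then if b = k then U $ c $ j * cnj (U $ d $ k) else 0 else 0))"
      unfolding mm_nth ct_nth munit_nth sum_distrib_right by (intro sum.cong refl) simp
    then show ?thesis by simp
  qed
  have orth: "(\<Sum>a\<in>UNIV. U $ c $ a * cnj (U $ h $ a)) = (if c = h then 1 else 0)" for c h
  proof -
    have "(U ** conj_transpose U) $ c $ h = (if c = h then 1 else 0)" unfolding unitaryD(1)[OF U] by (simp add: mat_nth)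
    then show ?thesis by (simp add: mm_nth ct_nth)
  qed
  have 3: "lder (munit a b) (lder (munit b a) f) A = 
      (\<Sum>(c, d, e, h)\<in>UNIV. U $ c $ a * cnj (U $ d $ b) * (U $ e $ b * cnj (U $ h $ a)) * ?G c d e h)" for a b
    using 2[of "munit a b" "munit b a"] lder_lder_expand[OF f, of "?c (munit a b)" "?c (munit b a)" ?A] by (simp only: cE)
  have "casimir f A = (\<Sum>(a, b)\<in>UNIV. \<Sum>(c, d, e, h)\<in>UNIV. U $ c $ a * cnj (U $ d $ b) * (U $ e $ b * cnj (U $ h $ a)) * ?G c d e h)"
    unfolding casimir_def 3 by (rule sum_UNIV_pair)
  also have "\<dots> = (\<Sum>(c, d, e, h)\<in>UNIV. \<Sum>(a, b)\<in>UNIV. U $ c $ a * cnj (U $ d $ b) * (U $ e $ b * cnj (U $ h $ a)) * ?G c d e h)"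
    by (simp only: case_prod_unfold, rule sum.swap)
  also have "\<dots> = (\<Sum>c\<in>UNIV. \<Sum>d\<in>UNIV. \<Sum>e\<in>UNIV. \<Sum>h\<in>UNIV. \<Sum>(a, b)\<in>UNIV. U $ c $ a * cnj (U $ d $ b) * (U $ e $ b * cnj (U $ h $ a)) * ?G c d e h)"
    by (rule sum_UNIV_quad)
  also have "\<dots> = (\<Sum>c\<in>UNIV. \<Sum>d\<in>UNIV. \<Sum>e\<in>UNIV. \<Sum>h\<in>UNIV. (if c = h then if d = e then ?G c d e h else 0 else 0))"
  proof (intro sum.cong refl)
    fix c d e h
    let ?k = "\<lambda>a b. U $ c $ a * cnj (U $ d $ b) * (U $ e $ b * cnj (U $ h $ a)) * ?G c d e h"
    have "(\<Sum>(a, b)\<in>UNIV. ?k a b) = (\<Sum>a\<in>UNIV. \<Sum>b\<in>UNIV. ?k a b)"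
      by (rule sum_UNIV_pair[symmetric])
    also have "\<dots> = (\<Sum>a\<in>UNIV. (U $ c $ a * cnj (U $ h $ a)) * (\<Sum>b\<in>UNIV. U $ e $ b * cnj (U $ d $ b)) * ?G c d e h)"
    proof (rule sum.cong[OF refl])
      fix a
      have "?k a b = (U $ c $ a * cnj (U $ h $ a)) * (U $ e $ b * cnj (U $ d $ b)) * ?G c d e h" for b
        by (simp only: mult_ac)
      then show "(\<Sum>b\<in>UNIV. ?k a b) = (U $ c $ a * cnj (U $ h $ a)) * (\<Sum>b\<in>UNIV. U $ e $ b * cnj (U $ d $ b)) * ?G c d e h"
        by (simp only: sum_distrib_left[symmetric] sum_distrib_right[symmetric])
    qed
    also have "\<dots> = (if c = h then 1 else 0) * (if e = d then 1 else 0) * ?G c d e h"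
      by (simp only: orth sum_distrib_right[symmetric])
    finally show "(\<Sum>(a, b)\<in>UNIV. U $ c $ a * cnj (U $ d $ b) * (U $ e $ b * cnj (U $ h $ a)) * ?G c d e h) = 
       (if c = h then if d = e then ?G c d e h else 0 else 0)" by (cases "c = h"; cases "d = e") simp_all
  qed
  also have "\<dots> = (\<Sum>c\<in>UNIV. \<Sum>d\<in>UNIV. \<Sum>e\<in>UNIV. if d = e then ?G c d e c else 0)"
    by (intro sum.cong refl) simp
  also have "\<dots> = casimir f ?A" by (simp add: casimir_def)
  finally show "casimir f ?A = casimir f A" by simp
qed

section \<open>The radial part of the Casimir operator\<close>

lemma ddir_munit_scale:
  assumes h: "mpoly h" and Y: "\<And>i j. Y $ i $ j = (if i = p \<and> j = q then c else 0)"
  shows "ddir Y h A = c * ddir (munit p q) h A"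
proof -
  have "ddir Y h A = (\<Sum>i\<in>UNIV. \<Sum>j\<in>UNIV. if p = i then if q = j then c * ddir (munit i j) h A else 0 else 0)"
    unfolding ddir_expand[OF h, of Y] Y by (intro sum.cong refl) simp
  also have "\<dots> = (\<Sum>i\<in>UNIV. if p = i then \<Sum>j\<in>UNIV. if q = j then c * ddir (munit i j) h A else 0 else 0)"
    by (intro sum.cong refl) simp
  also have "\<dots> = c * ddir (munit p q) h A" by simp
  finally show ?thesis .
qed

text \<open>On an invariant function the generators of left and right multiplication by E_ba agree, and the
second commutes with L_ab. At a
diagonal matrix the two directions are proportional to E_ba, with factors x_a and x_b. Thus
L_ab L_ba g and L_ba L_ab g have the ratio x_b : x_a, while their difference is the commutator, of
first order; the two equations determine L_ab L_ba g.\<close>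

lemma mixed_second_derivative:
  fixes g :: "complex^'n^'n \<Rightarrow> complex"
  assumes g: "mpoly g" "uclass g" and ab: "a \<noteq> b" and x: "x (idx a) \<noteq> x (idx b)"
  shows "lder (munit a b) (lder (munit b a) g) (diagm x) = 
    x (idx b) * (lder (munit b b) g (diagm x) - lder (munit a a) g (diagm x)) / (x (idx b) - x (idx a))"
proof -
  let ?A = "diagm x :: complex^'n^'n"
  let ?P = "lder (munit a b) (lder (munit b a) g) ?A" and ?Q = "lder (munit b a) (lder (munit a b) g) ?A"
  have m: "mpoly (lder (munit a b) g)" by (rule mpoly_lder[OF g(1)])
  have "?P = rder (munit b a) (lder (munit a b) g) ?A"
    unfolding uclass_lder_eq_rder[OF g ab[symmetric]] lder_rder_commute[OF g(1)] ..
  also have "\<dots> = x (idx b) * ddir (munit b a) (lder (munit a b) g) ?A"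
    unfolding rder_def by (rule ddir_munit_scale[OF m]) (simp add: mm_nth diagm_nth munit_nth if_distrib[of "\<lambda>z. z * _"] cong: if_cong)
  finally have P: "?P = x (idx b) * ddir (munit b a) (lder (munit a b) g) ?A" .
  have Q: "?Q = x (idx a) * ddir (munit b a) (lder (munit a b) g) ?A"
    unfolding lder_def[of "munit b a"] by (rule ddir_munit_scale[OF m]) (simp add: mm_nth diagm_nth munit_nth if_distrib[of "\<lambda>z. z * _"] if_distrib[of "\<lambda>z. _ * z"] cong: if_cong)
  have PQ: "?P - ?Q = lder (munit b b) g ?A - lder (munit a a) g ?A" by (rule lder_commutator[OF g(1)])
  have "(x (idx b) - x (idx a)) * ?P = x (idx b) * (?P - ?Q)"
    unfolding P Q by (simp add: algebra_simps)
  then show ?thesis unfolding PQ using x by (simp add: nonzero_eq_divide_eq mult.commute)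
qed

lemma sum_swap_offdiag:
  fixes F :: "'a::finite \<Rightarrow> 'a \<Rightarrow> complex"
  shows "(\<Sum>a\<in>UNIV. \<Sum>b\<in>UNIV-{a}. F a b) = (\<Sum>b\<in>UNIV. \<Sum>a\<in>UNIV-{b}. F a b)"
proof -
  have 1: "(\<Sum>b\<in>UNIV-{a}. F a b) = (\<Sum>b\<in>UNIV. if a = b then 0 else F a b)" for a
    by (rule sum.mono_neutral_cong_left) auto
  have 2: "(\<Sum>a\<in>UNIV-{b}. F a b) = (\<Sum>a\<in>UNIV. if a = b then 0 else F a b)" for b
    by (rule sum.mono_neutral_cong_left) auto
  show ?thesis unfolding 1 2 by (rule sum.swap)
qed

text \<open>The value of the Casimir operator at a diagonal matrix involves the derivatives in diagonal
directions only.\<close>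

lemma casimir_radial:
  fixes g :: "complex^'n^'n \<Rightarrow> complex"
  assumes g: "mpoly g" "uclass g" and x: "inj_on x {1..CARD('n)}"
  shows "casimir g (diagm x) = (\<Sum>a\<in>UNIV. lder (munit a a) (lder (munit a a) g) (diagm x)) +
     (\<Sum>a\<in>UNIV. lder (munit a a) g (diagm x) * (\<Sum>b\<in>UNIV-{a}. 2 * x (idx a) / (x (idx a) - x (idx b)) - 1))"
proof -
  let ?A = "diagm x :: complex^'n^'n"
  let ?\<theta> = "\<lambda>a. lder (munit a a) g ?A"
  let ?y = "\<lambda>a. x (idx a)"
  have ne: "?y a \<noteq> ?y b" if "a \<noteq> b" for a b :: 'n
    using inj_onD[OF x _ idx_in idx_in, of a b] that by auto
  have "casimir g ?A = (\<Sum>a\<in>UNIV. lder (munit a a) (lder (munit a a) g) ?A + (\<Sum>b\<in>UNIV-{a}. lder (munit a b) (lder (munit b a) g) ?A))"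
    unfolding casimir_def
  proof (rule sum.cong[OF refl])
    fix a
    show "(\<Sum>b\<in>UNIV. lder (munit a b) (lder (munit b a) g) ?A) = lder (munit a a) (lder (munit a a) g) ?A + (\<Sum>b\<in>UNIV-{a}. lder (munit a b) (lder (munit b a) g) ?A)"
      by (rule sum.remove) simp_all
  qed
  also have "\<dots> = (\<Sum>a\<in>UNIV. lder (munit a a) (lder (munit a a) g) ?A) + (\<Sum>a\<in>UNIV. \<Sum>b\<in>UNIV-{a}. lder (munit a b) (lder (munit b a) g) ?A)"
    by (rule sum.distrib)
  also have "(\<Sum>a\<in>UNIV. \<Sum>b\<in>UNIV-{a}. lder (munit a b) (lder (munit b a) g) ?A) = 
      (\<Sum>a\<in>UNIV. \<Sum>b\<in>UNIV-{a}. ?y b / (?y b - ?y a) * ?\<theta> b - ?y b / (?y b - ?y a) * ?\<theta> a)"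
    by (intro sum.cong refl) (simp add: mixed_second_derivative[OF g] ne diff_divide_distrib right_diff_distrib)
  also have "\<dots> = (\<Sum>a\<in>UNIV. \<Sum>b\<in>UNIV-{a}. ?y b / (?y b - ?y a) * ?\<theta> b) - (\<Sum>a\<in>UNIV. \<Sum>b\<in>UNIV-{a}. ?y b / (?y b - ?y a) * ?\<theta> a)"
    by (simp add: sum_subtractf)
  also have "(\<Sum>a\<in>UNIV. \<Sum>b\<in>UNIV-{a}. ?y b / (?y b - ?y a) * ?\<theta> b) = (\<Sum>b\<in>UNIV. \<Sum>a\<in>UNIV-{b}. ?y b / (?y b - ?y a) * ?\<theta> b)"
    by (rule sum_swap_offdiag)
  also have "(\<Sum>b\<in>UNIV. \<Sum>a\<in>UNIV-{b}. ?y b / (?y b - ?y a) * ?\<theta> b) - (\<Sum>a\<in>UNIV. \<Sum>b\<in>UNIV-{a}. ?y b / (?y b - ?y a) * ?\<theta> a)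
     = (\<Sum>a\<in>UNIV. ?\<theta> a * (\<Sum>b\<in>UNIV-{a}. ?y a / (?y a - ?y b) - ?y b / (?y b - ?y a)))"
    unfolding sum_subtractf[symmetric] sum_distrib_left by (intro sum.cong refl) (simp add: algebra_simps)
  also have "\<dots> = (\<Sum>a\<in>UNIV. ?\<theta> a * (\<Sum>b\<in>UNIV-{a}. 2 * ?y a / (?y a - ?y b) - 1))"
  proof (intro sum.cong refl arg_cong2[of _ _ _ _ "(*)"])
    fix a b :: 'n assume "b \<in> UNIV - {a}"
    then have "?y a - ?y b \<noteq> 0" "?y b - ?y a \<noteq> 0" using ne[of a b] by auto
    then show "?y a / (?y a - ?y b) - ?y b / (?y b - ?y a) = 2 * ?y a / (?y a - ?y b) - 1"
      by (simp add: divide_simps) (simp add: algebra_simps)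
  qed
  finally show ?thesis .
qed

definition monomial :: "nat \<Rightarrow> (nat \<Rightarrow> nat) \<Rightarrow> (nat \<Rightarrow> complex) \<Rightarrow> complex" where
  "monomial n \<kappa> x = (\<Prod>i=1..n. x i ^ \<kappa> i)"

text \<open>The direction E_aa D is tangent to the diagonal matrices and acts there as the Euler operator
x_a d/dx_a, for which monomials are eigenvectors.\<close>

lemma line_theta: "line (diagm x) (munit a a ** diagm x) t = (diagm (x(idx a := (1 + t) * x (idx a))) :: complex^'n^'n)"
proof -
  have "(munit a a ** diagm x :: complex^'n^'n) $ i $ j = (if i = a \<and> j = a then x (idx a) else 0)" for i j
    by (simp add: mm_nth diagm_nth munit_nth if_distrib[of "\<lambda>z. z * _"] if_distrib[of "\<lambda>z. _ * z"] cong: if_cong)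
  then show ?thesis by (simp add: vec_eq_iff diagm_nth algebra_simps)
qed

lemma theta_monomial:
  fixes H :: "complex^'n^'n \<Rightarrow> complex"
  assumes H: "\<And>x. H (diagm x) = (\<Sum>j\<in>J. v j * monomial (CARD('n)) (e j) x)"
  shows "lder (munit a a) H (diagm x) = (\<Sum>j\<in>J. of_nat (e j (idx a)) * v j * monomial (CARD('n)) (e j) x)"
proof -
  have m: "monomial (CARD('n)) \<kappa> (x(idx a := (1 + t) * x (idx a))) = (1 + t) ^ \<kappa> (idx a) * monomial (CARD('n)) \<kappa> x" for \<kappa> t
  proof -
    have "monomial (CARD('n)) \<kappa> (x(idx a := (1 + t) * x (idx a))) = (\<Prod>i=1..CARD('n). (if i = idx a then (1 + t) ^ \<kappa> i else 1) * x i ^ \<kappa> i)"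
      unfolding monomial_def by (intro prod.cong refl) (simp add: power_mult_distrib)
    also have "\<dots> = (1 + t) ^ \<kappa> (idx a) * monomial (CARD('n)) \<kappa> x"
      unfolding monomial_def prod.distrib using idx_in[of a] by simp
    finally show ?thesis .
  qed
  have "lder (munit a a) H (diagm x) = deriv (\<lambda>t. \<Sum>j\<in>J. v j * ((1 + t) ^ e j (idx a) * monomial (CARD('n)) (e j) x)) 0"
    unfolding lder_def ddir_def line_theta H m ..
  also have "\<dots> = (\<Sum>j\<in>J. of_nat (e j (idx a)) * v j * monomial (CARD('n)) (e j) x)"
    by (rule DERIV_imp_deriv) (auto intro!: derivative_eq_intros sum.cong)
  finally show ?thesis .
qed

text \<open>The Vandermonde product of the diagonal entries. It extends the Vandermonde product from diagonal
matrices to a polynomial on all matrices, so that the Leibniz rule for derivations applies to its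
products; only the values on diagonal matrices matter.\<close>

definition vdm :: "complex^'n^'n \<Rightarrow> complex" where
  "vdm M = vandermonde_prod (CARD('n)) (\<lambda>s. M $ inv_into UNIV idx s $ inv_into UNIV idx s)"

lemma inv_idx: "s \<in> {1..CARD('n)} \<Longrightarrow> idx (inv_into UNIV idx s :: 'n::finite) = s"
  by (rule f_inv_into_f) (use bij_betw_imp_surj_on[OF bij_idx] in auto)

lemma mpoly_vdm: "mpoly (vdm :: complex^'n^'n \<Rightarrow> complex)"
proof -
  have "mpoly (\<lambda>M :: complex^'n^'n. vdm M)"
    unfolding vdm_def vandermonde_prod_def by (intro mpoly_prod mpoly_minus mpoly_coord)
  then show ?thesis by simp
qed

lemma vdm_diagm: "vdm (diagm x :: complex^'n^'n) = vandermonde_prod (CARD('n)) x"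
  unfolding vdm_def vandermonde_prod_def
proof (intro prod.cong refl)
  fix s r assume "s \<in> {1..CARD('n)}" "r \<in> {1..<s}"
  then have r: "r \<in> {1..CARD('n)}" and s: "s \<in> {1..CARD('n)}" by auto
  show "(diagm x :: complex^'n^'n) $ inv_into UNIV idx r $ inv_into UNIV idx r - (diagm x :: complex^'n^'n) $ inv_into UNIV idx s $ inv_into UNIV idx s = x r - x s"
    by (simp only: diagm_nth inv_idx[OF r] inv_idx[OF s] if_True simp_thms)
qed

text \<open>The exponents of the monomials of the Vandermonde determinant, extended by 0 so that they are
represented by one function each.\<close>

definition delta_perm :: "nat \<Rightarrow> (nat \<Rightarrow> nat) \<Rightarrow> nat \<Rightarrow> nat" where
  "delta_perm n p i = (if i \<in> {1..n} then n - p i else 0)"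

lemma vdm_monomial: "vdm (diagm x :: complex^'n^'n) = (\<Sum>p | p permutes {1..CARD('n)}. of_int (sign p) * monomial (CARD('n)) (delta_perm (CARD('n)) p) x)"
  unfolding vdm_diagm vandermonde_eq_alt alt_def altdet_def monomial_def delta_perm_def by simp

text \<open>The logarithmic derivative of the Vandermonde product, which is the first-order coefficient of the
radial part.\<close>

lemma theta_vdm_log:
  fixes x :: "nat \<Rightarrow> complex"
  assumes x: "inj_on x {1..CARD('n)}"
  shows "lder (munit a a) vdm (diagm x :: complex^'n^'n) = vdm (diagm x :: complex^'n^'n) * (\<Sum>b\<in>UNIV-{a}. x (idx a) / (x (idx a) - x (idx b)))"
proof -
  let ?n = "CARD('n)" and ?c = "idx a"
  let ?S = "Sigma {1..?n} (\<lambda>s. {1..<s})"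
  let ?y = "\<lambda>t. x(?c := (1 + t) * x ?c)"
  let ?f = "\<lambda>(s, r) t. ?y t r - ?y t s"
  let ?d = "\<lambda>(s, r). (if r = ?c then x ?c else 0) - (if s = ?c then x ?c else 0)"
  let ?z = "\<lambda>(s, r). x r - x s"
  have ne: "?z q \<noteq> 0" if "q \<in> ?S" for q
    using that inj_onD[OF x, of "snd q" "fst q"] by (cases q) auto
  have V: "vandermonde_prod ?n y = (\<Prod>q\<in>?S. case q of (s, r) \<Rightarrow> y r - y s)" for y :: "nat \<Rightarrow> complex"
    unfolding vandermonde_prod_def by (subst prod.Sigma) auto
  have der: "((\<lambda>t. case q of (s, r) \<Rightarrow> ?y t r - ?y t s) has_field_derivative ?d q) (at 0)" for q
  proof -
    have "((\<lambda>t. ?y t i) has_field_derivative (if i = ?c then x ?c else 0)) (at 0)" for i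
      by (cases "i = ?c") (auto intro!: derivative_eq_intros)
    from DERIV_diff[OF this[of "snd q"] this[of "fst q"]] show ?thesis by (simp only: case_prod_unfold)
  qed
  have "lder (munit a a) vdm (diagm x :: complex^'n^'n) = deriv (\<lambda>t. \<Prod>q\<in>?S. case q of (s, r) \<Rightarrow> ?y t r - ?y t s) 0"
    unfolding lder_def ddir_def line_theta vdm_diagm V ..
  also have "\<dots> = (\<Sum>q\<in>?S. ?d q * (\<Prod>q'\<in>?S - {q}. case q' of (s, r) \<Rightarrow> ?y 0 r - ?y 0 s))"
    by (rule DERIV_imp_deriv[OF has_field_derivative_prod[OF der]])
  also have "?y 0 = x" by simp
  also have "(\<Sum>q\<in>?S. ?d q * (\<Prod>q'\<in>?S - {q}. ?z q')) = (\<Sum>q\<in>?S. vandermonde_prod ?n x * (?d q / ?z q))"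
  proof (rule sum.cong[OF refl])
    fix q assume q: "q \<in> ?S"
    have "vandermonde_prod ?n x = ?z q * (\<Prod>q'\<in>?S - {q}. ?z q')"
      unfolding V by (rule prod.remove) (use q in auto)
    then show "?d q * (\<Prod>q'\<in>?S - {q}. ?z q') = vandermonde_prod ?n x * (?d q / ?z q)"
      using ne[OF q] by simp
  qed
  also have "\<dots> = vandermonde_prod ?n x * (\<Sum>q\<in>?S. ?d q / ?z q)" by (simp only: sum_distrib_left)
  also have "(\<Sum>q\<in>?S. ?d q / ?z q) = (\<Sum>s=1..?n. \<Sum>r\<in>{1..<s}. ((if r = ?c then x ?c else 0) - (if s = ?c then x ?c else 0)) / (x r - x s))"
    by (subst sum.Sigma) (auto intro!: sum.cong)
  also have "\<dots> = (\<Sum>s=1..?n. (if s \<in> {?c<..?n} then x ?c / (x ?c - x s) else 0) + (if s = ?c then \<Sum>r\<in>{1..<?c}. x ?c / (x ?c - x r) else 0))"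
  proof (rule sum.cong[OF refl])
    fix s assume s: "s \<in> {1..?n}"
    consider "s < ?c" | "s = ?c" | "s > ?c" by linarith
    then show "(\<Sum>r\<in>{1..<s}. ((if r = ?c then x ?c else 0) - (if s = ?c then x ?c else 0)) / (x r - x s)) = 
       (if s \<in> {?c<..?n} then x ?c / (x ?c - x s) else 0) + (if s = ?c then \<Sum>r\<in>{1..<?c}. x ?c / (x ?c - x r) else 0)"
    proof cases
      case 1
      then show ?thesis by (auto intro!: sum.neutral)
    next
      case 2
      have "(\<Sum>r\<in>{1..<?c}. ((if r = ?c then x ?c else 0) - x ?c) / (x r - x ?c)) = (\<Sum>r\<in>{1..<?c}. x ?c / (x ?c - x r))"
      proof (rule sum.cong[OF refl])
        fix r assume "r \<in> {1..<?c}"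
        then show "((if r = ?c then x ?c else 0) - x ?c) / (x r - x ?c) = x ?c / (x ?c - x r)"
          using minus_divide_divide[of "x ?c" "x ?c - x r"] by simp
      qed
      then show ?thesis using 2 by simp
    next
      case 3
      have "(\<Sum>r\<in>{1..<s}. ((if r = ?c then x ?c else 0) - (if s = ?c then x ?c else 0)) / (x r - x s)) = (\<Sum>r\<in>{1..<s}. if r = ?c then x ?c / (x ?c - x s) else 0)"
        using 3 by (intro sum.cong refl) auto
      also have "\<dots> = x ?c / (x ?c - x s)" using 3 idx_in[of a] by simp
      finally show ?thesis using 3 s by simp
    qed
  qed
  also have "\<dots> = (\<Sum>s\<in>{?c<..?n}. x ?c / (x ?c - x s)) + (\<Sum>r\<in>{1..<?c}. x ?c / (x ?c - x r))"
  proof -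
    have "{1..?n} \<inter> {?c<..?n} = {?c<..?n}" using idx_in[of a] by auto
    then have "(\<Sum>s=1..?n. if s \<in> {?c<..?n} then x ?c / (x ?c - x s) else 0) = (\<Sum>s\<in>{?c<..?n}. x ?c / (x ?c - x s))"
      using sum.inter_restrict[of "{1..?n}" "\<lambda>s. x ?c / (x ?c - x s)" "{?c<..?n}"] by (simp only: finite_atLeastAtMost)
    moreover have "(\<Sum>s=1..?n. if s = ?c then \<Sum>r\<in>{1..<?c}. x ?c / (x ?c - x r) else 0) = (\<Sum>r\<in>{1..<?c}. x ?c / (x ?c - x r))"
      using idx_in[of a] by simp
    ultimately show ?thesis by (simp only: sum.distrib)
  qed
  also have "\<dots> = (\<Sum>s\<in>{?c<..?n} \<union> {1..<?c}. x ?c / (x ?c - x s))"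
    by (rule sum.union_disjoint[symmetric]) auto
  also have "{?c<..?n} \<union> {1..<?c} = idx ` (UNIV - {a})"
  proof -
    have r: "range (idx :: 'n \<Rightarrow> nat) = {1..?n}" by (rule bij_betw_imp_surj_on[OF bij_idx])
    have "idx ` (UNIV - {a}) = range (idx :: 'n \<Rightarrow> nat) - {?c}"
    proof (rule equalityI; rule subsetI)
      fix i assume "i \<in> range (idx :: 'n \<Rightarrow> nat) - {?c}"
      then obtain b :: 'n where "i = idx b" "b \<noteq> a" by blast
      then show "i \<in> idx ` (UNIV - {a})" by simp
    qed auto
    also have "\<dots> = {?c<..?n} \<union> {1..<?c}" unfolding r using idx_in[of a] by (simp add: set_eq_iff) arith
    finally show ?thesis by simp
  qed
  also have "(\<Sum>s\<in>idx ` (UNIV - {a}). x ?c / (x ?c - x s)) = (\<Sum>b\<in>UNIV-{a}. x ?c / (x ?c - x (idx b)))"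
    by (simp add: sum.reindex inj_on_def)
  finally show ?thesis unfolding vdm_diagm .
qed

text \<open>For kappa = lam + delta this is the eigenvalue of the Casimir element on the representation with
highest weight lam; it vanishes for kappa = delta.\<close>

definition casimir_ev :: "nat \<Rightarrow> (nat \<Rightarrow> nat) \<Rightarrow> complex" where
  "casimir_ev n \<kappa> = (\<Sum>i=1..n. of_nat (\<kappa> i) ^ 2) - of_nat (n - 1) * (\<Sum>i=1..n. of_nat (\<kappa> i))
     - ((\<Sum>i=1..n. of_nat (n - i) ^ 2) - of_nat (n - 1) * (\<Sum>i=1..n. of_nat (n - i)))"

lemma theta_sums:
  fixes H :: "complex^'n^'n \<Rightarrow> complex"
  assumes H: "\<And>x. H (diagm x) = (\<Sum>j\<in>J. v j * monomial (CARD('n)) (e j) x)"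
  shows "(\<Sum>a\<in>UNIV. lder (munit a a) (lder (munit a a) H) (diagm x)) = (\<Sum>j\<in>J. (\<Sum>i=1..CARD('n). of_nat (e j i) ^ 2) * (v j * monomial (CARD('n)) (e j) x))"
    "(\<Sum>a\<in>UNIV. lder (munit a a) H (diagm x)) = (\<Sum>j\<in>J. (\<Sum>i=1..CARD('n). of_nat (e j i)) * (v j * monomial (CARD('n)) (e j) x))"
proof -
  let ?n = "CARD('n)"
  note 1 = theta_monomial[OF H]
  have 2: "lder (munit a a) (lder (munit a a) H) (diagm x) = (\<Sum>j\<in>J. of_nat (e j (idx a)) * (of_nat (e j (idx a)) * v j) * monomial ?n (e j) x)" for a
    by (rule theta_monomial) (rule 1)
  have "(\<Sum>a\<in>UNIV. lder (munit a a) (lder (munit a a) H) (diagm x)) = (\<Sum>j\<in>J. \<Sum>a::'n\<in>UNIV. of_nat (e j (idx a)) ^ 2 * (v j * monomial ?n (e j) x))"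
    unfolding 2 by (subst sum.swap) (simp add: power2_eq_square mult.assoc)
  also have "\<dots> = (\<Sum>j\<in>J. (\<Sum>i=1..?n. of_nat (e j i) ^ 2) * (v j * monomial ?n (e j) x))"
    unfolding sum_distrib_right[symmetric] sum_idx[of "\<lambda>i. of_nat (e _ i) ^ 2"] ..
  finally show "(\<Sum>a\<in>UNIV. lder (munit a a) (lder (munit a a) H) (diagm x)) = (\<Sum>j\<in>J. (\<Sum>i=1..?n. of_nat (e j i) ^ 2) * (v j * monomial ?n (e j) x))" .
  have "(\<Sum>a\<in>UNIV. lder (munit a a) H (diagm x)) = (\<Sum>j\<in>J. \<Sum>a::'n\<in>UNIV. of_nat (e j (idx a)) * (v j * monomial ?n (e j) x))"
    unfolding 1 by (subst sum.swap) (simp add: mult.assoc)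
  also have "\<dots> = (\<Sum>j\<in>J. (\<Sum>i=1..?n. of_nat (e j i)) * (v j * monomial ?n (e j) x))"
    unfolding sum_distrib_right[symmetric] sum_idx[of "\<lambda>i. of_nat (e _ i)"] ..
  finally show "(\<Sum>a\<in>UNIV. lder (munit a a) H (diagm x)) = (\<Sum>j\<in>J. (\<Sum>i=1..?n. of_nat (e j i)) * (v j * monomial ?n (e j) x))" .
qed

text \<open>The first-order terms of the radial part are, up to a multiple of the sum of the Euler operators,
twice the gradient of the logarithm of the Vandermonde product. They are the cross terms of the
Leibniz rule for the second Euler derivatives of the product of g with the Vandermonde product.
Since the Vandermonde product is itself an eigenvector, conjugation by it leaves an operator that is
diagonal on monomials.\<close>

lemma vdm_casimir:
  fixes g :: "complex^'n^'n \<Rightarrow> complex"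
  assumes g: "mpoly g" "uclass g" and x: "inj_on x {1..CARD('n)}"
    and H: "\<And>x. vdm (diagm x :: complex^'n^'n) * g (diagm x) = (\<Sum>j\<in>J. v j * monomial (CARD('n)) (e j) x)"
  shows "vdm (diagm x :: complex^'n^'n) * casimir g (diagm x) = (\<Sum>j\<in>J. casimir_ev (CARD('n)) (e j) * (v j * monomial (CARD('n)) (e j) x))"
proof -
  let ?n = "CARD('n)" and ?A = "diagm x :: complex^'n^'n"
  let ?T = "\<lambda>a. lder (munit a a)"
  let ?L = "\<lambda>a. \<Sum>b\<in>UNIV-{a}. x (idx a) / (x (idx a) - x (idx b))"
  let ?N = "\<Sum>i=1..?n. of_nat (?n - i) :: complex" and ?N2 = "\<Sum>i=1..?n. of_nat (?n - i) ^ 2 :: complex"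
  define h where "h M = vdm M * g M" for M
  have hm: "mpoly h" unfolding h_def[abs_def] by (intro mpoly_mult mpoly_vdm g)
  have p1: "?T a h = (\<lambda>M. ?T a vdm M * g M + vdm M * ?T a g M)" for a
    unfolding h_def[abs_def] by (rule derivationD(4)[OF derivation_lder mpoly_vdm g(1)])
  have p2: "?T a (?T a h) M = ?T a (?T a vdm) M * g M + 2 * (?T a vdm M * ?T a g M) + vdm M * ?T a (?T a g) M" for a M
  proof -
    have "?T a (?T a h) = (\<lambda>M. (?T a (?T a vdm) M * g M + ?T a vdm M * ?T a g M) + (?T a vdm M * ?T a g M + vdm M * ?T a (?T a g) M))"
      unfolding p1
      by (simp only: derivationD(3,4)[OF derivation_lder] mpoly_mult mpoly_vdm g(1) mpoly_lder)
    then show ?thesis by (simp add: algebra_simps)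
  qed
  have sgn: "(\<Sum>i=1..?n. f (delta_perm ?n p i)) = (\<Sum>i=1..?n. f (?n - i))" if "p permutes {1..?n}" for p and f :: "nat \<Rightarrow> complex"
  proof -
    have "(\<Sum>i=1..?n. f (delta_perm ?n p i)) = (\<Sum>i=1..?n. f (?n - p i))" by (intro sum.cong refl) (simp add: delta_perm_def)
    also have "\<dots> = (\<Sum>i=1..?n. f (?n - i))" using sum.permute[OF that, of "\<lambda>i. f (?n - i)"] by (simp add: comp_def)
    finally show ?thesis .
  qed
  have V2: "(\<Sum>a\<in>UNIV. ?T a (?T a vdm) ?A) = ?N2 * vdm ?A"
    unfolding theta_sums(1)[OF vdm_monomial] vdm_monomial sum_distrib_left by (intro sum.cong refl) (simp only: sgn[of _ "\<lambda>k. of_nat k ^ 2"] mem_Collect_eq)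
  have V1: "(\<Sum>a\<in>UNIV. ?T a vdm ?A) = ?N * vdm ?A"
    unfolding theta_sums(2)[OF vdm_monomial] vdm_monomial sum_distrib_left by (intro sum.cong refl) (simp only: sgn[of _ of_nat] mem_Collect_eq)
  have Hh: "h (diagm x) = (\<Sum>j\<in>J. v j * monomial ?n (e j) x)" for x unfolding h_def by (rule H)
  \<comment> \<open>The cross terms of the Leibniz rule are those that appear in the radial part.\<close>
  have S2: "(\<Sum>a\<in>UNIV. ?T a (?T a h) ?A) = ?N2 * vdm ?A * g ?A + 2 * (\<Sum>a\<in>UNIV. ?T a vdm ?A * ?T a g ?A) + vdm ?A * (\<Sum>a\<in>UNIV. ?T a (?T a g) ?A)"
    unfolding p2 sum.distrib by (simp only: sum_distrib_left[symmetric] sum_distrib_right[symmetric] V2)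
  have S1: "(\<Sum>a\<in>UNIV. ?T a h ?A) = ?N * vdm ?A * g ?A + vdm ?A * (\<Sum>a\<in>UNIV. ?T a g ?A)"
    unfolding p1 sum.distrib by (simp only: sum_distrib_left[symmetric] sum_distrib_right[symmetric] V1)
  have gen1: "V * (T * (2 * L - N)) = 2 * (V * L * T) - N * (V * T)" for V T L N :: complex
    by (simp add: algebra_simps)
  have gen2: "(r - c * s - k) * m = r * m - c * (s * m) - k * m" for r c s k m :: complex
    by (simp add: algebra_simps)
  have card: "card (UNIV - {a}) = ?n - 1" for a :: 'n by (simp add: card_Diff_singleton)
  have "vdm ?A * (\<Sum>a\<in>UNIV. ?T a g ?A * (\<Sum>b\<in>UNIV-{a}. 2 * x (idx a) / (x (idx a) - x (idx b)) - 1)) =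
     (\<Sum>a\<in>UNIV. 2 * (?T a vdm ?A * ?T a g ?A) - of_nat (?n - 1) * (vdm ?A * ?T a g ?A))"
    unfolding sum_distrib_left[of "vdm ?A"]
  proof (rule sum.cong[OF refl])
    fix a :: 'n
    have "(\<Sum>b\<in>UNIV-{a}. 2 * x (idx a) / (x (idx a) - x (idx b)) - 1) = 2 * ?L a - of_nat (?n - 1)"
      unfolding sum_subtractf sum_distrib_left using card[of a] by simp
    then show "vdm ?A * (?T a g ?A * (\<Sum>b\<in>UNIV-{a}. 2 * x (idx a) / (x (idx a) - x (idx b)) - 1)) = 2 * (?T a vdm ?A * ?T a g ?A) - of_nat (?n - 1) * (vdm ?A * ?T a g ?A)"
      by (simp only: theta_vdm_log[OF x] gen1)
  qed
  also have "\<dots> = 2 * (\<Sum>a\<in>UNIV. ?T a vdm ?A * ?T a g ?A) - of_nat (?n - 1) * (vdm ?A * (\<Sum>a\<in>UNIV. ?T a g ?A))"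
    by (simp only: sum_subtractf sum_distrib_left)
  finally have "vdm ?A * casimir g ?A = vdm ?A * (\<Sum>a\<in>UNIV. ?T a (?T a g) ?A) + 2 * (\<Sum>a\<in>UNIV. ?T a vdm ?A * ?T a g ?A) - of_nat (?n - 1) * (vdm ?A * (\<Sum>a\<in>UNIV. ?T a g ?A))"
    unfolding casimir_radial[OF g x] distrib_left by simp
  also have "\<dots> = (\<Sum>a\<in>UNIV. ?T a (?T a h) ?A) - of_nat (?n - 1) * (\<Sum>a\<in>UNIV. ?T a h ?A) - (?N2 - of_nat (?n - 1) * ?N) * h ?A"
    unfolding S1 S2 h_def by (simp add: algebra_simps)
  also have "\<dots> = (\<Sum>j\<in>J. casimir_ev ?n (e j) * (v j * monomial ?n (e j) x))"
    unfolding casimir_ev_def gen2 sum_subtractf sum_distrib_left[symmetric] theta_sums[OF Hh] Hh ..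
  finally show ?thesis .
qed

section \<open>Extremal exponents\<close>

lemma monomial_cong: "(\<And>i. i \<in> {1..n} \<Longrightarrow> \<kappa> i = \<kappa>' i) \<Longrightarrow> (\<And>i. i \<in> {1..n} \<Longrightarrow> x i = y i) \<Longrightarrow> monomial n \<kappa> x = monomial n \<kappa>' y"
  unfolding monomial_def by (intro prod.cong) simp_all

text \<open>Induction on the number of variables: the coefficients with respect to the last variable vanish
separately.\<close>

lemma monomial_indep:
  assumes "finite K" "\<And>\<kappa> \<kappa>'. \<kappa> \<in> K \<Longrightarrow> \<kappa>' \<in> K \<Longrightarrow> (\<And>i. i \<in> {1..n} \<Longrightarrow> \<kappa> i = \<kappa>' i) \<Longrightarrow> \<kappa> = \<kappa>'"
    and "\<And>x. (\<Sum>\<kappa>\<in>K. c \<kappa> * monomial n \<kappa> x) = 0" and "\<kappa> \<in> K"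
  shows "c \<kappa> = 0"
  using assms
proof (induction n arbitrary: K \<kappa>)
  case 0
  have "K = {\<kappa>}"
  proof (rule equalityI; rule subsetI)
    fix \<kappa>' assume "\<kappa>' \<in> K"
    then have "\<kappa>' = \<kappa>" by (rule 0(2)) (use 0(4) in simp_all)
    then show "\<kappa>' \<in> {\<kappa>}" by simp
  qed (use 0(4) in simp)
  then show ?case using 0(3)[of undefined] by (simp add: monomial_def)
next
  case (Suc n)
  let ?a = "\<kappa> (Suc n)"
  let ?K = "{\<kappa>' \<in> K. \<kappa>' (Suc n) = ?a}"
  have z: "(\<Sum>\<kappa>'\<in>?K. c \<kappa>' * monomial n \<kappa>' x) = 0" for x
  proof -
    define p where "p = (\<Sum>\<kappa>'\<in>K. monom (c \<kappa>' * monomial n \<kappa>' x) (\<kappa>' (Suc n)))"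
    have "poly p t = 0" for t
    proof -
      have "poly p t = (\<Sum>\<kappa>'\<in>K. c \<kappa>' * monomial (Suc n) \<kappa>' (x(Suc n := t)))"
        unfolding p_def poly_sum poly_monom
      proof (rule sum.cong[OF refl])
        fix \<kappa>'
        have "monomial (Suc n) \<kappa>' (x(Suc n := t)) = monomial n \<kappa>' (x(Suc n := t)) * t ^ \<kappa>' (Suc n)"
          unfolding monomial_def by simp
        also have "monomial n \<kappa>' (x(Suc n := t)) = monomial n \<kappa>' x" by (rule monomial_cong) auto
        finally show "c \<kappa>' * monomial n \<kappa>' x * t ^ \<kappa>' (Suc n) = c \<kappa>' * monomial (Suc n) \<kappa>' (x(Suc n := t))" by (simp only: mult.assoc)
      qed
      then show ?thesis using Suc.prems(3) by simp
    qed
    then have "p = 0" by (simp add: poly_all_0_iff_0[symmetric])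
    then have "coeff p ?a = 0" by simp
    moreover have "coeff p ?a = (\<Sum>\<kappa>'\<in>K. if \<kappa>' (Suc n) = ?a then c \<kappa>' * monomial n \<kappa>' x else 0)"
      unfolding p_def coeff_sum by (intro sum.cong refl) (simp add: Polynomial.coeff_monom)
    moreover have "\<dots> = (\<Sum>\<kappa>'\<in>?K. c \<kappa>' * monomial n \<kappa>' x)"
      by (rule sum.inter_filter[symmetric]) (rule Suc.prems(1))
    ultimately show ?thesis by simp
  qed
  show ?case
  proof (rule Suc.IH[of ?K])
    show "finite ?K" using Suc.prems(1) by simp
    show "(\<Sum>\<kappa>'\<in>?K. c \<kappa>' * monomial n \<kappa>' x) = 0" for x by (rule z)
    show "\<kappa> \<in> ?K" using Suc.prems(4) by simp
    fix k k' assume k: "k \<in> ?K" "k' \<in> ?K" and eq: "\<And>i. i \<in> {1..n} \<Longrightarrow> k i = k' i"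
    show "k = k'"
    proof (rule Suc.prems(2))
      fix i assume "i \<in> {1..Suc n}"
      then show "k i = k' i" using eq[of i] k by (cases "i = Suc n") auto
    qed (use k in simp_all)
  qed
qed

text \<open>Exchanging the members of T beyond card T for the missing ones below does not decrease the sum.\<close>

lemma top_sum:
  fixes l :: "nat \<Rightarrow> nat"
  assumes l: "antimono_on {1..n} l" and T: "T \<subseteq> {1..n}"
  shows "sum l T \<le> part_sum l (card T)"
proof -
  let ?m = "card T"
  have fin: "finite T" using T finite_subset by blast
  have mn: "?m \<le> n" using card_mono[OF _ T] by simp
  have anti: "l j \<le> l i" if "1 \<le> i" "i \<le> j" "j \<le> n" for i j
    using l that by (simp add: monotone_on_def)
  have c: "card (T - {1..?m}) = card ({1..?m} - T)"
  proof -
    have "card (T - {1..?m}) + card (T \<inter> {1..?m}) = card T"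
      using card_Diff_subset_Int[of T "{1..?m}"] card_mono[of T "T \<inter> {1..?m}"] fin by simp
    moreover have "card ({1..?m} - T) + card (T \<inter> {1..?m}) = ?m"
      using card_Diff_subset_Int[of "{1..?m}" T] card_mono[of T "T \<inter> {1..?m}"] fin by (simp add: Int_commute)
    ultimately show ?thesis by simp
  qed
  have "sum l (T - {1..?m}) \<le> of_nat (card (T - {1..?m})) * l ?m"
  proof (rule sum_bounded_above)
    fix i assume i: "i \<in> T - {1..?m}"
    then have "?m \<noteq> 0" using fin by auto
    then show "l i \<le> l ?m" using i T by (intro anti) auto
  qed
  moreover have "of_nat (card ({1..?m} - T)) * l ?m \<le> sum l ({1..?m} - T)"
    by (rule sum_bounded_below) (use mn in \<open>auto intro!: anti\<close>)
  moreover have "sum l T = sum l (T - {1..?m}) + sum l (T \<inter> {1..?m})"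
    using sum.Int_Diff[OF fin, of l "{1..?m}"] by simp
  moreover have "sum l {1..?m} = sum l ({1..?m} - T) + sum l (T \<inter> {1..?m})"
    using sum.Int_Diff[of "{1..?m}" l T] by (simp add: Int_commute)
  ultimately show ?thesis using c by (simp add: part_sum_def)
qed

text \<open>Summation by parts.\<close>

lemma abel_nonneg:
  fixes k D :: "nat \<Rightarrow> int"
  assumes anti: "\<And>i. 1 \<le> i \<Longrightarrow> i < m \<Longrightarrow> k (Suc i) \<le> k i" and D: "\<And>i. i \<le> m \<Longrightarrow> D i \<ge> 0" "D 0 = 0" and m: "m \<ge> 1"
  shows "(\<Sum>i=1..m. k i * (D i - D (i - 1))) \<ge> k m * D m"
  using m anti D(1)
proof (induction m rule: dec_induct)
  case base
  then show ?case using D(2) by simp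
next
  case (step j)
  have "(\<Sum>i=1..j. k i * (D i - D (i - 1))) \<ge> k j * D j" using step.IH step.prems by auto
  moreover have "k (Suc j) * D j \<le> k j * D j"
    by (rule mult_right_mono) (use step in auto)
  ultimately show ?case by (simp add: algebra_simps)
qed

text \<open>A permutation that maximizes the pairing with (n-1, ..., 0) sorts, since exchanging two adjacent
values in the wrong order would increase the pairing.\<close>

lemma exists_sorting:
  fixes \<kappa> :: "nat \<Rightarrow> nat"
  shows "\<exists>w. w permutes {1..n} \<and> (\<forall>i. 1 \<le> i \<and> i < n \<longrightarrow> \<kappa> (w (Suc i)) \<le> \<kappa> (w i))"
proof -
  let ?P = "{p. p permutes {1..n}}"
  \<comment> \<open>The weights n - i decrease strictly, so that an inversion is detected.\<close>
  define \<Phi> where "\<Phi> w = (\<Sum>i=1..n. (n - i) * \<kappa> (w i))" for w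
  have fin: "finite ?P" by (simp add: finite_permutations)
  have ne: "?P \<noteq> {}" using permutes_id by blast
  have "Max (\<Phi> ` ?P) \<in> \<Phi> ` ?P" using fin ne by (intro Max_in) auto
  then obtain w where w: "w permutes {1..n}" "\<Phi> w = Max (\<Phi> ` ?P)" by auto
  have max: "\<Phi> v \<le> \<Phi> w" if "v permutes {1..n}" for v
    unfolding w(2) by (rule Max_ge) (use fin that in auto)
  have "\<kappa> (w (Suc i)) \<le> \<kappa> (w i)" if i: "1 \<le> i" "i < n" for i
  proof (rule ccontr)
    assume "\<not> ?thesis"
    then have lt: "\<kappa> (w i) < \<kappa> (w (Suc i))" by simp
    let ?t = "Transposition.transpose i (Suc i)"
    have t: "?t permutes {1..n}" using i by (intro permutes_swap_id) auto
    let ?v = "w \<circ> ?t"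
    have v: "?v permutes {1..n}" by (rule permutes_compose[OF t w(1)])
    have split: "\<Phi> u = (n - i) * \<kappa> (u i) + (n - Suc i) * \<kappa> (u (Suc i)) + (\<Sum>j\<in>{1..n} - {i, Suc i}. (n - j) * \<kappa> (u j))" for u
    proof -
      have "\<Phi> u = (n - i) * \<kappa> (u i) + (\<Sum>j\<in>{1..n} - {i}. (n - j) * \<kappa> (u j))"
        unfolding \<Phi>_def by (rule sum.remove) (use i in auto)
      also have "(\<Sum>j\<in>{1..n} - {i}. (n - j) * \<kappa> (u j)) = (n - Suc i) * \<kappa> (u (Suc i)) + (\<Sum>j\<in>{1..n} - {i} - {Suc i}. (n - j) * \<kappa> (u j))"
        by (rule sum.remove) (use i in auto)
      also have "{1..n} - {i} - {Suc i} = {1..n} - {i, Suc i}" by auto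
      finally show ?thesis by simp
    qed
    have rest: "(\<Sum>j\<in>{1..n} - {i, Suc i}. (n - j) * \<kappa> (?v j)) = (\<Sum>j\<in>{1..n} - {i, Suc i}. (n - j) * \<kappa> (w j))"
      by (intro sum.cong refl) (simp add: Transposition.transpose_def)
    have vi: "?v i = w (Suc i)" "?v (Suc i) = w i" by (simp_all add: Transposition.transpose_def)
    have ni: "n - i = Suc (n - Suc i)" using i by simp
    have "\<Phi> w < \<Phi> ?v"
      unfolding split[of w] split[of ?v] rest vi ni using lt by (simp add: algebra_simps)
    then show False using max[OF v] by simp
  qed
  then show ?thesis using w(1) by blast
qed

text \<open>The vertices of the permutohedron are its points farthest from the origin. For the decreasing
rearrangement k of kappa, summation by parts shows that the scalar product of k and l - k is
nonnegative, so |l|^2 = |k|^2 + 2 k.(l - k) + |l - k|^2 is at least |k|^2 + |l - k|^2.\<close>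

lemma dominated_extremal:
  fixes \<kappa> l :: "nat \<Rightarrow> nat"
  assumes \<kappa>: "\<kappa> \<in> dominated n (part_sum l)" and sq: "(\<Sum>i=1..n. (\<kappa> i)\<^sup>2) = (\<Sum>i=1..n. (l i)\<^sup>2)"
  shows "\<exists>w. w permutes {1..n} \<and> (\<forall>i\<in>{1..n}. \<kappa> i = l (w i))"
proof (cases "n = 0")
  case True then show ?thesis using permutes_id by auto
next
  case False
  obtain w where w: "w permutes {1..n}" and ws: "\<And>i. 1 \<le> i \<Longrightarrow> i < n \<Longrightarrow> \<kappa> (w (Suc i)) \<le> \<kappa> (w i)"
    using exists_sorting[of n \<kappa>] by blast
  define k where "k i = \<kappa> (w i)" for i
  have ksum: "(\<Sum>i=1..n. f (k i)) = (\<Sum>i=1..n. f (\<kappa> i))" for f :: "nat \<Rightarrow> nat"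
    unfolding k_def using sum.permute[OF w, of "\<lambda>i. f (\<kappa> i)"] by (simp add: comp_def)
  have le: "part_sum k j \<le> part_sum l j" if "j \<le> n" for j
  proof -
    have sub: "w ` {1..j} \<subseteq> {1..n}"
    proof
      fix y assume "y \<in> w ` {1..j}"
      then obtain i where "y = w i" "i \<in> {1..j}" by (elim imageE)
      then show "y \<in> {1..n}" using permutes_in_image[OF w, of i] that by simp
    qed
    have inj: "inj_on w {1..j}" by (rule inj_on_subset[OF permutes_inj[OF w] subset_UNIV])
    have "part_sum k j = sum \<kappa> (w ` {1..j})" unfolding part_sum_def k_def by (simp only: sum.reindex[OF inj] comp_def)
    also have "\<dots> \<le> part_sum l (card (w ` {1..j}))" using \<kappa> sub by (simp add: dominated_def)
    also have "card (w ` {1..j}) = j" unfolding card_image[OF inj] by simp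
    finally show ?thesis .
  qed
  have tot: "part_sum k n = part_sum l n"
    unfolding part_sum_def[of k] using ksum[of "\<lambda>z. z"] \<kappa> by (simp add: dominated_def)
  \<comment> \<open>The slack in the inequalities for partial sums; it is 0 at both ends.\<close>
  define D where "D j = int (part_sum l j) - int (part_sum k j)" for j
  have "(\<Sum>i=1..n. int (k i) * (D i - D (i - 1))) \<ge> int (k n) * D n"
  proof (rule abel_nonneg)
    show "D i \<ge> 0" if "i \<le> n" for i using le[OF that] by (simp add: D_def)
    show "D 0 = 0" by (simp add: D_def part_sum_def)
    show "int (k (Suc i)) \<le> int (k i)" if "1 \<le> i" "i < n" for i using ws[OF that] by (simp add: k_def)
    show "n \<ge> 1" using False by simp
  qed
  moreover have "D n = 0" by (simp add: D_def tot)
  moreover have "D i - D (i - 1) = int (l i) - int (k i)" if "i \<in> {1..n}" for i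
  proof -
    obtain j where "i = Suc j" using \<open>i \<in> {1..n}\<close> by (cases i) auto
    then show ?thesis by (simp add: D_def part_sum_Suc)
  qed
  ultimately have A: "(\<Sum>i=1..n. int (k i) * (int (l i) - int (k i))) \<ge> 0" by simp
  have "(\<Sum>i=1..n. int ((k i)\<^sup>2)) = (\<Sum>i=1..n. int ((l i)\<^sup>2))"
    using ksum[of "\<lambda>z. z\<^sup>2"] sq by (simp only: of_nat_sum[symmetric])
  moreover have "(\<Sum>i=1..n. (int (l i) - int (k i))\<^sup>2) = (\<Sum>i=1..n. int ((l i)\<^sup>2)) - (\<Sum>i=1..n. int ((k i)\<^sup>2)) - 2 * (\<Sum>i=1..n. int (k i) * (int (l i) - int (k i)))"
    unfolding sum_distrib_left sum_subtractf[symmetric] by (intro sum.cong refl) (simp add: power2_eq_square algebra_simps)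
  ultimately have "(\<Sum>i=1..n. (int (l i) - int (k i))\<^sup>2) \<le> 0" using A by simp
  then have "(\<Sum>i=1..n. (int (l i) - int (k i))\<^sup>2) = 0" by (intro antisym sum_nonneg) auto
  then have lk: "l i = k i" if "i \<in> {1..n}" for i
    using that by (subst (asm) sum_nonneg_eq_0_iff) auto
  let ?w = "inv_into UNIV w"
  have "?w permutes {1..n}" by (rule permutes_inv[OF w])
  moreover have "\<kappa> i = l (?w i)" if i: "i \<in> {1..n}" for i
  proof -
    have "?w i \<in> {1..n}" using permutes_in_image[OF \<open>?w permutes {1..n}\<close>] i by blast
    then have "l (?w i) = \<kappa> (w (?w i))" using lk by (simp add: k_def)
    also have "w (?w i) = i" by (rule permutes_inverses(1)[OF w])
    finally show ?thesis by simp
  qed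
  ultimately show ?thesis by blast
qed

lemma delta_perm_dominated:
  assumes p: "p permutes {1..n}"
  shows "delta_perm n p \<in> dominated n (part_sum (\<lambda>i. n - i))"
proof -
  have a: "antimono_on {1..n} (\<lambda>i. n - i)" by (auto simp: monotone_on_def)
  have "sum (delta_perm n p) S \<le> part_sum (\<lambda>i. n - i) (card S)" if S: "S \<subseteq> {1..n}" for S
  proof -
    have inj: "inj_on p S" by (rule inj_on_subset[OF permutes_inj[OF p]]) simp
    have "sum (delta_perm n p) S = (\<Sum>i\<in>S. n - p i)" using S by (intro sum.cong refl) (auto simp: delta_perm_def)
    also have "\<dots> = (\<Sum>i\<in>p ` S. n - i)" by (simp add: sum.reindex[OF inj])
    also have "\<dots> \<le> part_sum (\<lambda>i. n - i) (card (p ` S))"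
      by (rule top_sum[OF a]) (use S permutes_in_image[OF p] in auto)
    finally show ?thesis by (simp add: card_image[OF inj])
  qed
  moreover have "sum (delta_perm n p) {1..n} = part_sum (\<lambda>i. n - i) n"
  proof -
    have "sum (delta_perm n p) {1..n} = (\<Sum>i=1..n. n - p i)" by (intro sum.cong refl) (simp add: delta_perm_def)
    also have "\<dots> = (\<Sum>i=1..n. n - i)" using sum.permute[OF p, of "\<lambda>i. n - i"] by (simp add: comp_def)
    finally show ?thesis by (simp add: part_sum_def)
  qed
  ultimately show ?thesis by (simp add: dominated_def delta_perm_def)
qed

lemma part_sum_shifted: "j \<le> n \<Longrightarrow> part_sum (\<lambda>i. n - i) j + part_sum lam j = part_sum (shifted n lam) j"
  unfolding part_sum_def sum.distrib[symmetric] by (intro sum.cong refl) (auto simp: shifted_def)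

section \<open>Class functions with the eigenvalue of a Schur function\<close>

text \<open>Permutation matrices are unitary, so class functions are symmetric in the diagonal entries.\<close>

lemma perm_matrix:
  fixes g :: "complex^'n^'n \<Rightarrow> complex"
  assumes u: "uclass g" and p: "p permutes {1..CARD('n)}"
  shows "g (diagm (\<lambda>i. x (p i))) = g (diagm x)"
proof -
  define P :: "complex^'n^'n" where "P = (\<chi> i j. if idx j = p (idx i) then 1 else 0)"
  define \<sigma> :: "'n \<Rightarrow> 'n" where "\<sigma> i = inv_into UNIV idx (p (idx i))" for i
  have \<sigma>: "idx (\<sigma> i) = p (idx i)" for i
  proof -
    have "p (idx i) \<in> {1..CARD('n)}" using permutes_in_image[OF p] idx_in by blast
    then show ?thesis unfolding \<sigma>_def by (rule inv_idx)
  qed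
  have P: "P $ i $ j = (if \<sigma> i = j then 1 else 0)" for i j
  proof -
    have "idx j = p (idx i) \<longleftrightarrow> idx j = idx (\<sigma> i)" by (simp add: \<sigma>)
    then show ?thesis by (auto simp: P_def)
  qed
  have \<sigma>inj: "\<sigma> i = \<sigma> j \<longleftrightarrow> i = j" for i j
  proof
    assume "\<sigma> i = \<sigma> j"
    then have "p (idx i) = p (idx j)" by (metis \<sigma>)
    then show "i = j" using injD[OF permutes_inj[OF p]] by (metis idx_eq)
  qed simp
  have row: "(\<Sum>k\<in>UNIV. P $ i $ k * z k) = z (\<sigma> i)" for i z
  proof -
    have "(\<Sum>k\<in>UNIV. P $ i $ k * z k) = (\<Sum>k\<in>UNIV. if \<sigma> i = k then z k else 0)"
      by (intro sum.cong refl) (simp add: P)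
    then show ?thesis by simp
  qed
  have "P ** conj_transpose P = Finite_Cartesian_Product.mat 1"
    unfolding vec_eq_iff mm_nth row ct_nth by (auto simp: P mat_nth \<sigma>inj)
  then have U: "P \<in> unitary_group" by (rule unitaryI)
  have "P ** diagm x ** conj_transpose P = diagm (\<lambda>i. x (p i))"
  proof -
    have "(P ** diagm x ** conj_transpose P) $ i $ j = (diagm (\<lambda>i. x (p i)) :: complex^'n^'n) $ i $ j" for i j
    proof -
      have "(P ** diagm x ** conj_transpose P) $ i $ j = (P ** (diagm x ** conj_transpose P)) $ i $ j" by (simp add: matrix_mul_assoc)
      also have "\<dots> = (diagm x ** conj_transpose P) $ \<sigma> i $ j" unfolding mm_nth[of P] row ..
      also have "\<dots> = (\<Sum>k\<in>UNIV. if \<sigma> i = k then x (idx k) * cnj (P $ j $ k) else 0)"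
        unfolding mm_nth ct_nth diagm_nth by (intro sum.cong refl) simp
      also have "\<dots> = x (idx (\<sigma> i)) * cnj (P $ j $ \<sigma> i)" by simp
      also have "\<dots> = (if i = j then x (p (idx i)) else 0)" by (auto simp: P \<sigma> \<sigma>inj)
      finally show ?thesis by (simp add: diagm_nth)
    qed
    then show ?thesis by (simp only: vec_eq_iff simp_thms)
  qed
  then show ?thesis using u U unfolding uclass_def by metis
qed

lemma alt_rows: "alt n \<kappa> x = (\<Sum>p | p permutes {1..n}. of_int (sign p) * monomial n \<kappa> (\<lambda>i. x (p i)))"
proof -
  have "alt n \<kappa> x = altdet n (\<lambda>i j. x j ^ \<kappa> i)" unfolding alt_def by (rule altdet_transpose[of n "\<lambda>i j. x j ^ \<kappa> i"])
  then show ?thesis by (simp add: altdet_def monomial_def)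
qed

lemma vandermonde_permute:
  fixes x :: "nat \<Rightarrow> complex"
  assumes p: "p permutes {1..n}"
  shows "vandermonde_prod n (\<lambda>i. x (p i)) = of_int (sign p) * vandermonde_prod n x"
proof -
  have "vandermonde_prod n (\<lambda>i. x (p i)) = altdet n (\<lambda>i j. x (p j) ^ (n - i))"
    unfolding altdet_powers[symmetric] by (rule altdet_transpose[of n "\<lambda>i j. x (p j) ^ (n - i)"])
  also have "\<dots> = of_int (sign p) * altdet n (\<lambda>i j. x j ^ (n - i))"
    by (rule altdet_permute_cols[OF p, of "\<lambda>i j. x j ^ (n - i)"])
  also have "altdet n (\<lambda>i j. x j ^ (n - i)) = vandermonde_prod n x"
    unfolding altdet_powers[symmetric] by (rule altdet_transpose[of n "\<lambda>i j. x i ^ (n - j)"])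
  finally show ?thesis .
qed

text \<open>The monomials of the product of g with the Vandermonde product have exponents dominated by
lam + delta. The eigenvalue equation kills all of them except those with the eigenvalue of
lam + delta; the total degree being fixed, their exponents have the maximal sum of squares and are
permutations of lam + delta. Antisymmetrization over the permutations of x turns each into a multiple
of the alternant of lam and multiplies the product itself by n!.\<close>

lemma eigenfunction_unique:
  fixes g :: "complex^'n^'n \<Rightarrow> complex"
  assumes lam: "lam \<in> partitions_len (CARD('n))"
    and g: "mpoly g" "uclass g" "casimir g = (\<lambda>A. casimir_ev (CARD('n)) (shifted (CARD('n)) lam) * g A)"
    and F: "finite F" "F \<subseteq> dominated (CARD('n)) (part_sum lam)"
    and gF: "\<And>x. g (diagm x) = (\<Sum>\<nu>\<in>F. q \<nu> * monomial (CARD('n)) \<nu> x)"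
  shows "\<exists>s. \<forall>x. inj_on x {1..CARD('n)} \<longrightarrow> g (diagm x) = s * schur (CARD('n)) lam x"
proof -
  let ?n = "CARD('n)"
  let ?l = "shifted ?n lam"
  let ?P = "{p. p permutes {1..?n}}"
  let ?J = "?P \<times> F"
  let ?e = "\<lambda>(p, \<nu>) i. delta_perm ?n p i + \<nu> i"
  let ?v = "\<lambda>(p, \<nu>). of_int (sign p) * q \<nu> :: complex"
  have finP: "finite ?P" by (simp add: finite_permutations)
  have finJ: "finite ?J" using finP F(1) by simp
  define K where "K = ?e ` ?J"
  \<comment> \<open>Different pairs of a permutation and an exponent of g can give the same product monomial, so their coefficients are collected.\<close>
  define v where "v \<kappa> = (\<Sum>j | j \<in> ?J \<and> ?e j = \<kappa>. ?v j)" for \<kappa>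
  have finK: "finite K" unfolding K_def using finJ by simp
  have K: "K \<subseteq> dominated ?n (part_sum ?l)"
  proof
    fix \<kappa> assume "\<kappa> \<in> K"
    then obtain p \<nu> where *: "p permutes {1..?n}" "\<nu> \<in> F" "\<kappa> = (\<lambda>i. delta_perm ?n p i + \<nu> i)" unfolding K_def by auto
    show "\<kappa> \<in> dominated ?n (part_sum ?l)"
      unfolding *(3) by (rule dominated_add[OF delta_perm_dominated[OF *(1)] subsetD[OF F(2) *(2)]]) (rule part_sum_shifted)
  qed
  have h: "vdm (diagm x :: complex^'n^'n) * g (diagm x) = (\<Sum>\<kappa>\<in>K. v \<kappa> * monomial ?n \<kappa> x)" for x
  proof -
    have "vdm (diagm x :: complex^'n^'n) * g (diagm x) = (\<Sum>j\<in>?J. ?v j * monomial ?n (?e j) x)"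
      unfolding vdm_monomial gF sum_product sum.cartesian_product
      by (intro sum.cong refl) (auto simp: monomial_def power_add prod.distrib mult_ac)
    also have "\<dots> = (\<Sum>\<kappa>\<in>K. \<Sum>j | j \<in> ?J \<and> ?e j = \<kappa>. ?v j * monomial ?n (?e j) x)"
      unfolding K_def by (rule sum.image_gen[OF finJ])
    also have "\<dots> = (\<Sum>\<kappa>\<in>K. v \<kappa> * monomial ?n \<kappa> x)"
      unfolding v_def sum_distrib_right by (intro sum.cong refl) simp
    finally show ?thesis .
  qed
  have Kinj: "\<kappa> = \<kappa>'" if k: "\<kappa> \<in> K" "\<kappa>' \<in> K" and eq: "\<And>i. i \<in> {1..?n} \<Longrightarrow> \<kappa> i = \<kappa>' i" for \<kappa> \<kappa>'
  proof
    fix i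
    have "i \<notin> {1..?n} \<Longrightarrow> \<kappa> i = 0 \<and> \<kappa>' i = 0" using subsetD[OF K k(1)] subsetD[OF K k(2)] by (simp add: dominated_def)
    then show "\<kappa> i = \<kappa>' i" using eq[of i] by (cases "i \<in> {1..?n}") simp_all
  qed
  have pf: "poly_fun ?n (\<lambda>x. \<Sum>\<kappa>\<in>K. c \<kappa> * monomial ?n \<kappa> x)" for c :: "_ \<Rightarrow> complex"
    unfolding monomial_def by (rule poly_funI[OF finK, where c = c and e = "\<lambda>\<kappa>. \<kappa>"]) simp
  \<comment> \<open>Two expressions for the product of the Vandermonde product with the Casimir operator applied to g; the radial formula holds at distinct entries, and the identity extends to all points.\<close>
  have z: "(\<Sum>\<kappa>\<in>K. (casimir_ev ?n \<kappa> - casimir_ev ?n ?l) * v \<kappa> * monomial ?n \<kappa> x) = 0" for x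
  proof (rule poly_fun_eqI[of ?n "\<lambda>x. \<Sum>\<kappa>\<in>K. (casimir_ev ?n \<kappa> - casimir_ev ?n ?l) * v \<kappa> * monomial ?n \<kappa> x" "\<lambda>_. 0"])
    show "poly_fun ?n (\<lambda>x. \<Sum>\<kappa>\<in>K. (casimir_ev ?n \<kappa> - casimir_ev ?n ?l) * v \<kappa> * monomial ?n \<kappa> x)" by (rule pf)
    show "poly_fun ?n (\<lambda>_. 0 :: complex)" by (rule poly_fun_const)
    fix x :: "nat \<Rightarrow> complex" assume x: "inj_on x {1..?n}"
    have "vdm (diagm x :: complex^'n^'n) * casimir g (diagm x) = (\<Sum>\<kappa>\<in>K. casimir_ev ?n \<kappa> * (v \<kappa> * monomial ?n \<kappa> x))"
      by (rule vdm_casimir[OF g(1,2) x h])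
    moreover have "vdm (diagm x :: complex^'n^'n) * casimir g (diagm x) = (\<Sum>\<kappa>\<in>K. casimir_ev ?n ?l * (v \<kappa> * monomial ?n \<kappa> x))"
      unfolding g(3) mult.left_commute[of _ "casimir_ev ?n ?l"] h sum_distrib_left ..
    ultimately show "(\<Sum>\<kappa>\<in>K. (casimir_ev ?n \<kappa> - casimir_ev ?n ?l) * v \<kappa> * monomial ?n \<kappa> x) = 0"
      by (simp add: left_diff_distrib sum_subtractf mult.assoc)
  qed
  have ev: "(casimir_ev ?n \<kappa> - casimir_ev ?n ?l) * v \<kappa> = 0" if "\<kappa> \<in> K" for \<kappa>
    by (rule monomial_indep[OF finK Kinj z that])
  have w: "\<exists>w. w permutes {1..?n} \<and> (\<forall>i\<in>{1..?n}. \<kappa> i = ?l (w i))" if k: "\<kappa> \<in> K" "v \<kappa> \<noteq> 0" for \<kappa>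
  proof (rule dominated_extremal)
    show d: "\<kappa> \<in> dominated ?n (part_sum ?l)" using K k by blast
    have tot: "(\<Sum>i=1..?n. \<kappa> i) = (\<Sum>i=1..?n. ?l i)" using d by (simp add: dominated_def part_sum_def)
    have tot': "(\<Sum>i=1..?n. of_nat (\<kappa> i)) = (\<Sum>i=1..?n. of_nat (?l i) :: complex)"
      using tot by (simp only: of_nat_sum[symmetric])
    have "casimir_ev ?n \<kappa> = casimir_ev ?n ?l" using ev[OF k(1)] k(2) by simp
    then have "(\<Sum>i=1..?n. of_nat (\<kappa> i) ^ 2) = (\<Sum>i=1..?n. of_nat (?l i) ^ 2 :: complex)"
      unfolding casimir_ev_def tot' by simp
    then have "complex_of_nat (\<Sum>i=1..?n. (\<kappa> i)\<^sup>2) = complex_of_nat (\<Sum>i=1..?n. (?l i)\<^sup>2)"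
      by (simp only: of_nat_sum of_nat_power)
    then show "(\<Sum>i=1..?n. (\<kappa> i)\<^sup>2) = (\<Sum>i=1..?n. (?l i)\<^sup>2)" by (simp only: of_nat_eq_iff)
  qed
  have ka: "\<exists>s. \<forall>x. v \<kappa> * alt ?n \<kappa> x = s * alt ?n ?l x" if k: "\<kappa> \<in> K" for \<kappa>
  proof (cases "v \<kappa> = 0")
    case True
    then show ?thesis by (intro exI[of _ 0]) simp
  next
    case False
    obtain w where w: "w permutes {1..?n}" "\<And>i. i \<in> {1..?n} \<Longrightarrow> \<kappa> i = ?l (w i)"
      using w[OF k False] by blast
    have "alt ?n \<kappa> x = of_int (sign w) * alt ?n ?l x" for x :: "nat \<Rightarrow> complex"
    proof -
      have "alt ?n \<kappa> x = altdet ?n (\<lambda>i j. x i ^ ?l (w j))" unfolding alt_def by (rule altdet_cong) (simp add: w(2))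
      also have "\<dots> = of_int (sign w) * alt ?n ?l x"
        unfolding alt_def by (rule altdet_permute_cols[OF w(1), of "\<lambda>i j. x i ^ ?l j"])
      finally show ?thesis .
    qed
    then show ?thesis by (intro exI[of _ "v \<kappa> * of_int (sign w)"]) simp
  qed
  then obtain s where s: "\<And>\<kappa> x. \<kappa> \<in> K \<Longrightarrow> v \<kappa> * alt ?n \<kappa> x = s \<kappa> * alt ?n ?l x" by metis
  \<comment> \<open>The left side is antisymmetric in x, so its antisymmetrization is n! times itself.\<close>
  have avg: "fact ?n * (vandermonde_prod ?n x * g (diagm x)) = (\<Sum>\<kappa>\<in>K. s \<kappa>) * alt ?n ?l x" for x
  proof -
    have "of_int (sign p) * (\<Sum>\<kappa>\<in>K. v \<kappa> * monomial ?n \<kappa> (\<lambda>i. x (p i))) = vandermonde_prod ?n x * g (diagm x)" if p: "p \<in> ?P" for p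
    proof -
      have "(\<Sum>\<kappa>\<in>K. v \<kappa> * monomial ?n \<kappa> (\<lambda>i. x (p i))) = vandermonde_prod ?n (\<lambda>i. x (p i)) * g (diagm (\<lambda>i. x (p i)))"
        using h[of "\<lambda>i. x (p i)"] by (simp add: vdm_diagm)
      also have "\<dots> = of_int (sign p) * vandermonde_prod ?n x * g (diagm x)"
        using p by (simp add: vandermonde_permute perm_matrix[OF g(2)])
      finally have e: "(\<Sum>\<kappa>\<in>K. v \<kappa> * monomial ?n \<kappa> (\<lambda>i. x (p i))) = of_int (sign p) * vandermonde_prod ?n x * g (diagm x)" .
      have "of_int (sign p) * of_int (sign p) = (1::complex)"
        by (metis of_int_1 of_int_mult sign_idempotent)
      then show ?thesis unfolding e by (simp add: mult.assoc[symmetric])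
    qed
    then have "(\<Sum>p\<in>?P. of_int (sign p) * (\<Sum>\<kappa>\<in>K. v \<kappa> * monomial ?n \<kappa> (\<lambda>i. x (p i)))) = (\<Sum>p\<in>?P. vandermonde_prod ?n x * g (diagm x))"
      by (rule sum.cong[OF refl])
    also have "\<dots> = fact ?n * (vandermonde_prod ?n x * g (diagm x))"
      using card_permutations[of "{1..?n}" ?n] by simp
    finally have 1: "fact ?n * (vandermonde_prod ?n x * g (diagm x)) = (\<Sum>p\<in>?P. of_int (sign p) * (\<Sum>\<kappa>\<in>K. v \<kappa> * monomial ?n \<kappa> (\<lambda>i. x (p i))))" ..
    have "(\<Sum>p\<in>?P. of_int (sign p) * (\<Sum>\<kappa>\<in>K. v \<kappa> * monomial ?n \<kappa> (\<lambda>i. x (p i)))) = (\<Sum>\<kappa>\<in>K. \<Sum>p\<in>?P. of_int (sign p) * (v \<kappa> * monomial ?n \<kappa> (\<lambda>i. x (p i))))"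
      unfolding sum_distrib_left by (rule sum.swap)
    also have "\<dots> = (\<Sum>\<kappa>\<in>K. v \<kappa> * alt ?n \<kappa> x)"
      unfolding alt_rows sum_distrib_left by (intro sum.cong refl) (simp only: mult.left_commute)
    also have "\<dots> = (\<Sum>\<kappa>\<in>K. s \<kappa>) * alt ?n ?l x"
      unfolding sum_distrib_right by (rule sum.cong[OF refl s])
    finally show ?thesis using 1 by simp
  qed
  have "g (diagm x) = (\<Sum>\<kappa>\<in>K. s \<kappa>) / fact ?n * schur ?n lam x" if x: "inj_on x {1..?n}" for x
  proof -
    have V: "vandermonde_prod ?n x \<noteq> 0" using x by (simp add: vandermonde_prod_eq_0_iff)
    have "vandermonde_prod ?n x * (fact ?n * g (diagm x)) = vandermonde_prod ?n x * ((\<Sum>\<kappa>\<in>K. s \<kappa>) * schur ?n lam x)"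
      using avg[of x] unfolding schur_props(2)[OF lam, symmetric] by (simp only: mult.left_commute)
    then have "fact ?n * g (diagm x) = (\<Sum>\<kappa>\<in>K. s \<kappa>) * schur ?n lam x" using V by simp
    then show ?thesis by (simp add: field_simps)
  qed
  then show ?thesis by blast
qed

section \<open>Haar integrals\<close>

lemma haar_sets: "normalized_haar_measure H \<Longrightarrow> sets H = sets (restrict_space borel unitary_group)"
  by (simp add: normalized_haar_measure_def)

lemma haar_space:
  assumes "normalized_haar_measure H" shows "space H = unitary_group"
  using sets_eq_imp_space_eq[OF haar_sets[OF assms]] by (simp add: space_restrict_space)

lemma haar_finite: "normalized_haar_measure H \<Longrightarrow> finite_measure H"
  by (rule finite_measureI) (simp add: normalized_haar_measure_def)

lemma haar_measurable:
  fixes \<phi> :: "complex^'n^'n \<Rightarrow> 'b::topological_space"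
  assumes H: "normalized_haar_measure H" and \<phi>: "continuous_on unitary_group \<phi>"
  shows "\<phi> \<in> borel_measurable H"
  using borel_measurable_continuous_on_restrict[OF \<phi>] measurable_cong_sets[OF haar_sets[OF H] refl] by blast

lemma haar_integrable:
  fixes \<phi> :: "complex^'n^'n \<Rightarrow> complex"
  assumes H: "normalized_haar_measure H" and \<phi>: "continuous_on unitary_group \<phi>"
  shows "integrable H \<phi>"
proof -
  have "bounded (\<phi> ` unitary_group)"
    by (rule compact_imp_bounded[OF compact_continuous_image[OF \<phi> compact_unitary]])
  then obtain B where "\<And>U. U \<in> unitary_group \<Longrightarrow> norm (\<phi> U) \<le> B" unfolding bounded_iff by blast
  then have "AE U in H. norm (\<phi> U) \<le> B" by (intro AE_I2) (simp add: haar_space[OF H])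
  then show ?thesis
    by (rule finite_measure.integrable_const_bound[OF haar_finite[OF H] _ haar_measurable[OF H \<phi>]])
qed

lemma continuous_mm_left:
  fixes V :: "complex^'n^'n"
  shows "continuous_on S (\<lambda>U :: complex^'n^'n. V ** U)"
  by (rule continuous_on_entries) (unfold mm_nth, intro continuous_intros)

text \<open>Invariance is given for images of sets; preimages under V are images under its inverse.\<close>

lemma haar_left_invariant:
  fixes \<phi> :: "complex^'n^'n \<Rightarrow> complex"
  assumes H: "normalized_haar_measure H" and V: "V \<in> unitary_group" and \<phi>: "continuous_on unitary_group \<phi>"
  shows "(LINT U|H. \<phi> (V ** U)) = (LINT U|H. \<phi> U)"
proof -
  let ?T = "\<lambda>U :: complex^'n^'n. V ** U"
  have "?T \<in> measurable borel borel"
    by (rule borel_measurable_continuous_onI) (rule continuous_mm_left)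
  then have "?T \<in> measurable (restrict_space borel unitary_group) (restrict_space borel unitary_group)"
    by (rule measurable_restrict_space3) (auto intro: unitary_mm[OF V])
  then have T: "?T \<in> measurable H H"
    using measurable_cong_sets[OF haar_sets[OF H] haar_sets[OF H]] by blast
  have "distr H H ?T = H"
  proof (rule measure_eqI)
    fix A assume "A \<in> sets (distr H H ?T)"
    then have A: "A \<in> sets H" by simp
    have "?T -` A \<inter> space H = (\<lambda>U. conj_transpose V ** U) ` A"
    proof (rule equalityI; rule subsetI)
      fix U assume "U \<in> ?T -` A \<inter> space H"
      then have "V ** U \<in> A" by simp
      moreover have "U = conj_transpose V ** (V ** U)" by (simp add: matrix_mul_assoc unitaryD(2)[OF V])
      ultimately show "U \<in> (\<lambda>U. conj_transpose V ** U) ` A" by blast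
    next
      fix U assume "U \<in> (\<lambda>U. conj_transpose V ** U) ` A"
      then obtain W where W: "W \<in> A" "U = conj_transpose V ** W" by blast
      have "W \<in> unitary_group" using sets.sets_into_space[OF A] W(1) haar_space[OF H] by blast
      then have "U \<in> unitary_group" unfolding W(2) by (intro unitary_mm unitary_ct V)
      moreover have "V ** U = W" unfolding W(2) by (simp add: matrix_mul_assoc unitaryD(1)[OF V])
      ultimately show "U \<in> ?T -` A \<inter> space H" using W(1) by (simp add: haar_space[OF H])
    qed
    then have "emeasure (distr H H ?T) A = emeasure H ((\<lambda>U. conj_transpose V ** U) ` A)"
      using emeasure_distr[OF T A] by simp
    also have "\<dots> = emeasure H A" using H unitary_ct[OF V] A unfolding normalized_haar_measure_def by blast
    finally show "emeasure (distr H H ?T) A = emeasure H A" .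
  qed simp
  then have "(LINT U|H. \<phi> U) = (LINT U|distr H H ?T. \<phi> U)" by simp
  also have "\<dots> = (LINT U|H. \<phi> (V ** U))" by (rule integral_distr[OF T haar_measurable[OF H \<phi>]])
  finally show ?thesis ..
qed

lemma haar_const: 
  assumes "normalized_haar_measure H" shows "(LINT U|H. (c::complex)) = c"
proof -
  have "measure H (space H) = 1" using assms by (simp add: normalized_haar_measure_def measure_def)
  then show ?thesis by simp
qed

section \<open>Differentiation under the Haar integral\<close>

text \<open>Finite sums of products p(A) q(M). A linear operator in A passes through an integral over M for such
functions without any estimate.\<close>

inductive separable :: "(complex^'n^'n \<Rightarrow> complex^'n^'n \<Rightarrow> complex) \<Rightarrow> bool" where
  separable_base: "mpoly p \<Longrightarrow> mpoly q \<Longrightarrow> separable (\<lambda>A M. p A * q M)"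
| separable_add: "separable F \<Longrightarrow> separable G \<Longrightarrow> separable (\<lambda>A M. F A M + G A M)"

lemma separable_sum: "finite J \<Longrightarrow> (\<And>j. j \<in> J \<Longrightarrow> separable (F j)) \<Longrightarrow> separable (\<lambda>A M. \<Sum>j\<in>J. F j A M)"
proof (induction J rule: finite_induct)
  case empty
  show ?case using separable_base[OF mpoly_const[of 0] mpoly_const[of 0]] by simp
next
  case (insert j J)
  then show ?case by (simp add: separable_add)
qed

lemma separable_mult_base:
  assumes p: "mpoly p" and q: "mpoly q" and G: "separable G"
  shows "separable (\<lambda>A M. p A * q M * G A M)"
  using G
proof induction
  case (separable_base p' q')
  have "separable (\<lambda>A M. (p A * p' A) * (q M * q' M))"
    by (intro separable.separable_base mpoly_mult p q separable_base)
  then show ?case by (simp only: mult_ac)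
next
  case (separable_add F G)
  have "separable (\<lambda>A M. p A * q M * F A M + p A * q M * G A M)"
    by (rule separable.separable_add[OF separable_add.IH])
  then show ?case by (simp only: distrib_left)
qed

lemma separable_mult:
  assumes F: "separable F" and G: "separable G"
  shows "separable (\<lambda>A M. F A M * G A M)"
  using F
proof induction
  case (separable_base p q)
  show ?case by (rule separable_mult_base[OF separable_base G])
next
  case (separable_add F F')
  have "separable (\<lambda>A M. F A M * G A M + F' A M * G A M)"
    by (rule separable.separable_add[OF separable_add.IH])
  then show ?case by (simp only: distrib_right)
qed

lemma separable_mm:
  assumes "mpoly f" shows "separable (\<lambda>A M. f (A ** M))"
  using assms
proof induction
  case (mpoly_const c)
  show ?case using separable_base[OF mpoly.mpoly_const[of c] mpoly.mpoly_const[of 1]] by simp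
next
  case (mpoly_coord i j)
  show ?case unfolding mm_nth by (intro separable_sum separable_base mpoly.mpoly_coord) simp
next
  case (mpoly_add f g)
  show ?case by (rule separable_add[OF mpoly_add.IH])
next
  case (mpoly_mult f g)
  show ?case by (rule separable_mult[OF mpoly_mult.IH])
qed

lemma casimir_add:
  assumes f: "mpoly f" and g: "mpoly g"
  shows "casimir (\<lambda>A. f A + g A) A = casimir f A + casimir g A"
  unfolding casimir_def by (simp add: derivationD(3)[OF derivation_lder] f g mpoly_lder sum.distrib)

lemma casimir_cmult:
  assumes f: "mpoly f"
  shows "casimir (\<lambda>A. f A * c) A = casimir f A * c"
proof -
  have "lder Y (\<lambda>A. f A * c) = (\<lambda>A. lder Y f A * c)" if "mpoly f" for Y and f :: "complex^'a^'a \<Rightarrow> complex"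
    using lder_cmult[OF that, of Y c] by (simp only: mult.commute)
  then show ?thesis unfolding casimir_def by (simp add: f mpoly_lder sum_distrib_right)
qed

text \<open>The five claims are proved together: additivity of the integral and of the Casimir operator in the
induction step needs integrability and polynomiality of the summands.\<close>

lemma separable_integral:
  fixes F :: "complex^'n^'n \<Rightarrow> complex^'n^'n \<Rightarrow> complex"
  assumes H: "normalized_haar_measure H" and N: "continuous_on unitary_group N" and F: "separable F"
  shows "mpoly (\<lambda>A. LINT U|H. F A (N U)) \<and> (\<forall>A. integrable H (\<lambda>U. F A (N U))) \<and> (\<forall>M. mpoly (\<lambda>A. F A M)) \<and>
    (\<forall>A. integrable H (\<lambda>U. casimir (\<lambda>A. F A (N U)) A)) \<and>
    (\<forall>A. casimir (\<lambda>A. LINT U|H. F A (N U)) A = (LINT U|H. casimir (\<lambda>A. F A (N U)) A))"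
  using F
proof induction
  case (separable_base p q)
  have q: "integrable H (\<lambda>U. q (N U))"
    by (rule haar_integrable[OF H continuous_on_compose2[OF continuous_mpoly[OF separable_base(2), of UNIV] N]]) simp
  have 1: "(LINT U|H. p A * q (N U)) = p A * (LINT U|H. q (N U))" for A by simp
  show ?case
    unfolding 1 casimir_cmult[OF separable_base(1)]
    using q by (auto intro: mpoly_mult mpoly_const separable_base)
next
  case (separable_add F G)
  have 1: "(LINT U|H. F A (N U) + G A (N U)) = (LINT U|H. F A (N U)) + (LINT U|H. G A (N U))" for A
    using separable_add.IH by (intro Bochner_Integration.integral_add) blast+
  have 2: "casimir (\<lambda>A. F A (N U) + G A (N U)) A = casimir (\<lambda>A. F A (N U)) A + casimir (\<lambda>A. G A (N U)) A" for U A
    using separable_add.IH by (intro casimir_add) blast+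
  have 3: "casimir (\<lambda>A. (LINT U|H. F A (N U)) + (LINT U|H. G A (N U))) A = casimir (\<lambda>A. LINT U|H. F A (N U)) A + casimir (\<lambda>A. LINT U|H. G A (N U)) A" for A
    using separable_add.IH by (intro casimir_add) blast+
  have 4: "(LINT U|H. casimir (\<lambda>A. F A (N U)) A + casimir (\<lambda>A. G A (N U)) A) = (LINT U|H. casimir (\<lambda>A. F A (N U)) A) + (LINT U|H. casimir (\<lambda>A. G A (N U)) A)" for A
    using separable_add.IH by (intro Bochner_Integration.integral_add) blast+
  show ?case
    unfolding 1 2 3 4 using separable_add.IH by (auto intro: mpoly_add)
qed

section \<open>Averages of Schur functions over the unitary group\<close>

lemma inj_on_complex_of_real: "inj_on x S \<Longrightarrow> inj_on (\<lambda>i. complex_of_real (x i)) S"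
  by (rule inj_onI) (simp add: inj_on_eq_iff)

text \<open>A Schur function of the eigenvalues, as a polynomial in the entries of the matrix. The values
on eigenvalues determine it, since every matrix has eigenvalues.\<close>

definition matschur :: "(nat \<Rightarrow> nat) \<Rightarrow> complex^'n^'n \<Rightarrow> complex" where
  "matschur lam = (SOME f. mpoly f \<and> (\<forall>M x. has_eigenvalues M x \<longrightarrow> f M = schur (CARD('n)) lam x) \<and>
     weights_in (dominated (CARD('n)) (part_sum lam)) f)"

lemma matschur_props:
  assumes "lam \<in> partitions_len (CARD('n))"
  shows "mpoly (matschur lam :: complex^'n^'n \<Rightarrow> complex)"
    "has_eigenvalues M x \<Longrightarrow> matschur lam (M :: complex^'n^'n) = schur (CARD('n)) lam x"
    "weights_in (dominated (CARD('n)) (part_sum lam)) (matschur lam :: complex^'n^'n \<Rightarrow> complex)"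
proof -
  have *: "mpoly (matschur lam :: complex^'n^'n \<Rightarrow> complex) \<and>
      (\<forall>(M :: complex^'n^'n) x. has_eigenvalues M x \<longrightarrow> matschur lam M = schur (CARD('n)) lam x) \<and>
      weights_in (dominated (CARD('n)) (part_sum lam)) (matschur lam :: complex^'n^'n \<Rightarrow> complex)"
    unfolding matschur_def by (rule someI_ex[OF matschur_exists[OF assms]])
  show "mpoly (matschur lam :: complex^'n^'n \<Rightarrow> complex)" by (rule *[THEN conjunct1])
  show "has_eigenvalues M x \<Longrightarrow> matschur lam (M :: complex^'n^'n) = schur (CARD('n)) lam x"
    by (rule *[THEN conjunct2, THEN conjunct1, rule_format])
  show "weights_in (dominated (CARD('n)) (part_sum lam)) (matschur lam :: complex^'n^'n \<Rightarrow> complex)"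
    by (rule *[THEN conjunct2, THEN conjunct2])
qed

lemma uclass_matschur:
  assumes lam: "lam \<in> partitions_len (CARD('n))"
  shows "uclass (matschur lam :: complex^'n^'n \<Rightarrow> complex)"
  unfolding uclass_def
proof (intro ballI allI)
  fix U A :: "complex^'n^'n" assume U: "U \<in> unitary_group"
  obtain x where x: "has_eigenvalues A x" using has_eigenvalues_exists[of A] by blast
  show "matschur lam (U ** A ** conj_transpose U) = matschur lam A"
    using matschur_props(2)[OF lam x] matschur_props(2)[OF lam has_eigenvalues_conj[OF U x]] by simp
qed

lemma uclass_cmult: "uclass f \<Longrightarrow> uclass (\<lambda>A. c * f A)"
  by (simp add: uclass_def)

text \<open>All monomials of the alternant of lam have exponents that are permutations of lam + delta, and the
eigenvalue is symmetric in the exponents.\<close>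

lemma casimir_matschur:
  assumes lam: "lam \<in> partitions_len (CARD('n))"
  shows "casimir (matschur lam) = (\<lambda>A :: complex^'n^'n. casimir_ev (CARD('n)) (shifted (CARD('n)) lam) * matschur lam A)"
proof (rule uclass_eqI)
  let ?n = "CARD('n)" and ?f = "matschur lam :: complex^'n^'n \<Rightarrow> complex"
  note f = matschur_props(1)[OF lam] uclass_matschur[OF lam]
  show "mpoly (casimir ?f)" "uclass (casimir ?f)" by (rule mpoly_casimir[OF f(1)], rule uclass_casimir[OF f])
  show "mpoly (\<lambda>A. casimir_ev ?n (shifted ?n lam) * ?f A)" "uclass (\<lambda>A. casimir_ev ?n (shifted ?n lam) * ?f A)"
    by (intro mpoly_mult mpoly_const f, rule uclass_cmult[OF f(2)])
  fix x :: "nat \<Rightarrow> real" assume x: "inj_on x {1..?n}"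
  let ?x = "\<lambda>i. complex_of_real (x i)"
  have xi: "inj_on ?x {1..?n}" using x by (rule inj_on_complex_of_real)
  have h: "vdm (diagm y :: complex^'n^'n) * ?f (diagm y) = (\<Sum>p | p permutes {1..?n}. of_int (sign p) * monomial ?n (\<lambda>i. shifted ?n lam (p i)) y)" for y
    unfolding vdm_diagm matschur_props(2)[OF lam has_eigenvalues_diagm] schur_props(2)[OF lam] alt_def altdet_def monomial_def ..
  have E: "casimir_ev ?n (\<lambda>i. shifted ?n lam (p i)) = casimir_ev ?n (shifted ?n lam)" if p: "p permutes {1..?n}" for p
  proof -
    have "(\<Sum>i=1..?n. F (shifted ?n lam (p i))) = (\<Sum>i=1..?n. F (shifted ?n lam i))" for F :: "nat \<Rightarrow> complex"
      using sum.permute[OF p, of "\<lambda>i. F (shifted ?n lam i)"] by (simp add: comp_def)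
    from this[of "\<lambda>k. of_nat k ^ 2"] this[of of_nat] show ?thesis unfolding casimir_ev_def by (simp only:)
  qed
  have "vdm (diagm ?x :: complex^'n^'n) * casimir ?f (diagm ?x) = (\<Sum>p | p permutes {1..?n}. casimir_ev ?n (\<lambda>i. shifted ?n lam (p i)) * (of_int (sign p) * monomial ?n (\<lambda>i. shifted ?n lam (p i)) ?x))"
    by (rule vdm_casimir[OF f xi h])
  also have "\<dots> = (\<Sum>p | p permutes {1..?n}. casimir_ev ?n (shifted ?n lam) * (of_int (sign p) * monomial ?n (\<lambda>i. shifted ?n lam (p i)) ?x))"
    by (intro sum.cong refl) (simp only: mem_Collect_eq E)
  also have "\<dots> = vdm (diagm ?x :: complex^'n^'n) * (casimir_ev ?n (shifted ?n lam) * ?f (diagm ?x))"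
    unfolding sum_distrib_left[symmetric] h[symmetric] by (simp only: mult.left_commute)
  finally show "casimir ?f (diagm ?x) = casimir_ev ?n (shifted ?n lam) * ?f (diagm ?x)"
    using xi by (simp add: vdm_diagm vandermonde_prod_eq_0_iff)
qed

lemma diagm_one: "diagm (\<lambda>_. 1) = Finite_Cartesian_Product.mat 1"
  by (simp add: vec_eq_iff diagm_nth mat_nth)

lemma matschur_one:
  assumes lam: "lam \<in> partitions_len (CARD('n))"
  shows "matschur lam (Finite_Cartesian_Product.mat 1 :: complex^'n^'n) = complex_of_real (schur (CARD('n)) lam (\<lambda>_. 1))"
proof -
  have "matschur lam (diagm (\<lambda>_. 1) :: complex^'n^'n) = schur (CARD('n)) lam (\<lambda>_. 1)"
    by (rule matschur_props(2)[OF lam has_eigenvalues_diagm])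
  also have "\<dots> = complex_of_real (schur (CARD('n)) lam (\<lambda>_. 1))"
    using schur_complex_of_real[OF lam, of "\<lambda>_. 1"] by simp
  finally show ?thesis unfolding diagm_one .
qed

lemma matschur_one_nonzero:
  assumes lam: "lam \<in> partitions_len (CARD('n))"
  shows "matschur lam (Finite_Cartesian_Product.mat 1 :: complex^'n^'n) \<noteq> 0"
  using schur_one_nonzero[OF lam] by (simp add: matschur_one[OF lam])

text \<open>As a function of A, the average inherits from s_lam the eigenvalue under the Casimir operator and
the range of exponents, because both refer to the left side of the argument only, while the
conjugate of B is multiplied from the right. Hence it is a multiple of s_lam.\<close>

lemma haar_average_matschur:
  fixes A B :: "complex^'n^'n"
  assumes H: "normalized_haar_measure H" and lam: "lam \<in> partitions_len (CARD('n))"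
  shows "(LINT U|H. matschur lam (A ** (U ** B ** conj_transpose U))) = 
    matschur lam A * matschur lam B / matschur lam (Finite_Cartesian_Product.mat 1 :: complex^'n^'n)"
proof -
  let ?n = "CARD('n)" and ?f = "matschur lam :: complex^'n^'n \<Rightarrow> complex" and ?I = "Finite_Cartesian_Product.mat 1 :: complex^'n^'n"
  let ?N = "\<lambda>U. U ** B ** conj_transpose U"
  let ?E = "casimir_ev ?n (shifted ?n lam)"
  define g where "g A = (LINT U|H. ?f (A ** ?N U))" for A
  note f = matschur_props(1)[OF lam] uclass_matschur[OF lam]
  have N: "continuous_on unitary_group ?N"
    by (rule continuous_on_entries) (unfold mm_nth ct_nth, intro continuous_intros)
  have cont: "continuous_on unitary_group (\<lambda>U. q (?N U))" if "mpoly q" for q :: "complex^'n^'n \<Rightarrow> complex"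
    by (rule continuous_on_compose2[OF continuous_mpoly[OF that, of UNIV] N]) simp
  note S = separable_integral[OF H N separable_mm[OF f(1)], folded g_def]
  have g: "mpoly g" using S unfolding g_def[abs_def] by blast
  \<comment> \<open>A conjugation of A by V is moved to the second factor and absorbed by translating U.\<close>
  have gu: "uclass g"
    unfolding uclass_def
  proof (intro ballI allI)
    fix V A :: "complex^'n^'n" assume V: "V \<in> unitary_group"
    let ?\<phi> = "\<lambda>U. ?f (A ** ?N U)"
    have "?f (V ** A ** conj_transpose V ** ?N U) = ?\<phi> (conj_transpose V ** U)" for U
    proof -
      have "V ** (A ** ?N (conj_transpose V ** U)) ** conj_transpose V = V ** A ** conj_transpose V ** ?N U ** (V ** conj_transpose V)"
        by (simp add: ct_mm matrix_mul_assoc)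
      also have "\<dots> = V ** A ** conj_transpose V ** ?N U" using unitaryD(1)[OF V] by simp
      finally show ?thesis using f(2) V unfolding uclass_def by metis
    qed
    then have "g (V ** A ** conj_transpose V) = (LINT U|H. ?\<phi> (conj_transpose V ** U))" by (simp add: g_def)
    also have "\<dots> = (LINT U|H. ?\<phi> U)"
      by (rule haar_left_invariant[OF H unitary_ct[OF V] cont[OF mpoly_left[OF f(1)]]])
    finally show "g (V ** A ** conj_transpose V) = g A" by (simp add: g_def)
  qed
  \<comment> \<open>The operator passes through the integral and commutes with right multiplication.\<close>
  have gc: "casimir g = (\<lambda>A. ?E * g A)"
  proof
    fix A
    have "casimir g A = (LINT U|H. casimir (\<lambda>A. ?f (A ** ?N U)) A)"
      using S unfolding g_def[abs_def] by blast
    also have "\<dots> = (LINT U|H. ?E * ?f (A ** ?N U))" unfolding casimir_right casimir_matschur[OF lam] ..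
    also have "\<dots> = ?E * g A" unfolding g_def by simp
    finally show "casimir g A = ?E * g A" .
  qed
  obtain F q where F: "finite F" "F \<subseteq> dominated ?n (part_sum lam)" "\<And>\<nu>. mpoly (q \<nu>)"
    "\<And>x M. ?f (diagm x ** M) = (\<Sum>\<nu>\<in>F. q \<nu> M * (\<Prod>i=1..?n. x i ^ \<nu> i))"
    by (rule weights_inE[OF matschur_props(3)[OF lam]], rule that, assumption+)
  have gF: "g (diagm x) = (\<Sum>\<nu>\<in>F. (LINT U|H. q \<nu> (?N U)) * monomial ?n \<nu> x)" for x
  proof -
    have "g (diagm x) = (LINT U|H. (\<Sum>\<nu>\<in>F. q \<nu> (?N U) * monomial ?n \<nu> x))" unfolding g_def F(4) monomial_def ..
    also have "\<dots> = (\<Sum>\<nu>\<in>F. LINT U|H. q \<nu> (?N U) * monomial ?n \<nu> x)"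
      by (rule Bochner_Integration.integral_sum) (intro integrable_mult_left haar_integrable[OF H] cont F(3))
    finally show ?thesis by simp
  qed
  obtain s where s: "\<And>x. inj_on x {1..?n} \<Longrightarrow> g (diagm x) = s * schur ?n lam x"
    using eigenfunction_unique[OF lam g gu gc F(1,2) gF] by blast
  have gs: "g = (\<lambda>A. s * ?f A)"
  proof (rule uclass_eqI[OF g gu])
    show "mpoly (\<lambda>A. s * ?f A)" "uclass (\<lambda>A. s * ?f A)"
      by (intro mpoly_mult mpoly_const f, rule uclass_cmult[OF f(2)])
    fix x :: "nat \<Rightarrow> real" assume "inj_on x {1..?n}"
    then have "inj_on (\<lambda>i. complex_of_real (x i)) {1..?n}" by (rule inj_on_complex_of_real)
    then show "g (diagm (\<lambda>i. complex_of_real (x i))) = s * ?f (diagm (\<lambda>i. complex_of_real (x i)))"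
      by (simp only: s matschur_props(2)[OF lam has_eigenvalues_diagm])
  qed
  \<comment> \<open>At A = I the integrand is constant, which determines the multiple.\<close>
  have "g ?I = (LINT U|H. ?f B)"
    unfolding g_def
  proof (rule Bochner_Integration.integral_cong[OF refl])
    fix U assume "U \<in> space H"
    then have "U \<in> unitary_group" by (simp add: haar_space[OF H])
    then show "?f (?I ** ?N U) = ?f B" using f(2) by (simp add: uclass_def)
  qed
  then have "s * ?f ?I = ?f B" by (simp only: gs haar_const[OF H])
  then have "s = ?f B / ?f ?I" using matschur_one_nonzero[OF lam] by (simp add: field_simps)
  then have "g A = ?f A * ?f B / ?f ?I" unfolding gs by simp
  then show ?thesis unfolding g_def .
qed

text \<open>Both sides are class functions, so it suffices to compare them on diagonal matrices.\<close>

lemma trace_power_expansion: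
  fixes M :: "complex^'n^'n"
  shows "trace M ^ d = fact d * (\<Sum>lam\<in>partitions_of_size (CARD('n)) d. complex_of_real (expcoef (CARD('n)) lam) * matschur lam M)"
proof -
  let ?n = "CARD('n)"
  let ?h = "\<lambda>M :: complex^'n^'n. fact d * (\<Sum>lam\<in>partitions_of_size ?n d. complex_of_real (expcoef ?n lam) * matschur lam M)"
  have p: "lam \<in> partitions_len ?n" if "lam \<in> partitions_of_size ?n d" for lam using that by (simp add: partitions_of_size_def)
  have "(\<lambda>M :: complex^'n^'n. trace M ^ d) = ?h"
  proof (rule uclass_eqI)
    have "mpoly (\<lambda>M :: complex^'n^'n. \<Prod>_<d. trace M)"
      unfolding trace_def by (intro mpoly_prod mpoly_sum mpoly_coord)
    then show "mpoly (\<lambda>M :: complex^'n^'n. trace M ^ d)" by simp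
    have "trace (U ** A ** conj_transpose U) = trace A" if U: "U \<in> unitary_group" for U A :: "complex^'n^'n"
    proof -
      have "trace (U ** A ** conj_transpose U) = trace (conj_transpose U ** (U ** A))" by (rule trace_mul_sym)
      then show ?thesis by (simp add: matrix_mul_assoc unitaryD(2)[OF U])
    qed
    then show "uclass (\<lambda>M :: complex^'n^'n. trace M ^ d)" by (simp add: uclass_def)
    show "mpoly ?h" by (intro mpoly_mult mpoly_const mpoly_sum matschur_props(1)[OF p])
    show "uclass ?h"
      unfolding uclass_def
    proof (intro ballI allI)
      fix U A :: "complex^'n^'n" assume U: "U \<in> unitary_group"
      have "matschur lam (U ** A ** conj_transpose U) = matschur lam A" if "lam \<in> partitions_of_size ?n d" for lam
        using uclass_matschur[OF p[OF that]] U by (simp add: uclass_def)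
      then show "?h (U ** A ** conj_transpose U) = ?h A" by simp
    qed
    fix x :: "nat \<Rightarrow> real"
    let ?x = "\<lambda>i. complex_of_real (x i)"
    have "trace (diagm ?x :: complex^'n^'n) = (\<Sum>i=1..?n. ?x i)"
      unfolding trace_def diagm_nth using sum_idx[of ?x, where 'n = 'n] by simp
    moreover have "matschur lam (diagm ?x :: complex^'n^'n) = schur ?n lam ?x" if "lam \<in> partitions_of_size ?n d" for lam
      by (rule matschur_props(2)[OF p[OF that] has_eigenvalues_diagm])
    ultimately show "trace (diagm ?x :: complex^'n^'n) ^ d = ?h (diagm ?x)"
      using power_sum_expansion[where n = ?n and x = ?x and d = d] by simp
  qed
  then show ?thesis by (rule fun_cong)
qed

section \<open>Integrals of products of conjugates\<close>

abbreviation haar_prod :: "nat \<Rightarrow> (complex^'n^'n) measure \<Rightarrow> (nat \<Rightarrow> complex^'n^'n) measure" where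
  "haar_prod K H \<equiv> PiM {1..K} (\<lambda>_. H)"

lemma haar_product_sigma_finite: 
  "normalized_haar_measure H \<Longrightarrow> product_sigma_finite (\<lambda>_::nat. H)"
  unfolding product_sigma_finite_def using haar_finite finite_measure.axioms(1) by blast

lemma haar_prod_finite:
  assumes H: "normalized_haar_measure H" shows "finite_measure (haar_prod K H)"
proof (rule finite_measureI)
  interpret product_sigma_finite "\<lambda>_::nat. H" by (rule haar_product_sigma_finite[OF H])
  have "emeasure (haar_prod K H) (space (haar_prod K H)) = (\<Prod>i\<in>{1..K}. emeasure H (space H))"
    unfolding space_PiM by (rule emeasure_PiM) auto
  also have "\<dots> = 1" using H by (simp add: normalized_haar_measure_def)
  finally show "emeasure (haar_prod K H) (space (haar_prod K H)) \<noteq> \<infinity>" by simp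
qed

text \<open>The number K of factors is a parameter, so that the integral over the last one can be split off.\<close>

definition conj_prod :: "(nat \<Rightarrow> complex^'n^'n) \<Rightarrow> nat \<Rightarrow> (nat \<Rightarrow> complex^'n^'n) \<Rightarrow> complex^'n^'n" where
  "conj_prod X K U = ordered_matrix_prod 1 K (\<lambda>k. U k ** X k ** matrix_inv (U k))"

lemma conj_prod_0: "conj_prod X 0 U = Finite_Cartesian_Product.mat 1"
  by (simp add: conj_prod_def ordered_matrix_prod_def)

lemma foldr_mm: "foldr (**) xs (C :: complex^'n^'n) = foldr (**) xs (Finite_Cartesian_Product.mat 1) ** C"
  by (induction xs) (simp_all add: matrix_mul_assoc[symmetric])

lemma conj_prod_Suc: "conj_prod X (Suc K) U = conj_prod X K U ** (U (Suc K) ** X (Suc K) ** matrix_inv (U (Suc K)))"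
proof -
  let ?A = "\<lambda>k. U k ** X k ** matrix_inv (U k)"
  have "conj_prod X (Suc K) U = foldr (**) (map ?A [1..<Suc K]) (?A (Suc K))"
    unfolding conj_prod_def ordered_matrix_prod_def by simp
  also have "\<dots> = foldr (**) (map ?A [1..<Suc K]) (Finite_Cartesian_Product.mat 1) ** ?A (Suc K)"
    by (rule foldr_mm)
  finally show ?thesis unfolding conj_prod_def ordered_matrix_prod_def .
qed

lemma conj_prod_cong: "(\<And>k. k \<in> {1..K} \<Longrightarrow> U k = V k) \<Longrightarrow> conj_prod X K U = conj_prod X K V"
  by (induction K) (simp_all add: conj_prod_0 conj_prod_Suc)

text \<open>Bounded measurable functions are closed under sums and products, and integrable for a finite
measure; this covers all polynomials in the entries of the product matrix.\<close>

definition bdd_meas :: "'a measure \<Rightarrow> ('a \<Rightarrow> complex) \<Rightarrow> bool" where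
  "bdd_meas M f \<longleftrightarrow> f \<in> borel_measurable M \<and> (\<exists>B. \<forall>x\<in>space M. norm (f x) \<le> B)"

lemma bdd_meas_const: "bdd_meas M (\<lambda>_. c)"
  unfolding bdd_meas_def by auto

lemma bdd_meas_add:
  assumes "bdd_meas M f" "bdd_meas M g" shows "bdd_meas M (\<lambda>x. f x + g x)"
proof -
  obtain B C where B: "\<And>x. x \<in> space M \<Longrightarrow> norm (f x) \<le> B" and C: "\<And>x. x \<in> space M \<Longrightarrow> norm (g x) \<le> C"
    using assms unfolding bdd_meas_def by blast
  have "norm (f x + g x) \<le> B + C" if "x \<in> space M" for x
    using norm_triangle_le[OF add_mono[OF B[OF that] C[OF that]]] .
  then show ?thesis using assms unfolding bdd_meas_def by auto
qed

lemma bdd_meas_mult: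
  assumes "bdd_meas M f" "bdd_meas M g" shows "bdd_meas M (\<lambda>x. f x * g x)"
proof -
  obtain B C where B: "\<And>x. x \<in> space M \<Longrightarrow> norm (f x) \<le> B" and C: "\<And>x. x \<in> space M \<Longrightarrow> norm (g x) \<le> C"
    using assms unfolding bdd_meas_def by blast
  have "norm (f x * g x) \<le> B * C" if "x \<in> space M" for x
    unfolding norm_mult by (intro mult_mono B C that norm_ge_zero order.trans[OF norm_ge_zero B[OF that]])
  then show ?thesis using assms unfolding bdd_meas_def by auto
qed

lemma bdd_meas_sum: "(\<And>j. j \<in> J \<Longrightarrow> bdd_meas M (f j)) \<Longrightarrow> bdd_meas M (\<lambda>x. \<Sum>j\<in>J. f j x)"
  by (induction J rule: infinite_finite_induct) (auto intro: bdd_meas_const bdd_meas_add)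

lemma bdd_meas_mpoly:
  assumes "mpoly f" and "\<And>i j. bdd_meas M (\<lambda>x. W x $ i $ j)"
  shows "bdd_meas M (\<lambda>x. f (W x))"
  using assms(1) by induction (auto intro: bdd_meas_const bdd_meas_add bdd_meas_mult assms(2))

lemma bdd_meas_mm:
  assumes "\<And>i j. bdd_meas M (\<lambda>x. V x $ i $ j)" "\<And>i j. bdd_meas M (\<lambda>x. W x $ i $ j)"
  shows "bdd_meas M (\<lambda>x. (V x ** W x) $ i $ j)"
  unfolding mm_nth by (intro bdd_meas_sum bdd_meas_mult assms)

lemma bdd_meas_cong: "(\<And>x. x \<in> space M \<Longrightarrow> f x = g x) \<Longrightarrow> bdd_meas M g \<Longrightarrow> bdd_meas M f"
  unfolding bdd_meas_def using measurable_cong[of M f g borel] by simp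

lemma haar_prod_space:
  assumes H: "normalized_haar_measure H" and U: "U \<in> space (haar_prod K H)" and k: "k \<in> {1..K}"
  shows "U k \<in> unitary_group"
proof -
  have "U \<in> PiE {1..K} (\<lambda>_. space H)" using U unfolding space_PiM .
  then show ?thesis using PiE_mem[OF _ k] by (metis haar_space[OF H])
qed

lemma bdd_meas_component:
  assumes H: "normalized_haar_measure H" and k: "k \<in> {1..K}" and \<phi>: "continuous_on unitary_group \<phi>"
  shows "bdd_meas (haar_prod K H) (\<lambda>U. \<phi> (U k))"
proof -
  have "(\<lambda>U. U k) \<in> measurable (haar_prod K H) H"
    by (rule measurable_component_singleton[OF k, of "\<lambda>_. H"])
  then have "(\<lambda>U. \<phi> (U k)) \<in> borel_measurable (haar_prod K H)"
    using measurable_compose[OF _ haar_measurable[OF H \<phi>]] by blast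
  moreover have "bounded (\<phi> ` unitary_group)"
    by (rule compact_imp_bounded[OF compact_continuous_image[OF \<phi> compact_unitary]])
  then obtain B where B: "\<And>U. U \<in> unitary_group \<Longrightarrow> norm (\<phi> U) \<le> B" unfolding bounded_iff by blast
  ultimately show ?thesis unfolding bdd_meas_def using B[OF haar_prod_space[OF H _ k]] by blast
qed

lemma bdd_meas_conj_prod:
  fixes X :: "nat \<Rightarrow> complex^'n^'n"
  assumes H: "normalized_haar_measure H" 
  shows "k \<le> K \<Longrightarrow> bdd_meas (haar_prod K H) (\<lambda>U. conj_prod X k U $ i $ j)"
proof (induction k arbitrary: i j)
  case 0
  then show ?case by (simp add: conj_prod_0 bdd_meas_const)
next
  case (Suc k)
  have k: "Suc k \<in> {1..K}" using Suc.prems by simp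
  have 1: "bdd_meas (haar_prod K H) (\<lambda>U. conj_prod X k U $ i $ j)" for i j
    using Suc by simp
  have c: "continuous_on unitary_group (\<lambda>V. (V ** X (Suc k) ** conj_transpose V) $ i $ j)" for i j
    unfolding mm_nth ct_nth by (intro continuous_intros)
  have 2: "bdd_meas (haar_prod K H) (\<lambda>U. (U (Suc k) ** X (Suc k) ** matrix_inv (U (Suc k))) $ i $ j)" for i j
  proof (rule bdd_meas_cong[OF _ bdd_meas_component[OF H k c[of i j]]])
    fix U assume "U \<in> space (haar_prod K H)"
    then have "U (Suc k) \<in> unitary_group" by (rule haar_prod_space[OF H _ k])
    then show "(U (Suc k) ** X (Suc k) ** matrix_inv (U (Suc k))) $ i $ j = (U (Suc k) ** X (Suc k) ** conj_transpose (U (Suc k))) $ i $ j"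
      by (simp only: matrix_inv_unitary)
  qed
  show ?case unfolding conj_prod_Suc by (rule bdd_meas_mm[OF 1 2])
qed

lemma bdd_meas_integrable:
  assumes H: "normalized_haar_measure H" and f: "bdd_meas (haar_prod K H) f"
  shows "integrable (haar_prod K H) f"
proof -
  obtain B where B: "\<And>x. x \<in> space (haar_prod K H) \<Longrightarrow> norm (f x) \<le> B" using f unfolding bdd_meas_def by blast
  have "f \<in> borel_measurable (haar_prod K H)" using f by (simp add: bdd_meas_def)
  then show ?thesis
    by (intro finite_measure.integrable_const_bound[OF haar_prod_finite[OF H], where B = B] AE_I2 B)
qed

text \<open>Integrate over the last variable first: with the other variables fixed, the averaging identity
replaces the last factor by the scalar s_lam(X_K) / s_lam(I) and leaves a product with one factor
less.\<close>

lemma integral_matschur_prod: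
  fixes X :: "nat \<Rightarrow> complex^'n^'n"
  assumes H: "normalized_haar_measure H" and lam: "lam \<in> partitions_len (CARD('n))"
  shows "(LINT U|haar_prod K H. matschur lam (conj_prod X K U)) = 
    matschur lam (Finite_Cartesian_Product.mat 1 :: complex^'n^'n) *
      (\<Prod>k=1..K. matschur lam (X k) / matschur lam (Finite_Cartesian_Product.mat 1 :: complex^'n^'n))"
proof (induction K)
  case 0
  have "measure (PiM {} (\<lambda>_::nat. H)) (space (PiM {} (\<lambda>_::nat. H))) = 1"
    by (simp add: measure_def space_PiM_empty)
  then show ?case by (simp add: conj_prod_0)
next
  case (Suc K)
  let ?f = "matschur lam :: complex^'n^'n \<Rightarrow> complex" and ?I = "Finite_Cartesian_Product.mat 1 :: complex^'n^'n"
  interpret product_sigma_finite "\<lambda>_::nat. H" by (rule haar_product_sigma_finite[OF H])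
  have ins: "{1..Suc K} = insert (Suc K) {1..K}" by auto
  have "integrable (haar_prod (Suc K) H) (\<lambda>U. ?f (conj_prod X (Suc K) U))"
    by (rule bdd_meas_integrable[OF H bdd_meas_mpoly[OF matschur_props(1)[OF lam] bdd_meas_conj_prod[OF H order_refl]]])
  then have int: "integrable (PiM (insert (Suc K) {1..K}) (\<lambda>_. H)) (\<lambda>U. ?f (conj_prod X (Suc K) U))"
    unfolding ins .
  have inner: "(LINT V|H. ?f (conj_prod X (Suc K) (U(Suc K := V)))) = ?f (conj_prod X K U) * (?f (X (Suc K)) / ?f ?I)" for U
  proof -
    have "(LINT V|H. ?f (conj_prod X (Suc K) (U(Suc K := V)))) = (LINT V|H. ?f (conj_prod X K U ** (V ** X (Suc K) ** conj_transpose V)))"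
    proof (rule Bochner_Integration.integral_cong[OF refl])
      fix V assume "V \<in> space H"
      then have V: "V \<in> unitary_group" by (simp add: haar_space[OF H])
      have "conj_prod X K (U(Suc K := V)) = conj_prod X K U" by (rule conj_prod_cong) auto
      then show "?f (conj_prod X (Suc K) (U(Suc K := V))) = ?f (conj_prod X K U ** (V ** X (Suc K) ** conj_transpose V))"
        unfolding conj_prod_Suc by (simp add: matrix_inv_unitary[OF V])
    qed
    then show ?thesis using haar_average_matschur[OF H lam, of "conj_prod X K U" "X (Suc K)"] by simp
  qed
  have "(LINT U|haar_prod (Suc K) H. ?f (conj_prod X (Suc K) U)) = (LINT U|haar_prod K H. (LINT V|H. ?f (conj_prod X (Suc K) (U(Suc K := V)))))"
    unfolding ins by (rule product_integral_insert[OF _ _ int]) auto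
  also have "\<dots> = (LINT U|haar_prod K H. ?f (conj_prod X K U)) * (?f (X (Suc K)) / ?f ?I)"
    unfolding inner by simp
  also have "\<dots> = ?f ?I * (\<Prod>k=1..Suc K. ?f (X k) / ?f ?I)"
    unfolding Suc.IH by simp
  finally show ?case .
qed

definition schur_term :: "nat \<Rightarrow> nat \<Rightarrow> (nat \<Rightarrow> nat \<Rightarrow> real) \<Rightarrow> (nat \<Rightarrow> nat) \<Rightarrow> real" where
  "schur_term n m x lam = 1 / (\<Prod>j=1..n. fact (lam j + n - j)) *
                (1 / schur n lam (\<lambda>_. 1 :: real) ^ (2*m - 2)) *
                (\<Prod>k=1..2*m. schur n lam (x k))"

lemma exp_partial_bound:
  fixes z :: complex
  shows "norm (\<Sum>d<N. z ^ d / fact d) \<le> exp (norm z)"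
proof -
  have "norm (\<Sum>d<N. z ^ d / fact d) \<le> (\<Sum>d<N. norm z ^ d / fact d)"
    by (rule order.trans[OF norm_sum]) (simp add: norm_divide norm_power)
  also have "\<dots> \<le> (\<Sum>d. norm z ^ d / fact d)"
    using summable_exp[of "norm z"] by (intro sum_le_suminf) (auto simp: field_simps)
  also have "\<dots> = exp (norm z)" by (simp add: exp_def field_simps scaleR_conv_of_real)
  finally show ?thesis .
qed

text \<open>The partial sums of the exponential series of the trace are bounded by a constant, because the
unitary group is compact; the measure is finite, so dominated convergence applies.\<close>

lemma partial_sums_converge:
  fixes X :: "nat \<Rightarrow> complex^'n^'n" and x :: "nat \<Rightarrow> nat \<Rightarrow> real"
  assumes m: "m \<ge> 1" and H: "normalized_haar_measure H"
    and eig: "\<And>k. k \<in> {1..2*m} \<Longrightarrow> has_eigenvalues (X k) (\<lambda>i. complex_of_real (x k i))"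
  shows "integrable (haar_prod (2*m) H) (\<lambda>U. exp (trace (conj_prod X (2*m) U)))"
    "(\<lambda>N. complex_of_real (beta (CARD('n)) * (\<Sum>d<N. \<Sum>lam\<in>partitions_of_size (CARD('n)) d. schur_term (CARD('n)) m x lam)))
       \<longlonglongrightarrow> (LINT U|haar_prod (2*m) H. exp (trace (conj_prod X (2*m) U)))"
proof -
  let ?n = "CARD('n)" and ?M = "haar_prod (2*m) H" and ?I = "Finite_Cartesian_Product.mat 1 :: complex^'n^'n"
  let ?P = "\<lambda>U. conj_prod X (2*m) U"
  have bm: "bdd_meas ?M (\<lambda>U. f (?P U))" if "mpoly f" for f
    by (rule bdd_meas_mpoly[OF that bdd_meas_conj_prod[OF H order_refl]])
  have mt: "mpoly (trace :: complex^'n^'n \<Rightarrow> complex)"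
  proof -
    have "mpoly (\<lambda>M :: complex^'n^'n. trace M)" unfolding trace_def by (intro mpoly_sum mpoly_coord)
    then show ?thesis by simp
  qed
  have tm: "(\<lambda>U. trace (?P U)) \<in> borel_measurable ?M" using bm[OF mt] by (simp add: bdd_meas_def)
  obtain R where R: "\<And>U. U \<in> space ?M \<Longrightarrow> norm (trace (?P U)) \<le> R" using bm[OF mt] unfolding bdd_meas_def by blast
  have em: "(\<lambda>U. exp (trace (?P U))) \<in> borel_measurable ?M"
    using tm by measurable
  have pm: "(\<lambda>U. \<Sum>d<N. trace (?P U) ^ d / fact d) \<in> borel_measurable ?M" for N
    using tm by measurable
  have intR: "integrable ?M (\<lambda>_. exp R)"
    using finite_measure.integrable_const[OF haar_prod_finite[OF H]] .
  have lim: "AE U in ?M. (\<lambda>N. \<Sum>d<N. trace (?P U) ^ d / fact d) \<longlonglongrightarrow> exp (trace (?P U))"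
  proof (rule AE_I2)
    fix U
    have "(\<lambda>d. trace (?P U) ^ d /\<^sub>R fact d) sums exp (trace (?P U))" by (rule exp_converges)
    then show "(\<lambda>N. \<Sum>d<N. trace (?P U) ^ d / fact d) \<longlonglongrightarrow> exp (trace (?P U))"
      unfolding sums_def by (simp add: scaleR_conv_of_real field_simps)
  qed
  have bound: "AE U in ?M. norm (\<Sum>d<N. trace (?P U) ^ d / fact d) \<le> exp R" for N
  proof (rule AE_I2)
    fix U assume "U \<in> space ?M"
    then show "norm (\<Sum>d<N. trace (?P U) ^ d / fact d) \<le> exp R"
      using order.trans[OF exp_partial_bound[of "trace (?P U)" N]] R by simp
  qed
  note dc = integral_dominated_convergence[OF em pm intR lim bound]
  show "integrable ?M (\<lambda>U. exp (trace (?P U)))"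
    by (rule integrable_dominated_convergence[OF em pm intR lim bound])
  \<comment> \<open>The integral of the term of degree d is the part of the series with partitions of d.\<close>
  have val: "(LINT U|?M. trace (?P U) ^ d / fact d) = complex_of_real (beta ?n * (\<Sum>lam\<in>partitions_of_size ?n d. schur_term ?n m x lam))" for d
  proof -
    have p: "lam \<in> partitions_len ?n" if "lam \<in> partitions_of_size ?n d" for lam using that by (simp add: partitions_of_size_def)
    have "(LINT U|?M. trace (?P U) ^ d / fact d) = (LINT U|?M. (\<Sum>lam\<in>partitions_of_size ?n d. complex_of_real (expcoef ?n lam) * matschur lam (?P U)))"
      unfolding trace_power_expansion by simp
    also have "\<dots> = (\<Sum>lam\<in>partitions_of_size ?n d. LINT U|?M. complex_of_real (expcoef ?n lam) * matschur lam (?P U))"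
      by (rule Bochner_Integration.integral_sum) (intro integrable_mult_right bdd_meas_integrable[OF H] bm matschur_props(1)[OF p])
    also have "\<dots> = (\<Sum>lam\<in>partitions_of_size ?n d. complex_of_real (beta ?n * schur_term ?n m x lam))"
    proof (rule sum.cong[OF refl])
      fix lam assume "lam \<in> partitions_of_size ?n d"
      then have lam: "lam \<in> partitions_len ?n" by (rule p)
      let ?s = "schur ?n lam (\<lambda>_. 1 :: real)"
      have s0: "?s \<noteq> 0" by (rule schur_one_nonzero[OF lam])
      have "(\<Prod>k=1..2*m. matschur lam (X k) / matschur lam ?I) = (\<Prod>k=1..2*m. complex_of_real (schur ?n lam (x k) / ?s))"
        by (intro prod.cong refl) (simp add: matschur_props(2)[OF lam eig] schur_complex_of_real[OF lam] matschur_one[OF lam])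
      also have "\<dots> = complex_of_real ((\<Prod>k=1..2*m. schur ?n lam (x k)) / ?s ^ (2*m))"
        by (simp add: prod_dividef)
      finally have "(LINT U|?M. complex_of_real (expcoef ?n lam) * matschur lam (?P U)) =
         complex_of_real (expcoef ?n lam * (?s * ((\<Prod>k=1..2*m. schur ?n lam (x k)) / ?s ^ (2*m))))"
        by (simp only: integral_mult_right_zero integral_matschur_prod[OF H lam] matschur_one[OF lam] of_real_mult)
      also have "expcoef ?n lam * (?s * ((\<Prod>k=1..2*m. schur ?n lam (x k)) / ?s ^ (2*m))) = beta ?n * schur_term ?n m x lam"
      proof -
        have "2 * m = Suc (Suc (2 * m - 2))" using m by simp
        then have "?s ^ (2*m) = ?s * (?s * ?s ^ (2*m - 2))" by (metis power_Suc)
        then show ?thesis unfolding expcoef_eq[OF lam] schur_term_def using s0 by (simp add: field_simps)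
      qed
      finally show "(LINT U|?M. complex_of_real (expcoef ?n lam) * matschur lam (?P U)) = complex_of_real (beta ?n * schur_term ?n m x lam)" .
    qed
    finally show ?thesis by (simp add: sum_distrib_left)
  qed
  have ii: "integrable ?M (\<lambda>U. trace (?P U) ^ d / fact d)" for d
  proof -
    have "mpoly (\<lambda>M :: complex^'n^'n. (\<Prod>_<d. trace M) * (1 / fact d))" by (intro mpoly_mult mpoly_prod mpoly_const mt)
    from bdd_meas_integrable[OF H bm[OF this]] show ?thesis by simp
  qed
  have "(LINT U|?M. (\<Sum>d<N. trace (?P U) ^ d / fact d)) = complex_of_real (beta ?n * (\<Sum>d<N. \<Sum>lam\<in>partitions_of_size ?n d. schur_term ?n m x lam))" for N
    by (simp only: Bochner_Integration.integral_sum[OF ii] val of_real_sum sum_distrib_left)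
  then show "(\<lambda>N. complex_of_real (beta ?n * (\<Sum>d<N. \<Sum>lam\<in>partitions_of_size ?n d. schur_term ?n m x lam))) \<longlonglongrightarrow> (LINT U|?M. exp (trace (?P U)))"
    using dc by simp
qed

section \<open>Summation over all partitions\<close>

definition parts_below :: "nat \<Rightarrow> nat \<Rightarrow> (nat \<Rightarrow> nat) set" where
  "parts_below n N = (\<Union>d<N. partitions_of_size n d)"

lemma finite_parts_below: "finite (parts_below n N)"
  unfolding parts_below_def using finite_partitions_of_size by blast

lemma parts_below_mem: "lam \<in> parts_below n N \<longleftrightarrow> lam \<in> partitions_len n \<and> part_sum lam n < N"
  by (auto simp: parts_below_def partitions_of_size_def)

lemma sum_parts_below: "(\<Sum>lam\<in>parts_below n N. f lam) = (\<Sum>d<N. \<Sum>lam\<in>partitions_of_size n d. f lam :: real)"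
  unfolding parts_below_def
proof (rule sum.UNION_disjoint)
  show "\<forall>d\<in>{..<N}. finite (partitions_of_size n d)" by (simp add: finite_partitions_of_size)
qed (auto simp: partitions_of_size_def)

lemma finite_subset_parts_below:
  assumes "finite F" "F \<subseteq> partitions_len n" shows "\<exists>N. F \<subseteq> parts_below n N"
proof -
  let ?N = "Suc (\<Sum>lam\<in>F. part_sum lam n)"
  have "part_sum lam n < ?N" if "lam \<in> F" for lam
    using member_le_sum[OF that, of "\<lambda>lam. part_sum lam n"] assms(1) by simp
  then have "F \<subseteq> parts_below n ?N" using assms(2) by (auto simp: parts_below_mem subset_iff)
  then show ?thesis by (rule exI)
qed

lemma parts_below_filterlim: "filterlim (parts_below n) (finite_subsets_at_top (partitions_len n)) sequentially"
  unfolding filterlim_finite_subsets_at_top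
proof (intro allI impI)
  fix F assume "finite F \<and> F \<subseteq> partitions_len n"
  then obtain N where N: "F \<subseteq> parts_below n N" using finite_subset_parts_below by metis
  have "finite (parts_below n N') \<and> F \<subseteq> parts_below n N' \<and> parts_below n N' \<subseteq> partitions_len n" if "N' \<ge> N" for N'
    using N that finite_parts_below by (auto simp: parts_below_mem subset_iff)
  then show "eventually (\<lambda>N'. finite (parts_below n N') \<and> F \<subseteq> parts_below n N' \<and> parts_below n N' \<subseteq> partitions_len n) sequentially"
    unfolding eventually_sequentially by blast
qed

lemma summable_on_of_nonneg_convergent:
  fixes f :: "(nat \<Rightarrow> nat) \<Rightarrow> real"
  assumes nn: "\<And>lam. lam \<in> partitions_len n \<Longrightarrow> f lam \<ge> 0"
    and conv: "convergent (\<lambda>N. \<Sum>lam\<in>parts_below n N. f lam)"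
  shows "f summable_on partitions_len n"
proof (rule nonneg_bdd_above_summable_on[OF nn])
  obtain B where B: "\<And>N. norm (\<Sum>lam\<in>parts_below n N. f lam) \<le> B"
    using convergent_imp_Bseq[OF conv] unfolding Bseq_def by blast
  show "bdd_above (sum f ` {F. F \<subseteq> partitions_len n \<and> finite F})"
  proof (rule bdd_aboveI2)
    fix F assume "F \<in> {F. F \<subseteq> partitions_len n \<and> finite F}"
    then obtain N where N: "F \<subseteq> parts_below n N" using finite_subset_parts_below[of F n] by blast
    have "sum f F \<le> sum f (parts_below n N)"
      by (rule sum_mono2[OF finite_parts_below N]) (rule nn, simp add: parts_below_mem)
    also have "\<dots> \<le> B" using B[of N] by simp
    finally show "sum f F \<le> B" .
  qed
qed

lemma summable_on_finite_sum:
  fixes f :: "'b \<Rightarrow> 'a \<Rightarrow> real"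
  assumes "finite J" "\<And>j. j \<in> J \<Longrightarrow> f j summable_on A"
  shows "(\<lambda>x. \<Sum>j\<in>J. f j x) summable_on A"
  using assms by (induction J rule: finite_induct) (simp_all add: summable_on_add)

text \<open>If all matrices are equal, the terms are nonnegative, for the Schur functions enter with the even
powers 2m and 2m - 2; convergence of the partial sums by size is then summability. In general the
product of 2m numbers is at most the 2m-th power of the largest, hence at most the sum of all 2m-th
powers.\<close>

lemma schur_term_summable:
  fixes X :: "nat \<Rightarrow> complex^'n^'n" and x :: "nat \<Rightarrow> nat \<Rightarrow> real" and H :: "(complex^'n^'n) measure"
  assumes m: "m \<ge> 1" and H: "normalized_haar_measure H"
    and eig: "\<And>k. k \<in> {1..2*m} \<Longrightarrow> has_eigenvalues (X k) (\<lambda>i. complex_of_real (x k i))"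
  shows "schur_term (CARD('n)) m x summable_on partitions_len (CARD('n))"
proof -
  let ?n = "CARD('n)"
  let ?w = "\<lambda>lam. 1 / (\<Prod>j=1..?n. fact (lam j + ?n - j)) * (1 / schur ?n lam (\<lambda>_. 1 :: real) ^ (2*m - 2)) :: real"
  have ev: "even (2*m - 2)" by simp
  have w: "?w lam \<ge> 0" for lam
  proof -
    have "(\<Prod>j=1..?n. fact (lam j + ?n - j) :: real) \<ge> 0" by (rule prod_nonneg) simp
    moreover have "schur ?n lam (\<lambda>_. 1 :: real) ^ (2*m - 2) \<ge> 0" by (rule zero_le_even_power[OF ev])
    ultimately show ?thesis by (intro mult_nonneg_nonneg divide_nonneg_nonneg zero_le_one)
  qed
  have s: "schur_term ?n m (\<lambda>_. x k) summable_on partitions_len ?n" if k: "k \<in> {1..2*m}" for k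
  proof (rule summable_on_of_nonneg_convergent)
    show "schur_term ?n m (\<lambda>_. x k) lam \<ge> 0" for lam
      unfolding schur_term_def by (rule mult_nonneg_nonneg[OF w]) (simp add: zero_le_even_power)
    let ?S = "\<lambda>N. \<Sum>lam\<in>parts_below ?n N. schur_term ?n m (\<lambda>_. x k) lam"
    obtain L where "(\<lambda>N. complex_of_real (beta ?n * ?S N)) \<longlonglongrightarrow> L"
      using partial_sums_converge(2)[OF m H, of "\<lambda>_. X k" "\<lambda>_. x k"] eig[OF k] unfolding sum_parts_below by blast
    then have "(\<lambda>N. Re (complex_of_real (beta ?n * ?S N)) / beta ?n) \<longlonglongrightarrow> Re L / beta ?n"
      by (intro tendsto_intros) (use beta_pos[of ?n] in auto)
    moreover have "Re (complex_of_real (beta ?n * ?S N)) / beta ?n = ?S N" for N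
      using beta_pos[of ?n] by simp
    ultimately show "convergent ?S" by (auto simp: convergent_def)
  qed
  have "(\<lambda>lam. \<Sum>k=1..2*m. schur_term ?n m (\<lambda>_. x k) lam) summable_on partitions_len ?n"
    by (rule summable_on_finite_sum[OF finite_atLeastAtMost s])
  then have "(\<lambda>lam. norm (schur_term ?n m x lam)) summable_on partitions_len ?n"
  proof (rule summable_on_comparison_test)
    fix lam
    let ?y = "\<lambda>k. schur ?n lam (x k)"
    have ne: "(\<lambda>k. \<bar>?y k\<bar>) ` {1..2*m} \<noteq> {}" using m by simp
    define b where "b = Max ((\<lambda>k. \<bar>?y k\<bar>) ` {1..2*m})"
    have "b \<in> (\<lambda>k. \<bar>?y k\<bar>) ` {1..2*m}" unfolding b_def by (rule Max_in) (use ne in auto)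
    then obtain k where k: "k \<in> {1..2*m}" "b = \<bar>?y k\<bar>" by blast
    have "\<bar>\<Prod>k=1..2*m. ?y k\<bar> = (\<Prod>k=1..2*m. \<bar>?y k\<bar>)" by (rule abs_prod)
    also have "\<dots> \<le> (\<Prod>k=1..2*m. b)"
      by (rule prod_mono) (auto simp: b_def intro!: Max_ge)
    also have "\<dots> = ?y k ^ (2*m)" unfolding k(2) by (simp add: power_mult)
    also have "\<dots> \<le> (\<Sum>k=1..2*m. ?y k ^ (2*m))"
      using k(1) by (intro member_le_sum) (auto simp: zero_le_even_power)
    finally have le: "\<bar>\<Prod>k=1..2*m. ?y k\<bar> \<le> (\<Sum>k=1..2*m. ?y k ^ (2*m))" .
    have h: "(\<Sum>k=1..2*m. schur_term ?n m (\<lambda>_. x k) lam) = ?w lam * (\<Sum>k=1..2*m. ?y k ^ (2*m))"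
      unfolding schur_term_def sum_distrib_left by simp
    have "norm (schur_term ?n m x lam) = ?w lam * \<bar>\<Prod>k=1..2*m. ?y k\<bar>"
      unfolding schur_term_def real_norm_def abs_mult[of "?w lam"] using w[of lam] by (simp only: abs_of_nonneg)
    also have "\<dots> \<le> ?w lam * (\<Sum>k=1..2*m. ?y k ^ (2*m))" by (rule mult_left_mono[OF le w])
    finally show "norm (schur_term ?n m x lam) \<le> (\<Sum>k=1..2*m. schur_term ?n m (\<lambda>_. x k) lam)" unfolding h .
  qed simp
  then show ?thesis by (rule abs_summable_summable)
qed

theorem theorem4p2:
  fixes X :: "nat \<Rightarrow> complex^'n^'n"
    and x :: "nat \<Rightarrow> nat \<Rightarrow> real"
    and m n :: nat
    and H :: "(complex^'n^'n) measure"
  defines "n \<equiv> CARD('n)"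
  assumes m: "m \<ge> 1"
    and haar: "normalized_haar_measure H"
    and herm: "\<And>k. k \<in> {1..2*m} \<Longrightarrow> hermitian_matrix (X k)"
    and eig: "\<And>k. k \<in> {1..2*m} \<Longrightarrow> has_eigenvalues (X k) (\<lambda>i. complex_of_real (x k i))"
  shows "integrable (PiM {1..2*m} (\<lambda>_. H))
           (\<lambda>U. exp (trace (ordered_matrix_prod 1 (2*m) (\<lambda>k. U k ** X k ** matrix_inv (U k)))))
       \<and> (\<lambda>lam. 1 / (\<Prod>j=1..n. fact (lam j + n - j)) *
              (1 / schur n lam (\<lambda>_. 1 :: real) ^ (2*m - 2)) *
              (\<Prod>k=1..2*m. schur n lam (x k))) summable_on partitions_len n
       \<and> (LINT U|PiM {1..2*m} (\<lambda>_. H).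
            exp (trace (ordered_matrix_prod 1 (2*m) (\<lambda>k. U k ** X k ** matrix_inv (U k)))))
         = complex_of_real (beta n *
             (\<Sum>\<^sub>\<infinity>lam\<in>partitions_len n.
                1 / (\<Prod>j=1..n. fact (lam j + n - j)) *
                (1 / schur n lam (\<lambda>_. 1 :: real) ^ (2*m - 2)) *
                (\<Prod>k=1..2*m. schur n lam (x k))))"
proof -
  \<comment> \<open>The partial sums by size run through a cofinal family of finite sets, so their limit is the unordered sum.\<close>
  have sm: "schur_term n m x summable_on partitions_len n"
    unfolding n_def by (rule schur_term_summable[OF m haar eig])
  then have "(schur_term n m x has_sum (\<Sum>\<^sub>\<infinity>lam\<in>partitions_len n. schur_term n m x lam)) (partitions_len n)"
    by (rule has_sum_infsum)
  then have "(\<lambda>N. sum (schur_term n m x) (parts_below n N)) \<longlonglongrightarrow> (\<Sum>\<^sub>\<infinity>lam\<in>partitions_len n. schur_term n m x lam)"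
    unfolding has_sum_def by (rule filterlim_compose[OF _ parts_below_filterlim])
  then have "(\<lambda>N. complex_of_real (beta n * sum (schur_term n m x) (parts_below n N))) \<longlonglongrightarrow> complex_of_real (beta n * (\<Sum>\<^sub>\<infinity>lam\<in>partitions_len n. schur_term n m x lam))"
    by (intro tendsto_of_real tendsto_mult tendsto_const)
  moreover have "(\<lambda>N. complex_of_real (beta n * sum (schur_term n m x) (parts_below n N))) \<longlonglongrightarrow> (LINT U|haar_prod (2*m) H. exp (trace (conj_prod X (2*m) U)))"
    unfolding sum_parts_below n_def by (rule partial_sums_converge(2)[OF m haar eig])
  ultimately have "(LINT U|haar_prod (2*m) H. exp (trace (conj_prod X (2*m) U))) = complex_of_real (beta n * (\<Sum>\<^sub>\<infinity>lam\<in>partitions_len n. schur_term n m x lam))"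
    by (rule LIMSEQ_unique[symmetric])
  then show ?thesis
    using partial_sums_converge(1)[OF m haar eig] sm
    unfolding conj_prod_def schur_term_def by simp
qed

end
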